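(* Let $n \geq 7$, let $G$ be an $n$-dimensional twisted hypercube-like network, and let $F \subseteq V(G)\cup E(G)$ with $|F| \leq 2n-10$. Then for any two nodes $s,t \in V(G-F)$ such that $N_{G-F}(s)\setminus\{t\}\neq\emptyset$ and $N_{G-F}(t)\setminus\{s\}\neq\emptyset$, there exists a hamiltonian path or a near-hamiltonian path between $s$ and $t$ in $G-F$.
   Context: Twisted hypercube-like networks (THLNs) are defined recursively. For $n=3$, an $3$-dimensional THLN is a graph isomorphic to the following cubic graph on $8$ vertices (the $3$-dimensional locally twisted cube): vertices $a_0,a_1,a_2,a_3,b_0,b_1,b_2,b_3$, with edges forming the two $4$-cycles $a_0a_1a_2a_3a_0$ and $b_0b_1b_2b_3b_0$, together with the edges $a_0b_0$, $a_1b_1$, $a_2b_3$, $a_3b_2$. For $n\geq 4$, an $n$-dimensional THLN is any graph $G$ obtained from two $(n-1)$-dimensional THLNs $G_1,G_2$ (on disjoint vertex sets) and a bijection $\phi:V(G_1)\to V(G_2)$ by setting $V(G)=V(G_1)\cup V(G_2)$ and $E(G)=E(G_1)\cup E(G_2)\cup\{(u,\phi(u)) : u\in V(G_1)\}$. For $F\subseteq V(G)\cup E(G)$, $G-F$ is the graph with vertex set $V(G)\setminus F$ and edge set $\{(u,v)\in E(G): u,v\in V(G)\setminus F,\ (u,v)\notin F\}$. $N_{H}(u)$ denotes the set of neighbors of $u$ in the graph $H$. A hamiltonian path in a graph is a path passing through every node exactly once; a near-hamiltonian path is a path passing through every node but one exactly once. *)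

theory Defs
  imports Main
begin

text \<open>The 3-dimensional locally twisted cube: a0..a3 = 0..3, b0..b3 = 4..7.\<close>
definition LTQ3_edges :: "nat set set" where
  "LTQ3_edges = {{0,1},{1,2},{2,3},{3,0},{4,5},{5,6},{6,7},{7,4},
                 {0,4},{1,5},{2,7},{3,6}}"

inductive thln :: "nat \<Rightarrow> 'a set \<Rightarrow> 'a set set \<Rightarrow> bool" where
  base: "bij_betw f {0..<8::nat} V \<Longrightarrow> E = (\<lambda>e. f ` e) ` LTQ3_edges \<Longrightarrow> thln 3 V E"
| step: "thln n V1 E1 \<Longrightarrow> thln n V2 E2 \<Longrightarrow> V1 \<inter> V2 = {} \<Longrightarrow> bij_betw \<phi> V1 V2 \<Longrightarrow>
         thln (Suc n) (V1 \<union> V2) (E1 \<union> E2 \<union> {{u, \<phi> u} | u. u \<in> V1})"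

text \<open>G - F, where F = FV \<union> FE with FV a set of vertices and FE a set of edges.\<close>
definition del_verts :: "'a set \<Rightarrow> 'a set \<Rightarrow> 'a set" where
  "del_verts V FV = V - FV"

definition del_edges :: "'a set \<Rightarrow> 'a set set \<Rightarrow> 'a set \<Rightarrow> 'a set set \<Rightarrow> 'a set set" where
  "del_edges V E FV FE = {e \<in> E. e \<subseteq> V - FV \<and> e \<notin> FE}"

definition nbrs :: "'a set set \<Rightarrow> 'a \<Rightarrow> 'a set" where
  "nbrs E u = {v. {u, v} \<in> E}"

definition is_path :: "'a set \<Rightarrow> 'a set set \<Rightarrow> 'a list \<Rightarrow> bool" where
  "is_path V E p \<longleftrightarrow> p \<noteq> [] \<and> distinct p \<and> set p \<subseteq> V \<and>
     (\<forall>i. Suc i < length p \<longrightarrow> {p ! i, p ! Suc i} \<in> E)"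

definition ham_path_between :: "'a set \<Rightarrow> 'a set set \<Rightarrow> 'a \<Rightarrow> 'a \<Rightarrow> bool" where
  "ham_path_between V E s t \<longleftrightarrow>
     (\<exists>p. is_path V E p \<and> hd p = s \<and> last p = t \<and> set p = V)"

definition near_ham_path_between :: "'a set \<Rightarrow> 'a set set \<Rightarrow> 'a \<Rightarrow> 'a \<Rightarrow> bool" where
  "near_ham_path_between V E s t \<longleftrightarrow>
     (\<exists>p w. is_path V E p \<and> hd p = s \<and> last p = t \<and> w \<in> V \<and> set p = V - {w})"

end

theory Submission
  imports Defs
begin

text \<open>
  All statements are proved by induction on the dimension, splitting a network of dimension
  \<open>m + 1\<close> into two halves \<open>A\<close>, \<open>B\<close> joined by a perfect matching, where \<open>A\<close> carries at least as many
  faults as \<open>B\<close>. A network of dimension \<open>n\<close> is shown to be Hamilton-connected with at most \<open>n - 3\<close>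
  faults and Hamiltonian with at most \<open>n - 2\<close> faults. The step from 3 to 4 rests on a search through
  the matchings between two copies of the 3-dimensional network, which is a vertex-transitive cubic
  graph. Consequently a half with few faults is so flexible that it also admits covers by two
  disjoint paths joining two prescribed pairs of end points in one of the two possible ways.

  If \<open>A\<close> has at most \<open>2m - 10\<close> faults, the induction hypothesis yields a path of \<open>A\<close> that is prolonged
  through \<open>B\<close>. Otherwise \<open>B\<close> and the matching contain at most one fault. If both end points lie in
  \<open>A\<close>, one or two faults of \<open>A\<close> are ignored; the path from the induction hypothesis then breaks into
  at most three pieces, which are joined again by disjoint paths of \<open>B\<close>. If an end point lies in
  \<open>B\<close>, one starts instead from a cycle of \<open>A\<close> missing at most one vertex: such cycles exist for up
  to \<open>2n - 9\<close> faults in dimension \<open>n\<close>, so at most one fault has to be ignored. When the end of a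
  piece cannot cross to \<open>B\<close>, it is exchanged by a rotation, or left out while the vertex missed so
  far is inserted; two vertices cannot both be short of fault-free neighbours, since they have at
  most two common neighbours.
\<close>

section \<open>Paths and cycles spanning a vertex set\<close>

text \<open>One dimension up, the fault budget grows by two, but a single half can carry every
  fault, so it may exceed the induction hypothesis by up to two. The induction starts at
  \<open>n = 7\<close> because there \<open>2 * n - 10 = n - 3\<close> and
  \<open>2 * n - 9 = n - 2\<close>, so nothing is missed at first. The decisive count: two vertices
  of a half of dimension \<open>m\<close> with \<open>f\<close> faults keep together at least
  \<open>2 * m - 3 - f\<close> fault-free neighbours. The extreme values of \<open>f\<close> are
  \<open>2 * m - 8\<close> for paths and \<open>2 * m - 7\<close> for cycles, which leaves five and
  four. So one of the two vertices has three, respectively two, usable neighbours: a path needs the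
  third because its two end points are excluded as places of insertion. The remaining obstacles are
  degenerate positions: pieces of a single vertex, which have no two ends to cross at, and piece
  ends whose partner is a prescribed end point.\<close>

definition hpath :: "'a set set \<Rightarrow> 'a set \<Rightarrow> 'a \<Rightarrow> 'a \<Rightarrow> bool" where
  "hpath E S a b \<longleftrightarrow> (\<exists>p. p \<noteq> [] \<and> distinct p \<and> set p = S \<and> hd p = a \<and> last p = b \<and>
     successively (\<lambda>x y. {x, y} \<in> E) p)"

lemma hpathI: "p \<noteq> [] \<Longrightarrow> distinct p \<Longrightarrow> set p = S \<Longrightarrow> hd p = a \<Longrightarrow> last p = b \<Longrightarrow>
   successively (\<lambda>x y. {x, y} \<in> E) p \<Longrightarrow> hpath E S a b"
  unfolding hpath_def by blast

lemma hpath_finite: "hpath E S a b \<Longrightarrow> finite S"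
  unfolding hpath_def by auto

lemma hpath_hd_in: "hpath E S a b \<Longrightarrow> a \<in> S"
  unfolding hpath_def by auto

lemma hpath_last_in: "hpath E S a b \<Longrightarrow> b \<in> S"
  unfolding hpath_def by auto

lemma hpath_single: "hpath E {a} a a"
  unfolding hpath_def by (intro exI[of _ "[a]"]) auto

lemma hpath_rev: "hpath E S a b \<Longrightarrow> hpath E S b a"
  unfolding hpath_def
proof (elim exE conjE)
  fix p assume "p \<noteq> []" "distinct p" "set p = S" "hd p = a" "last p = b"
    "successively (\<lambda>x y. {x, y} \<in> E) p"
  then show "\<exists>p. p \<noteq> [] \<and> distinct p \<and> set p = S \<and> hd p = b \<and> last p = a \<and>
     successively (\<lambda>x y. {x, y} \<in> E) p"
    by (intro exI[of _ "rev p"]) (auto simp: hd_rev last_rev insert_commute successively_rev)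
qed

lemma hpath_mono: "hpath E S a b \<Longrightarrow> E \<subseteq> E' \<Longrightarrow> hpath E' S a b"
  unfolding hpath_def by (blast intro: successively_mono)

lemma hpath_eq_ends: "hpath E S a a \<Longrightarrow> S = {a}"
  unfolding hpath_def
proof (elim exE conjE)
  fix p assume "p \<noteq> []" "distinct p" "set p = S" "hd p = a" "last p = a"
  then show "S = {a}" by (cases p) (auto split: if_splits)
qed

text \<open>As \<open>hpath\<close> hides the list and keeps only the vertex set and the ends, all
  later surgery reduces to unions of disjoint sets and one connecting edge.\<close>

lemma hpath_join:
  assumes "hpath E S a b" "hpath E T c d" "{b, c} \<in> E" "S \<inter> T = {}"
  shows "hpath E (S \<union> T) a d"
proof -
  obtain p where p: "p \<noteq> []" "distinct p" "set p = S" "hd p = a" "last p = b"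
    "successively (\<lambda>x y. {x, y} \<in> E) p" using assms(1) unfolding hpath_def by blast
  obtain q where q: "q \<noteq> []" "distinct q" "set q = T" "hd q = c" "last q = d"
    "successively (\<lambda>x y. {x, y} \<in> E) q" using assms(2) unfolding hpath_def by blast
  show ?thesis
    by (rule hpathI[of "p @ q"]) (use p q assms(3,4) in \<open>auto simp: successively_append_iff\<close>)
qed

lemma hpath_join':
  assumes "hpath E S a b" "hpath E T c d" "{b, c} \<in> E" "S \<inter> T = {}" "U = S \<union> T"
  shows "hpath E U a d"
  using hpath_join[OF assms(1-4)] assms(5) by simp

lemma hpath_append_split:
  assumes "p \<noteq> []" "q \<noteq> []" "distinct (p @ q)" "successively (\<lambda>x y. {x, y} \<in> E) (p @ q)"
  shows "hpath E (set p) (hd p) (last p) \<and> hpath E (set q) (hd q) (last q) \<and> {last p, hd q} \<in> E \<and>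
     set p \<inter> set q = {}"
  using assms unfolding hpath_def by (auto simp: successively_append_iff)

lemma hpath_succ:
  assumes "hpath E S a b" "d \<in> S" "d \<noteq> b"
  obtains S1 S2 e where "hpath E S1 a d" "hpath E S2 e b" "{d, e} \<in> E" "S1 \<union> S2 = S" "S1 \<inter> S2 = {}"
proof -
  obtain p where p: "p \<noteq> []" "distinct p" "set p = S" "hd p = a" "last p = b"
    "successively (\<lambda>x y. {x, y} \<in> E) p" using assms(1) unfolding hpath_def by blast
  obtain ys zs where yz: "p = ys @ d # zs" using assms(2) p(3) by (metis split_list)
  have z: "zs \<noteq> []" using yz p(5) assms(3) by auto
  have "hpath E (set (ys @ [d])) (hd (ys @ [d])) (last (ys @ [d])) \<and> hpath E (set zs) (hd zs) (last zs) \<and>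
     {last (ys @ [d]), hd zs} \<in> E \<and> set (ys @ [d]) \<inter> set zs = {}"
    by (rule hpath_append_split) (use z yz p in auto)
  moreover have "hd (ys @ [d]) = a" "last zs = b" "set (ys @ [d]) \<union> set zs = S"
    using p yz z by (cases ys; auto)+
  ultimately show thesis by (intro that[of "set (ys @ [d])" "set zs" "hd zs"]) auto
qed

lemma hpath_pred:
  assumes "hpath E S a b" "d \<in> S" "d \<noteq> a"
  obtains S1 S2 e where "hpath E S1 a e" "hpath E S2 d b" "{e, d} \<in> E" "S1 \<union> S2 = S" "S1 \<inter> S2 = {}"
proof -
  obtain S1 S2 e where s: "hpath E S1 b d" "hpath E S2 e a" "{d, e} \<in> E" "S1 \<union> S2 = S" "S1 \<inter> S2 = {}"
    by (rule hpath_succ[OF hpath_rev[OF assms(1)] assms(2,3)])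
  show thesis
    by (rule that[of S2 e S1]) (use s hpath_rev in \<open>auto simp: insert_commute\<close>)
qed

lemma hpath_card1: "hpath E S a b \<Longrightarrow> card S = 1 \<longleftrightarrow> a = b"
  by (metis card_1_singletonE hpath_eq_ends hpath_hd_in hpath_last_in is_singletonI is_singleton_altdef singletonD)

text \<open>Each vertex of \<open>X\<close> lies on at most two of the \<open>card S - 1\<close>
  edges of the path, so some edge has both ends outside \<open>X\<close>, and the path is cut
  there.\<close>

lemma hpath_generic:
  assumes "hpath E S s t" "finite X" "2 * card X + 1 < card S"
  obtains S1 S2 x y where "hpath E S1 s x" "hpath E S2 y t" "{x, y} \<in> E" "S1 \<union> S2 = S"
    "S1 \<inter> S2 = {}" "x \<notin> X" "y \<notin> X"
proof -
  obtain p where p: "p \<noteq> []" "distinct p" "set p = S" "hd p = s" "last p = t"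
    "successively (\<lambda>x y. {x, y} \<in> E) p" using assms(1) unfolding hpath_def by blast
  have len: "length p = card S" using p distinct_card by fastforce
  define I where "I = {i. i < length p - 1 \<and> (p ! i \<in> X \<or> p ! Suc i \<in> X)}"
  define I1 where "I1 = {i. i < length p \<and> p ! i \<in> X}"
  have i1: "inj_on (\<lambda>i. p ! i) I1" using p(2) by (auto simp: I1_def inj_on_def nth_eq_iff_index_eq)
  have "card I1 \<le> card X"
    by (rule card_inj_on_le[OF i1]) (use assms(2) in \<open>auto simp: I1_def\<close>)
  moreover have "I \<subseteq> I1 \<union> (\<lambda>i. i - 1) ` I1"
  proof
    fix i assume "i \<in> I"
    then consider "i \<in> I1" | "Suc i \<in> I1" by (auto simp: I_def I1_def)
    then show "i \<in> I1 \<union> (\<lambda>i. i - 1) ` I1" by (cases) (auto simp: image_iff intro: bexI[of _ "Suc i"])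
  qed
  moreover have fI1: "finite I1" by (auto simp: I1_def)
  ultimately have "card I \<le> card X + card X"
    using card_mono[of "I1 \<union> (\<lambda>i. i - 1) ` I1" I] card_Un_le[of I1 "(\<lambda>i. i - 1) ` I1"]
      card_image_le[OF fI1, of "\<lambda>i. i - 1"] by auto
  then have "card I < card {i. i < length p - 1}" using assms(3) len by simp
  moreover have "finite I" unfolding I_def by auto
  ultimately have "\<not> {i. i < length p - 1} \<subseteq> I" using card_mono[of I] by (meson not_le)
  then obtain i where i: "i < length p - 1" "i \<notin> I" by blast
  let ?q = "take (Suc i) p" and ?r = "drop (Suc i) p"
  have ne: "?q \<noteq> []" "?r \<noteq> []" using i by auto
  have "hpath E (set ?q) (hd ?q) (last ?q) \<and> hpath E (set ?r) (hd ?r) (last ?r) \<and> {last ?q, hd ?r} \<in> E \<and>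
     set ?q \<inter> set ?r = {}"
    by (rule hpath_append_split) (use ne p in auto)
  moreover have "hd ?q = s" "last ?r = t" "set ?q \<union> set ?r = S"
    using p i by (auto simp: hd_append simp flip: set_append)
  moreover have "last ?q = p ! i" "hd ?r = p ! Suc i"
    using i by (auto simp: take_Suc_conv_app_nth hd_drop_conv_nth)
  moreover have "p ! i \<notin> X" "p ! Suc i \<notin> X" using i by (auto simp: I_def)
  ultimately show thesis by (intro that[of "set ?q" "last ?q" "set ?r" "hd ?r"]) auto
qed

lemma hpath_subgraph:
  assumes "hpath E S a b" "\<And>e. e \<in> E \<Longrightarrow> e \<subseteq> S \<Longrightarrow> e \<in> E'"
  shows "hpath E' S a b"
proof -
  obtain p where p: "p \<noteq> []" "distinct p" "set p = S" "hd p = a" "last p = b"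
    "successively (\<lambda>x y. {x, y} \<in> E) p" using assms(1) unfolding hpath_def by blast
  have "successively (\<lambda>x y. {x, y} \<in> E') p"
    proof (rule successively_mono[OF p(6)])
    fix x y assume "x \<in> set p" "y \<in> set p" "{x, y} \<in> E"
    then show "{x, y} \<in> E'" using p(3) by (intro assms(2)) auto
  qed
  then show ?thesis by (intro hpathI[OF p(1-5)])
qed

lemma hpath_drop_vertex:
  assumes "hpath E S s t" "x \<in> S" "s \<noteq> x"
  shows "(x = t \<and> (\<exists>a. {a, x} \<in> E \<and> hpath E (S - {x}) s a)) \<or>
    (x \<noteq> t \<and> (\<exists>S1 S2 a b. hpath E S1 s a \<and> hpath E S2 b t \<and> {a, x} \<in> E \<and> {x, b} \<in> E \<and>
       S1 \<union> S2 = S - {x} \<and> S1 \<inter> S2 = {}))"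
proof -
  obtain S1 S2 e where s: "hpath E S1 s e" "hpath E S2 x t" "{e, x} \<in> E" "S1 \<union> S2 = S" "S1 \<inter> S2 = {}"
    by (rule hpath_pred[OF assms(1,2) assms(3)[symmetric]])
  show ?thesis
  proof (cases "x = t")
    case True
    then have "S2 = {x}" using s(2) hpath_eq_ends by metis
    then have "S1 = S - {x}" using s by auto
    then show ?thesis using s True by auto
  next
    case False
    obtain T1 T2 g where g: "hpath E T1 x x" "hpath E T2 g t" "{x, g} \<in> E" "T1 \<union> T2 = S2" "T1 \<inter> T2 = {}"
      by (rule hpath_succ[OF s(2) hpath_hd_in[OF s(2)] False])
    have "T1 = {x}" using g hpath_eq_ends by metis
    then have "S1 \<union> T2 = S - {x}" "S1 \<inter> T2 = {}" using s g by auto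
    then show ?thesis using s g False by blast
  qed
qed

text \<open>A path runs through an edge at most once, so removing \<open>e\<close> breaks it at one
  place only.\<close>

lemma hpath_drop_edge:
  assumes "hpath (insert e E) S s t"
  shows "hpath E S s t \<or>
    (\<exists>S1 S2 a b. hpath E S1 s a \<and> hpath E S2 b t \<and> e = {a, b} \<and> S1 \<union> S2 = S \<and> S1 \<inter> S2 = {})"
proof -
  obtain p where p: "p \<noteq> []" "distinct p" "set p = S" "hd p = s" "last p = t"
    "successively (\<lambda>x y. {x, y} \<in> insert e E) p" using assms(1) unfolding hpath_def by blast
  show ?thesis
  proof (cases "successively (\<lambda>x y. {x, y} \<in> E) p")
    case True then show ?thesis using hpathI[OF p(1-5)] by simp
  next
    case False
    then obtain i where i: "Suc i < length p" "{p ! i, p ! Suc i} \<notin> E"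
      by (auto simp: successively_conv_nth)
    have e: "e = {p ! i, p ! Suc i}" using p(6) i by (auto simp: successively_conv_nth)
    let ?q = "take (Suc i) p" and ?r = "drop (Suc i) p"
    have ne: "?q \<noteq> []" "?r \<noteq> []" using i by auto
    have *: "hpath (insert e E) (set ?q) (hd ?q) (last ?q) \<and> hpath (insert e E) (set ?r) (hd ?r) (last ?r) \<and>
       {last ?q, hd ?r} \<in> insert e E \<and> set ?q \<inter> set ?r = {}"
      by (rule hpath_append_split) (use ne p in auto)
    moreover have **: "hd ?q = s" "last ?r = t" "set ?q \<union> set ?r = S"
      using p i by (auto simp: hd_append simp flip: set_append)
    moreover have l: "last ?q = p ! i" "hd ?r = p ! Suc i"
      using i by (auto simp: take_Suc_conv_app_nth hd_drop_conv_nth)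
    moreover have lq: "last ?q \<in> set ?q" "hd ?r \<in> set ?r" using ne last_in_set hd_in_set by blast+
    \<comment> \<open>The ends of \<open>e\<close> lie in different pieces, so neither piece
      contains \<open>e\<close> as a subset.\<close>
    have "hpath E (set ?q) (hd ?q) (last ?q)"
      by (rule hpath_subgraph[of "insert e E"]) (use * e l lq in auto)
    moreover have "hpath E (set ?r) (hd ?r) (last ?r)"
      by (rule hpath_subgraph[of "insert e E"]) (use * e l lq in auto)
    ultimately have "\<exists>S1 S2 a b. hpath E S1 s a \<and> hpath E S2 b t \<and> e = {a, b} \<and> S1 \<union> S2 = S \<and> S1 \<inter> S2 = {}"
      using e * by (intro exI[of _ "set ?q"] exI[of _ "set ?r"] exI[of _ "p ! i"] exI[of _ "p ! Suc i"]) auto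
    then show ?thesis ..
  qed
qed

text \<open>A cycle is a spanning path with adjacent ends; \<open>3 \<le> card S\<close> excludes a
  single edge run back and forth.\<close>

definition hcycle :: "'a set set \<Rightarrow> 'a set \<Rightarrow> bool" where
  "hcycle E S \<longleftrightarrow> (\<exists>a b. hpath E S a b \<and> {a, b} \<in> E \<and> 3 \<le> card S)"

lemma hcycle_finite: "hcycle E S \<Longrightarrow> finite S"
  by (auto simp: hcycle_def dest: hpath_finite)

lemma hcycle_mono: "hcycle E S \<Longrightarrow> E \<subseteq> E' \<Longrightarrow> hcycle E' S"
  unfolding hcycle_def by (meson hpath_mono subsetD)

text \<open>The closed path is opened at another place: from \<open>x\<close> back to
  \<open>a\<close>, over the closing edge to \<open>b\<close>, and back to \<open>y\<close>.\<close>

lemma hcycle_edge: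
  assumes "hpath E S a b" "{a, b} \<in> E" "hpath E S1 a x" "hpath E S2 y b" "S1 \<union> S2 = S" "S1 \<inter> S2 = {}"
  shows "hpath E S x y"
  by (rule hpath_join'[OF hpath_rev[OF assms(3)] hpath_rev[OF assms(4)]]) (use assms in auto)

lemma hcycle_at:
  assumes "hcycle E S" "x \<in> S"
  obtains p q where "p \<noteq> q" "p \<noteq> x" "q \<noteq> x" "hpath E S x p" "hpath E S x q" "{x, p} \<in> E" "{x, q} \<in> E"
proof -
  obtain a b where ab: "hpath E S a b" "{a, b} \<in> E" "3 \<le> card S" using assms(1) unfolding hcycle_def by blast
  have nab: "a \<noteq> b" using ab(3) hpath_card1[OF ab(1)] by auto
  note main = that
  have one: thesis if h: "hpath E S c d" "{c, d} \<in> E" "x = c" "c \<noteq> d" for c d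
  proof -
    obtain S1 S2 e where e: "hpath E S1 c c" "hpath E S2 e d" "{c, e} \<in> E" "S1 \<union> S2 = S" "S1 \<inter> S2 = {}"
      by (rule hpath_succ[OF h(1) hpath_hd_in[OF h(1)] h(4)])
    have "S1 = {c}" using e hpath_eq_ends by metis
    have "e \<noteq> d"
    proof
      assume "e = d"
      then have "S2 = {d}" using e hpath_eq_ends by metis
      then have "S = {c, d}" using e \<open>S1 = {c}\<close> by auto
      then show False using ab(3) by (simp add: card_insert_if split: if_splits)
    qed
    moreover have "hpath E S c e" using hcycle_edge[OF h(1,2) e(1,2,4,5)] .
    moreover have "e \<noteq> c" using e hpath_hd_in[OF e(2)] \<open>S1 = {c}\<close> by auto
    ultimately show thesis using h e by (intro main[of e d]) auto
  qed
  show thesis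
  proof (cases "x = a \<or> x = b")
    case True
    then show thesis using one[OF ab(1,2)] one[OF hpath_rev[OF ab(1)]] ab(2) nab
      by (metis insert_commute)
  next
    case False
    obtain S1 S2 e where e: "hpath E S1 a x" "hpath E S2 e b" "{x, e} \<in> E" "S1 \<union> S2 = S" "S1 \<inter> S2 = {}"
      using False by (auto intro: hpath_succ[OF ab(1) assms(2)])
    obtain T1 T2 g where g: "hpath E T1 a g" "hpath E T2 x b" "{g, x} \<in> E" "T1 \<union> T2 = S" "T1 \<inter> T2 = {}"
      using False by (auto intro: hpath_pred[OF ab(1) assms(2)])
    have x1: "hpath E S x e" using hcycle_edge[OF ab(1,2) e(1,2,4,5)] .
    have x2: "hpath E S x g" using hpath_rev[OF hcycle_edge[OF ab(1,2) g(1,2,4,5)]] .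
    show thesis
    proof (cases "e = g")
      case False
      have "e \<noteq> x" using e hpath_hd_in[OF e(2)] hpath_last_in[OF e(1)] by auto
      moreover have "g \<noteq> x" using g hpath_hd_in[OF g(2)] hpath_last_in[OF g(1)] by auto
      ultimately show thesis using False x1 x2 e(3) g(3) by (intro main[of e g]) (auto simp: insert_commute)
    next
      case True
      \<comment> \<open>\<open>e\<close> and \<open>g\<close> stem from two unrelated cuts and could
        coincide. A predecessor taken inside \<open>S1\<close> cannot, since \<open>e\<close> lies
        in \<open>S2\<close>.\<close>
      obtain U1 U2 h where h: "hpath E U1 a h" "hpath E U2 x x" "{h, x} \<in> E" "U1 \<union> U2 = S1" "U1 \<inter> U2 = {}"
        using False by (auto intro: hpath_pred[OF e(1) hpath_last_in[OF e(1)]])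
      have "U2 = {x}" using h hpath_eq_ends by metis
      have hS1: "h \<in> S1" "h \<noteq> x" using h hpath_last_in[OF h(1)] hpath_hd_in[OF h(2)] by auto
      have eS2: "e \<in> S2" using hpath_hd_in[OF e(2)] .
      have "hpath E (U2 \<union> S2) x b" by (rule hpath_join[OF h(2) e(2)]) (use e(3,4,5) h(4,5) in auto)
      moreover have "U1 \<union> (U2 \<union> S2) = S" "U1 \<inter> (U2 \<union> S2) = {}" using e(4,5) h(4,5) by auto
      ultimately have "hpath E S h x" using hcycle_edge[OF ab(1,2) h(1)] by blast
      then have "hpath E S x h" by (rule hpath_rev)
      then show thesis using hS1 eS2 hpath_last_in[OF e(1)] e(3,5) x1 h(3) by (intro main[of e h]) (auto simp: insert_commute)
    qed
  qed
qed

lemma hcycle_generic: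
  assumes "hcycle E S" "finite X" "2 * card X + 1 < card S"
  obtains x y where "hpath E S x y" "{x, y} \<in> E" "x \<notin> X" "y \<notin> X" "x \<noteq> y"
proof -
  obtain a b where ab: "hpath E S a b" "{a, b} \<in> E" "3 \<le> card S" using assms(1) unfolding hcycle_def by blast
  obtain S1 S2 x y where e: "hpath E S1 a x" "hpath E S2 y b" "{x, y} \<in> E" "S1 \<union> S2 = S"
    "S1 \<inter> S2 = {}" "x \<notin> X" "y \<notin> X" by (rule hpath_generic[OF ab(1) assms(2,3)])
  have "x \<noteq> y" using e hpath_hd_in[OF e(2)] hpath_last_in[OF e(1)] by auto
  then show thesis using hcycle_edge[OF ab(1,2) e(1,2,4,5)] e(3,6,7) by (intro that[of x y]) auto
qed

text \<open>The ends are kept distinct because both will cross the matching and need different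
  partners.\<close>

lemma hcycle_drop_vertex:
  assumes "hcycle E S"
  obtains a b where "hpath E (S - {x}) a b" "a \<noteq> b"
proof (cases "x \<in> S")
  case True
  obtain p q where p: "p \<noteq> q" "p \<noteq> x" "q \<noteq> x" "hpath E S x p" "hpath E S x q" "{x, p} \<in> E" "{x, q} \<in> E"
    by (rule hcycle_at[OF assms True])
  obtain S1 S2 e where e: "hpath E S1 x x" "hpath E S2 e p" "{x, e} \<in> E" "S1 \<union> S2 = S" "S1 \<inter> S2 = {}"
    by (rule hpath_succ[OF p(4) True p(2)[symmetric]])
  have "S1 = {x}" using e hpath_eq_ends by metis
  then have s2: "S2 = S - {x}" using e by auto
  have "q \<in> S" using hpath_last_in[OF p(5)] .
  then have "q \<in> S2" using p s2 by auto
  then have "e \<noteq> p" using e(2) hpath_eq_ends[of E S2 p] p(1) by auto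
  then show thesis using e(2) s2 by (intro that[of e p]) auto
next
  case False
  obtain a b where ab: "hpath E S a b" "{a, b} \<in> E" "3 \<le> card S" using assms(1) unfolding hcycle_def by blast
  have nab: "a \<noteq> b" using ab(3) hpath_card1[OF ab(1)] by auto
  then show thesis using ab(1) False by (intro that[of a b]) auto
qed

lemma hcycle_drop_edge:
  assumes "hcycle (insert e E) S"
  obtains a b where "hpath E S a b" "a \<noteq> b"
proof -
  obtain a b where ab: "hpath (insert e E) S a b" "{a, b} \<in> insert e E" "3 \<le> card S" 
    using assms(1) unfolding hcycle_def by blast
  have nab: "a \<noteq> b" using ab(3) hpath_card1[OF ab(1)] by auto
  from hpath_drop_edge[OF ab(1)] show thesis
  proof (elim disjE exE conjE)
    assume "hpath E S a b" then show thesis using that nab by blast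
  next
    fix S1 S2 c d assume s: "hpath E S1 a c" "hpath E S2 d b" "e = {c, d}" "S1 \<union> S2 = S" "S1 \<inter> S2 = {}"
    have cd: "c \<in> S1" "d \<in> S2" using s hpath_last_in hpath_hd_in by metis+
    show thesis
    proof (cases "{a, b} = e")
      case False
      then have "{b, a} \<in> E" using ab(2) by (auto simp: insert_commute)
      then have "hpath E (S2 \<union> S1) d c" by (rule hpath_join[OF s(2) s(1)]) (use s(5) in auto)
      then show thesis using s(4,5) cd by (intro that[of d c]) (auto simp: Un_commute)
    next
      \<comment> \<open>Here \<open>e\<close> is the closing edge and an inner edge at once, which
        would leave only two vertices.\<close>
      case True
      have "a \<in> S1" "b \<in> S2" using s hpath_last_in hpath_hd_in by metis+
      then have "a = c" "b = d" using True s cd by (auto simp: doubleton_eq_iff)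
      then have "S1 = {a}" "S2 = {b}" using s hpath_eq_ends by metis+
      then have "S = {a, b}" using s by auto
      then show thesis using ab(3) by (simp add: card_insert_if split: if_splits)
    qed
  qed
qed

section \<open>Networks split into two halves\<close>

text \<open>Adjacency lists of the 3-dimensional network, in a form that can be evaluated.\<close>

definition wn :: "nat \<Rightarrow> nat list" where
  "wn i = (if i = 0 then [1,3,4] else if i = 1 then [0,2,5] else if i = 2 then [1,3,7]
     else if i = 3 then [0,2,6] else if i = 4 then [0,5,7] else if i = 5 then [1,4,6]
     else if i = 6 then [3,5,7] else if i = 7 then [2,4,6] else [])"

lemma less_8_iff: "(i::nat) < 8 \<longleftrightarrow> i = 0 \<or> i = 1 \<or> i = 2 \<or> i = 3 \<or> i = 4 \<or> i = 5 \<or> i = 6 \<or> i = 7"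
  by auto

lemma LTQ3_iff: "{i, j} \<in> LTQ3_edges \<longleftrightarrow> i < 8 \<and> j \<in> set (wn i)"
proof -
  have "{i, j} \<in> LTQ3_edges \<longleftrightarrow> (\<exists>(a,b) \<in> {(0,1),(1,2),(2,3),(3,0),(4,5),(5,6),(6,7),(7,4),
                 (0,4),(1,5),(2,7),(3,6)}. (i = a \<and> j = b) \<or> (i = b \<and> j = a))"
    unfolding LTQ3_edges_def by (simp add: doubleton_eq_iff)
  also have "\<dots> \<longleftrightarrow> i < 8 \<and> j \<in> set (wn i)"
    unfolding less_8_iff wn_def by auto
  finally show ?thesis .
qed

lemma LTQ3_edge: assumes "e \<in> LTQ3_edges" shows "\<exists>i j. i < 8 \<and> j < 8 \<and> i \<noteq> j \<and> e = {i, j}"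
proof -
  have "\<exists>(a,b) \<in> {(0,1),(1,2),(2,3),(3,0),(4,5),(5,6),(6,7),(7,4),
                 (0,4),(1,5),(2,7),(3,6)}. e = {a, b}"
    using assms unfolding LTQ3_edges_def by simp
  then obtain a b where "(a,b) \<in> {(0,1),(1,2),(2,3),(3,0),(4,5),(5,6),(6,7),(7,4),
                 (0,4),(1,5),(2,7),(3,6::nat)}" "e = {a, b}" by blast
  then have "a < 8 \<and> b < 8 \<and> a \<noteq> b" "e = {a, b}" by auto
  then show ?thesis by blast
qed

lemma wn_less: "j \<in> set (wn i) \<Longrightarrow> j < 8"
  by (auto simp: wn_def split: if_splits)

lemma wn_card: "i < 8 \<Longrightarrow> card (set (wn i)) = 3"
  unfolding less_8_iff by (elim disjE; simp add: wn_def)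

lemma wn_codeg: assumes "i < 8" "j < 8" "i \<noteq> j" shows "card (set (wn i) \<inter> set (wn j)) \<le> 2"
proof -
  have "i \<in> set [0..<8]" "j \<in> set [0..<8]" using assms by auto
  moreover have "\<forall>i \<in> set [0..<8]. \<forall>j \<in> set [0..<8]. i \<noteq> j \<longrightarrow> length (filter (\<lambda>x. x \<in> set (wn j)) (wn i)) \<le> 2"
    by code_simp
  ultimately have "length (filter (\<lambda>x. x \<in> set (wn j)) (wn i)) \<le> 2" using assms by blast
  moreover have "set (wn i) \<inter> set (wn j) = set (filter (\<lambda>x. x \<in> set (wn j)) (wn i))" by auto
  ultimately show ?thesis using card_length le_trans by metis
qed

lemma base_nbrs:
  assumes "bij_betw f {0..<8::nat} V" "E = (\<lambda>e. f ` e) ` LTQ3_edges" "i < 8"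
  shows "{z. {f i, z} \<in> E} = f ` set (wn i)"
proof (rule set_eqI)
  fix z
  have inj: "inj_on f {0..<8}" using assms(1) bij_betw_def by auto
  show "z \<in> {z. {f i, z} \<in> E} \<longleftrightarrow> z \<in> f ` set (wn i)"
  proof
    assume "z \<in> {z. {f i, z} \<in> E}"
    then obtain e where e: "e \<in> LTQ3_edges" "{f i, z} = f ` e" using assms(2) by auto
    obtain a b where ab: "a < 8" "b < 8" "a \<noteq> b" "e = {a, b}" using LTQ3_edge[OF e(1)] by blast
    have "(f i = f a \<and> z = f b) \<or> (f i = f b \<and> z = f a)" using e(2) ab(4) by (auto simp: doubleton_eq_iff)
    then have "(i = a \<and> z = f b) \<or> (i = b \<and> z = f a)" using inj ab assms(3) by (auto simp: inj_on_def)
    then obtain j where "z = f j" "e = {i, j}" using ab by auto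
    then show "z \<in> f ` set (wn i)" using e(1) LTQ3_iff by blast
  next
    assume "z \<in> f ` set (wn i)"
    then obtain j where j: "j \<in> set (wn i)" "z = f j" by blast
    then have "{i, j} \<in> LTQ3_edges" using LTQ3_iff assms(3) by blast
    then have "f ` {i, j} \<in> E" using assms(2) by blast
    then show "z \<in> {z. {f i, z} \<in> E}" using j by simp
  qed
qed

lemma thln_basic:
  assumes "thln n V E"
  shows "finite V \<and> card V = 2 ^ n \<and> 3 \<le> n \<and> finite E \<and>
     (\<forall>e\<in>E. \<exists>x\<in>V. \<exists>y\<in>V. x \<noteq> y \<and> e = {x, y})"
  using assms
proof (induction rule: thln.induct)
  case (base f V E)
  have "\<forall>e\<in>E. \<exists>x\<in>V. \<exists>y\<in>V. x \<noteq> y \<and> e = {x, y}"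
  proof
    fix e assume "e \<in> E"
    then obtain e' where e: "e' \<in> LTQ3_edges" "e = f ` e'" using base by auto
    obtain a b where ab: "a < 8" "b < 8" "a \<noteq> b" "e' = {a, b}" using LTQ3_edge[OF e(1)] by blast
    then have "f a \<in> V" "f b \<in> V" "f a \<noteq> f b" "e = {f a, f b}"
      using base(1) e by (auto simp: bij_betw_def inj_on_def)
    then show "\<exists>x\<in>V. \<exists>y\<in>V. x \<noteq> y \<and> e = {x, y}" by blast
  qed
  moreover have "finite E" using base(2) by (simp add: LTQ3_edges_def)
  moreover have "finite V" "card V = 8" using base(1) bij_betw_finite bij_betw_same_card by fastforce+
  ultimately show ?case by simp
next
  case (step n V1 E1 V2 E2 \<phi>)
  have im: "\<phi> ` V1 = V2" using step(4) bij_betw_def by metis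
  have "{{u, \<phi> u} |u. u \<in> V1} = (\<lambda>u. {u, \<phi> u}) ` V1" by auto
  moreover have "\<forall>e\<in>{{u, \<phi> u} |u. u \<in> V1}. \<exists>x\<in>V1 \<union> V2. \<exists>y\<in>V1 \<union> V2. x \<noteq> y \<and> e = {x, y}"
  proof
    fix e assume "e \<in> {{u, \<phi> u} |u. u \<in> V1}"
    then obtain u where u: "u \<in> V1" "e = {u, \<phi> u}" by blast
    then have "\<phi> u \<in> V2" "u \<noteq> \<phi> u" using im step(3) by auto
    then show "\<exists>x\<in>V1 \<union> V2. \<exists>y\<in>V1 \<union> V2. x \<noteq> y \<and> e = {x, y}" using u by blast
  qed
  moreover have "\<forall>e\<in>E1 \<union> E2. \<exists>x\<in>V1 \<union> V2. \<exists>y\<in>V1 \<union> V2. x \<noteq> y \<and> e = {x, y}"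
  proof
    fix e assume "e \<in> E1 \<union> E2"
    then consider "e \<in> E1" | "e \<in> E2" by blast
    then show "\<exists>x\<in>V1 \<union> V2. \<exists>y\<in>V1 \<union> V2. x \<noteq> y \<and> e = {x, y}"
    proof cases
      case 1
      then obtain x y where "x \<in> V1" "y \<in> V1" "x \<noteq> y" "e = {x, y}" using step.IH(1) by blast
      then show ?thesis by blast
    next
      case 2
      then obtain x y where "x \<in> V2" "y \<in> V2" "x \<noteq> y" "e = {x, y}" using step.IH(2) by blast
      then show ?thesis by blast
    qed
  qed
  ultimately show ?case using step.IH step.hyps(3) by (simp add: card_Un_disjoint ball_Un)
qed

text \<open>\<open>FV\<close> and \<open>FE\<close> are fixed without assumptions, so the predicate
  \<open>thsplit\<close> does not mention them and one split serves every pair of fault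
  sets.\<close>

locale thsplit =
  fixes m :: nat and V :: "'a set" and E A EA B EB and \<phi> :: "'a \<Rightarrow> 'a" and FV :: "'a set" and FE :: "'a set set"
  assumes tA: "thln m A EA" and tB: "thln m B EB" and disj: "A \<inter> B = {}" and bij: "bij_betw \<phi> A B"
    and V: "V = A \<union> B" and E: "E = EA \<union> EB \<union> {{u, \<phi> u} | u. u \<in> A}"
begin

abbreviation Eg where "Eg \<equiv> E - FE"

definition crossable where "crossable x \<longleftrightarrow> x \<in> A - FV \<and> \<phi> x \<in> B - FV \<and> {x, \<phi> x} \<notin> FE"

lemma inj: "inj_on \<phi> A" and im: "\<phi> ` A = B"
  using bij by (auto simp: bij_betw_def)

lemma phi_in: "x \<in> A \<Longrightarrow> \<phi> x \<in> B"
  using im by auto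

lemma phi_eq: "x \<in> A \<Longrightarrow> y \<in> A \<Longrightarrow> \<phi> x = \<phi> y \<longleftrightarrow> x = y"
  using inj by (auto simp: inj_on_def)

lemma phi_ex: "y \<in> B \<Longrightarrow> \<exists>x\<in>A. \<phi> x = y"
  using im by auto

lemma EA_sub: "EA - FE \<subseteq> Eg" and EB_sub: "EB - FE \<subseteq> Eg"
  unfolding E by auto

lemma crossable_edge: "crossable x \<Longrightarrow> {x, \<phi> x} \<in> Eg"
  unfolding crossable_def E by auto

lemma crossable_in: "crossable x \<Longrightarrow> x \<in> A \<and> x \<notin> FV \<and> \<phi> x \<in> B \<and> \<phi> x \<notin> FV"
  unfolding crossable_def by auto

lemma finA: "finite A" and finB: "finite B" and cardA: "card A = 2 ^ m" and cardB: "card B = 2 ^ m"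
  and m3: "3 \<le> m" and finEA: "finite EA" and finEB: "finite EB"
  using thln_basic[OF tA] thln_basic[OF tB] by auto

lemma edge_A: "{x, y} \<in> E \<Longrightarrow> x \<in> A \<Longrightarrow> y \<in> A \<Longrightarrow> {x, y} \<in> EA"
proof -
  assume a: "{x, y} \<in> E" "x \<in> A" "y \<in> A"
  have "{x, y} \<notin> EB" using thln_basic[OF tB] a disj by fastforce
  moreover have "{x, y} \<notin> {{u, \<phi> u} | u. u \<in> A}" using a disj phi_in by (auto simp: doubleton_eq_iff)
  ultimately show ?thesis using a(1) E by auto
qed

lemma EA_in: "{x, y} \<in> EA \<Longrightarrow> x \<in> A \<and> y \<in> A \<and> x \<noteq> y"
  using thln_basic[OF tA] by (metis doubleton_eq_iff)

lemma EB_in: "{x, y} \<in> EB \<Longrightarrow> x \<in> B \<and> y \<in> B \<and> x \<noteq> y"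
  using thln_basic[OF tB] by (metis doubleton_eq_iff)

lemma edge_cross: "{x, y} \<in> E \<Longrightarrow> x \<in> A \<Longrightarrow> y \<in> B \<Longrightarrow> y = \<phi> x"
proof -
  assume a: "{x, y} \<in> E" "x \<in> A" "y \<in> B"
  have "{x, y} \<notin> EB" "{x, y} \<notin> EA" using EB_in EA_in a disj by blast+
  then have "{x, y} \<in> {{u, \<phi> u} | u. u \<in> A}" using a(1) E by auto
  then show ?thesis using a disj phi_in by (auto simp: doubleton_eq_iff)
qed

text \<open>With the inverse matching the halves exchange their roles, so every fact about
  \<open>A\<close> also holds for \<open>B\<close>.\<close>

lemma swap: "thsplit m V E B EB A EA (inv_into A \<phi>)"
proof
  show "thln m B EB" "thln m A EA" "B \<inter> A = {}" "V = B \<union> A" using tA tB disj V by auto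
  show "bij_betw (inv_into A \<phi>) B A" using bij by (rule bij_betw_inv_into)
  have "{{u, \<phi> u} | u. u \<in> A} = {{u, inv_into A \<phi> u} | u. u \<in> B}"
  proof (rule set_eqI, rule iffI)
    fix e assume "e \<in> {{u, \<phi> u} | u. u \<in> A}"
    then obtain u where u: "u \<in> A" "e = {u, \<phi> u}" by blast
    then have "e = {\<phi> u, inv_into A \<phi> (\<phi> u)}" "\<phi> u \<in> B" using inj phi_in by (auto simp: insert_commute)
    then show "e \<in> {{u, inv_into A \<phi> u} | u. u \<in> B}" by blast
  next
    fix e assume "e \<in> {{u, inv_into A \<phi> u} | u. u \<in> B}"
    then obtain u where u: "u \<in> B" "e = {u, inv_into A \<phi> u}" by blast
    then have "e = {inv_into A \<phi> u, \<phi> (inv_into A \<phi> u)}" "inv_into A \<phi> u \<in> A"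
      using im by (auto simp: insert_commute f_inv_into_f inv_into_into)
    then show "e \<in> {{u, \<phi> u} | u. u \<in> A}" by blast
  qed
  then show "E = EB \<union> EA \<union> {{u, inv_into A \<phi> u} | u. u \<in> B}" using E by auto
qed

end

text \<open>Only faults inside the given graph count, so that one pair of fault sets serves a network and
  its halves.\<close>

definition nfaults :: "'a set \<Rightarrow> 'a set set \<Rightarrow> 'a set \<Rightarrow> 'a set set \<Rightarrow> nat" where
  "nfaults FV FE V E = card (FV \<inter> V) + card (FE \<inter> E)"

lemma thln_splitE:
  assumes "thln n V E" "n \<noteq> 3"
  obtains m A EA B EB \<phi> where "n = Suc m" "thsplit m V E A EA B EB \<phi>"
  using assms(1)
proof (cases rule: thln.cases)
  case base then show ?thesis using assms by simp
next
  case (step m A EA B EB \<phi>)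
  then show ?thesis by (intro that[of m A EA B EB \<phi>]) (auto simp: thsplit_def)
qed

context thsplit begin

abbreviation fA where "fA \<equiv> nfaults FV FE A EA"

abbreviation fB where "fB \<equiv> nfaults FV FE B EB"

definition ncross where "ncross = card (FE \<inter> {{u, \<phi> u} | u. u \<in> A})"

lemma nfaults_split: "nfaults FV FE V E = fA + fB + ncross"
proof -
  let ?C = "{{u, \<phi> u} | u. u \<in> A}"
  have C: "?C = (\<lambda>u. {u, \<phi> u}) ` A" by auto
  have d1: "EA \<inter> EB = {}"
  proof (rule ccontr)
    assume "EA \<inter> EB \<noteq> {}"
    then obtain e where e: "e \<in> EA" "e \<in> EB" by blast
    obtain x y where "x \<in> A" "e = {x, y}" using thln_basic[OF tA] e(1) by blast
    then show False using EB_in[of x y] e(2) disj by blast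
  qed
  have d2: "EA \<inter> ?C = {}"
  proof (rule ccontr)
    assume "EA \<inter> ?C \<noteq> {}"
    then obtain u where "u \<in> A" "{u, \<phi> u} \<in> EA" by blast
    then show False using EA_in phi_in disj by blast
  qed
  have d3: "EB \<inter> ?C = {}"
  proof (rule ccontr)
    assume "EB \<inter> ?C \<noteq> {}"
    then obtain u where "u \<in> A" "{u, \<phi> u} \<in> EB" by blast
    then show False using EB_in phi_in disj by blast
  qed
  have fC: "finite ?C" using C finA by simp
  have "FE \<inter> E = (FE \<inter> EA \<union> FE \<inter> EB) \<union> (FE \<inter> ?C)" unfolding E by blast
  moreover have "card ((FE \<inter> EA \<union> FE \<inter> EB) \<union> (FE \<inter> ?C)) = card (FE \<inter> EA \<union> FE \<inter> EB) + card (FE \<inter> ?C)"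
    by (rule card_Un_disjoint) (use finEA finEB fC d2 d3 in auto)
  moreover have "card (FE \<inter> EA \<union> FE \<inter> EB) = card (FE \<inter> EA) + card (FE \<inter> EB)"
    by (rule card_Un_disjoint) (use finEA finEB d1 in auto)
  ultimately have "card (FE \<inter> E) = card (FE \<inter> EA) + card (FE \<inter> EB) + card (FE \<inter> ?C)" by simp
  moreover have "card (FV \<inter> V) = card (FV \<inter> A) + card (FV \<inter> B)"
    unfolding V Int_Un_distrib using finA finB disj by (subst card_Un_disjoint) auto
  ultimately show ?thesis unfolding nfaults_def ncross_def by simp
qed

text \<open>Different vertices of \<open>A\<close> have different partners and different matching
  edges, so each fault outside \<open>A\<close> blocks at most one crossing.\<close>

lemma card_not_cr: "card {x \<in> A - FV. \<not> crossable x} \<le> fB + ncross"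
proof -
  let ?C = "{{u, \<phi> u} | u. u \<in> A}"
  have C: "?C = (\<lambda>u. {u, \<phi> u}) ` A" by auto
  let ?X = "{x \<in> A. \<phi> x \<in> FV}" and ?Y = "{x \<in> A. {x, \<phi> x} \<in> FE}"
  have "{x \<in> A - FV. \<not> crossable x} \<subseteq> ?X \<union> ?Y" unfolding crossable_def using phi_in by auto
  then have "card {x \<in> A - FV. \<not> crossable x} \<le> card (?X \<union> ?Y)" using finA by (intro card_mono) auto
  also have "\<dots> \<le> card ?X + card ?Y" by (rule card_Un_le)
  also have "card ?X \<le> card (FV \<inter> B)"
    by (rule card_inj_on_le[of \<phi>]) (use inj phi_in finB in \<open>auto simp: inj_on_def\<close>)
  also have "card ?Y \<le> card (FE \<inter> ?C)"
  proof (rule card_inj_on_le[of "\<lambda>u. {u, \<phi> u}"])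
    show "inj_on (\<lambda>u. {u, \<phi> u}) ?Y"
      unfolding inj_on_def using disj phi_in by (auto simp: doubleton_eq_iff)
    show "finite (FE \<inter> ?C)" using C finA by simp
  qed auto
  finally show ?thesis unfolding nfaults_def ncross_def by simp
qed

end

section \<open>Fault-tolerant Hamiltonicity and path surgery across the matching\<close>

definition ham_conn :: "'a set set \<Rightarrow> 'a set \<Rightarrow> bool" where
  "ham_conn E S \<longleftrightarrow> (\<forall>p\<in>S. \<forall>q\<in>S. p \<noteq> q \<longrightarrow> hpath E S p q)"

text \<open>The unpaired 2-disjoint path cover property with sources \<open>p\<close>,
  \<open>q\<close> and sinks \<open>u\<close>, \<open>v\<close>.\<close>

definition two_dpc :: "'a set set \<Rightarrow> 'a set \<Rightarrow> bool" where
  "two_dpc E S \<longleftrightarrow> (\<forall>p\<in>S. \<forall>q\<in>S. \<forall>u\<in>S. \<forall>v\<in>S. distinct [p, q, u, v] \<longrightarrow>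
     (\<exists>S1 S2. S1 \<union> S2 = S \<and> S1 \<inter> S2 = {} \<and>
        (hpath E S1 p u \<and> hpath E S2 q v \<or> hpath E S1 p v \<and> hpath E S2 q u)))"

lemma ham_connD: "ham_conn E S \<Longrightarrow> p \<in> S \<Longrightarrow> q \<in> S \<Longrightarrow> p \<noteq> q \<Longrightarrow> hpath E S p q"
  unfolding ham_conn_def by simp

lemma ham_conn_mono: "ham_conn E S \<Longrightarrow> E \<subseteq> E' \<Longrightarrow> ham_conn E' S"
  unfolding ham_conn_def using hpath_mono[of E S _ _ E'] by simp

lemma two_dpc_mono:
  assumes "two_dpc E S" "E \<subseteq> E'" shows "two_dpc E' S"
  unfolding two_dpc_def
proof (intro ballI impI)
  fix p q u v assume a: "p \<in> S" "q \<in> S" "u \<in> S" "v \<in> S" "distinct [p, q, u, v]"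
  obtain S1 S2 where s: "S1 \<union> S2 = S" "S1 \<inter> S2 = {}"
    "hpath E S1 p u \<and> hpath E S2 q v \<or> hpath E S1 p v \<and> hpath E S2 q u"
    using assms(1) a unfolding two_dpc_def by meson
  have "hpath E' S1 p u \<and> hpath E' S2 q v \<or> hpath E' S1 p v \<and> hpath E' S2 q u"
    using s(3) hpath_mono[OF _ assms(2)] by auto
  then show "\<exists>S1 S2. S1 \<union> S2 = S \<and> S1 \<inter> S2 = {} \<and>
        (hpath E' S1 p u \<and> hpath E' S2 q v \<or> hpath E' S1 p v \<and> hpath E' S2 q u)" using s(1,2) by blast
qed

text \<open>The \<open>itself\<close> argument carries the vertex type, so that the property can
  serve as an induction statement about the dimension alone.\<close>

definition ham_conn_at :: "'a itself \<Rightarrow> nat \<Rightarrow> bool" where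
  "ham_conn_at _ n \<longleftrightarrow> (\<forall>(V::'a set) E FV FE. thln n V E \<longrightarrow> nfaults FV FE V E + 3 \<le> n \<longrightarrow> ham_conn (E - FE) (V - FV))"

definition hcycle_at :: "'a itself \<Rightarrow> nat \<Rightarrow> bool" where
  "hcycle_at _ n \<longleftrightarrow> (\<forall>(V::'a set) E FV FE. thln n V E \<longrightarrow> nfaults FV FE V E + 2 \<le> n \<longrightarrow> hcycle (E - FE) (V - FV))"

lemma nfaults_Un: "finite V \<Longrightarrow> finite X \<Longrightarrow> nfaults (FV \<union> X) FE V E \<le> nfaults FV FE V E + card X"
proof -
  assume f: "finite V" "finite X"
  have "card ((FV \<union> X) \<inter> V) \<le> card (FV \<inter> V \<union> X)" using f by (intro card_mono) auto
  also have "\<dots> \<le> card (FV \<inter> V) + card X" by (rule card_Un_le)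
  finally show ?thesis unfolding nfaults_def by simp
qed

text \<open>Vertices to be avoided are declared faulty; spare fault tolerance thus yields spanning
  paths of the half without prescribed vertices.\<close>

lemma ham_conn_del:
  assumes "ham_conn_at TYPE('a) m" "thln m (V::'a set) E" "finite X" "nfaults FV FE V E + card X + 3 \<le> m"
  shows "ham_conn (E - FE) (V - FV - X)"
proof -
  have "nfaults (FV \<union> X) FE V E + 3 \<le> m"
    using nfaults_Un[of V X FV FE E] thln_basic[OF assms(2)] assms(3,4) by linarith
  then have "ham_conn (E - FE) (V - (FV \<union> X))" using assms(1,2) unfolding ham_conn_at_def by blast
  then show ?thesis by (simp add: Diff_eq Int_assoc)
qed

lemma card_faultfree:
  assumes "thln m V E" shows "card (V - FV) + nfaults FV FE V E \<ge> 2 ^ m" "finite (V - FV)"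
proof -
  have "finite V" "card V = 2 ^ m" using thln_basic[OF assms] by auto
  moreover have "card V \<le> card (V - FV) + card (FV \<inter> V)"
  proof -
    have "V = (V - FV) \<union> (FV \<inter> V)" by blast
    then show ?thesis using card_Un_le[of "V - FV" "FV \<inter> V"] by simp
  qed
  ultimately show "card (V - FV) + nfaults FV FE V E \<ge> 2 ^ m" "finite (V - FV)" unfolding nfaults_def by auto
qed

text \<open>Equality holds at \<open>m = 3\<close>; this is enough room for generic edges in the
  steps from dimension 3 on.\<close>

lemma pow_ge: "3 \<le> m \<Longrightarrow> 2 * m + 2 \<le> (2::nat) ^ m"
proof (induction m rule: dec_induct)
  case (step n) then show ?case by simp
qed simp

text \<open>Equality holds at \<open>m = 7\<close>, where both sides are 128.\<close>

lemma pow_ge7: "7 \<le> m \<Longrightarrow> 16 * m + 16 \<le> (2::nat) ^ m"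
proof (induction m rule: dec_induct)
  case (step n) then show ?case by simp
qed simp

context thsplit begin

lemma cross_swap: "{{u, inv_into A \<phi> u} | u. u \<in> B} = {{u, \<phi> u} | u. u \<in> A}"
proof (rule set_eqI, rule iffI)
  fix e assume "e \<in> {{u, \<phi> u} | u. u \<in> A}"
  then obtain u where u: "u \<in> A" "e = {u, \<phi> u}" by blast
  then have "e = {\<phi> u, inv_into A \<phi> (\<phi> u)}" "\<phi> u \<in> B" using inj phi_in by (auto simp: insert_commute)
  then show "e \<in> {{u, inv_into A \<phi> u} | u. u \<in> B}" by blast
next
  fix e assume "e \<in> {{u, inv_into A \<phi> u} | u. u \<in> B}"
  then obtain u where u: "u \<in> B" "e = {u, inv_into A \<phi> u}" by blast
  then have "e = {inv_into A \<phi> u, \<phi> (inv_into A \<phi> u)}" "inv_into A \<phi> u \<in> A"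
    using im by (auto simp: insert_commute f_inv_into_f inv_into_into)
  then show "e \<in> {{u, \<phi> u} | u. u \<in> A}" by blast
qed

lemma inv_phi: "x \<in> A \<Longrightarrow> inv_into A \<phi> (\<phi> x) = x"
  using inj by simp

lemma crossable_swap: "x \<in> A \<Longrightarrow> thsplit.crossable B A (inv_into A \<phi>) FV FE (\<phi> x) \<longleftrightarrow> crossable x"
  unfolding thsplit.crossable_def[OF swap] crossable_def using inv_phi phi_in by (auto simp: insert_commute)

lemma fc_swap: "thsplit.ncross B (inv_into A \<phi>) FE = ncross"
  unfolding thsplit.ncross_def[OF swap] ncross_def cross_swap ..

lemma ham_conn_A_del: "ham_conn_at TYPE('a) m \<Longrightarrow> finite X \<Longrightarrow> fA + card X + 3 \<le> m \<Longrightarrow> ham_conn Eg (A - FV - X)"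
  using ham_conn_mono[OF ham_conn_del[OF _ tA] EA_sub] by blast

lemma ham_conn_B_del: "ham_conn_at TYPE('a) m \<Longrightarrow> finite X \<Longrightarrow> fB + card X + 3 \<le> m \<Longrightarrow> ham_conn Eg (B - FV - X)"
  using ham_conn_mono[OF ham_conn_del[OF _ tB] EB_sub] by blast

lemma ham_conn_A: "ham_conn_at TYPE('a) m \<Longrightarrow> fA + 3 \<le> m \<Longrightarrow> ham_conn Eg (A - FV)"
  using ham_conn_A_del[of "{}"] by simp

lemma ham_conn_B: "ham_conn_at TYPE('a) m \<Longrightarrow> fB + 3 \<le> m \<Longrightarrow> ham_conn Eg (B - FV)"
  using ham_conn_B_del[of "{}"] by simp

lemma extend_to_B:
  assumes "hpath Eg S s a" "S \<subseteq> A" "crossable a" "hpath Eg T (\<phi> a) t" "T \<subseteq> B"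
  shows "hpath Eg (S \<union> T) s t"
  by (rule hpath_join[OF assms(1,4) crossable_edge[OF assms(3)]]) (use assms disj in auto)

text \<open>The gap between \<open>a\<close> and \<open>b\<close> is bridged by a spanning path of
  \<open>T\<close>. The set \<open>T\<close> may be smaller than the fault-free part of
  \<open>B\<close>, so that vertices needed elsewhere can be reserved.\<close>

lemma link_pieces:
  assumes "hpath Eg S1 s a" "hpath Eg S2 b t" "S1 \<subseteq> A" "S2 \<subseteq> A" "S1 \<inter> S2 = {}" "crossable a" "crossable b"
    "\<phi> a \<in> T" "\<phi> b \<in> T" "T \<subseteq> B" "ham_conn Eg T"
  shows "hpath Eg (S1 \<union> S2 \<union> T) s t"
proof -
  have "a \<noteq> b" using assms hpath_last_in[OF assms(1)] hpath_hd_in[OF assms(2)] by auto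
  then have "\<phi> a \<noteq> \<phi> b" using phi_eq crossable_in assms(6,7) by blast
  then have h: "hpath Eg T (\<phi> a) (\<phi> b)" using ham_connD assms by metis
  have 1: "hpath Eg (S1 \<union> T) s (\<phi> b)" by (rule extend_to_B[OF assms(1,3,6) h assms(10)])
  show ?thesis
    by (rule hpath_join'[OF 1 assms(2)]) (use crossable_edge[OF assms(7)] assms disj in \<open>auto simp: insert_commute\<close>)
qed

lemma detour_B:
  assumes "hpath Eg S s t" "S \<subseteq> A - FV" "T \<subseteq> B" "ham_conn Eg T"
    "2 * card {x \<in> S. \<not> crossable x \<or> \<phi> x \<notin> T} + 1 < card S"
  shows "hpath Eg (S \<union> T) s t"
proof -
  have "finite {x \<in> S. \<not> crossable x \<or> \<phi> x \<notin> T}" using finA assms(2) by (auto intro: finite_subset[of _ A])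
  then obtain S1 S2 x y where s: "hpath Eg S1 s x" "hpath Eg S2 y t" "{x, y} \<in> Eg" "S1 \<union> S2 = S"
    "S1 \<inter> S2 = {}" "x \<notin> {x \<in> S. \<not> crossable x \<or> \<phi> x \<notin> T}" "y \<notin> {x \<in> S. \<not> crossable x \<or> \<phi> x \<notin> T}"
    by (rule hpath_generic[OF assms(1) _ assms(5)])
  have "x \<in> S" "y \<in> S" using s hpath_last_in[OF s(1)] hpath_hd_in[OF s(2)] by auto
  then have "hpath Eg (S1 \<union> S2 \<union> T) s t" using s assms by (intro link_pieces[OF s(1,2)]) auto
  then show ?thesis using s by simp
qed

text \<open>Which sink each source gets in the cover of \<open>T\<close> does not matter, because
  the piece \<open>M\<close> between the two covering paths can be traversed in either
  direction.\<close>

lemma thread_piece: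
  assumes "hpath Eg M b x" "M \<subseteq> A" "b \<noteq> x" "crossable b" "crossable x" "\<phi> b \<in> T" "\<phi> x \<in> T" "T \<subseteq> B"
    "p \<in> T" "q \<in> T" "p \<noteq> q" "p \<noteq> \<phi> b" "p \<noteq> \<phi> x" "q \<noteq> \<phi> b" "q \<noteq> \<phi> x" "two_dpc Eg T"
  shows "hpath Eg (M \<union> T) p q"
proof -
  have "\<phi> b \<noteq> \<phi> x" using phi_eq crossable_in assms(3-5) by blast
  then obtain S1 S2 where s: "S1 \<union> S2 = T" "S1 \<inter> S2 = {}"
    "hpath Eg S1 p (\<phi> b) \<and> hpath Eg S2 q (\<phi> x) \<or> hpath Eg S1 p (\<phi> x) \<and> hpath Eg S2 q (\<phi> b)"
    using assms(16)[unfolded two_dpc_def, rule_format, OF assms(9,10,6,7)] assms by auto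
  have main: "hpath Eg (M \<union> T) p q" if "hpath Eg M c d" "crossable c" "crossable d" "hpath Eg S1 p (\<phi> c)" "hpath Eg S2 q (\<phi> d)" for c d
  proof -
    have 1: "hpath Eg (S1 \<union> M) p d"
      by (rule hpath_join[OF that(4) that(1)]) (use crossable_edge[OF that(2)] s assms disj in \<open>auto simp: insert_commute\<close>)
    show ?thesis
      by (rule hpath_join'[OF 1 hpath_rev[OF that(5)] crossable_edge[OF that(3)]]) (use s assms disj in auto)
  qed
  show ?thesis using s(3) main[OF assms(1,4,5)] main[OF hpath_rev[OF assms(1)] assms(5,4)] by blast
qed

text \<open>The middle piece is threaded between the partners of \<open>a\<close> and
  \<open>y\<close>. It must have two different ends, since the cover needs four different vertices;
  one-vertex pieces require separate arguments.\<close>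

lemma link_three_pieces:
  assumes "hpath Eg S1 s a" "hpath Eg M b x" "hpath Eg S2 y t" "b \<noteq> x"
    "S1 \<subseteq> A" "M \<subseteq> A" "S2 \<subseteq> A" "S1 \<inter> S2 = {}" "S1 \<inter> M = {}" "S2 \<inter> M = {}"
    "crossable a" "crossable b" "crossable x" "crossable y" "\<phi> a \<in> T" "\<phi> b \<in> T" "\<phi> x \<in> T" "\<phi> y \<in> T" "T \<subseteq> B" "two_dpc Eg T"
  shows "hpath Eg (S1 \<union> M \<union> S2 \<union> T) s t"
proof -
  have i: "a \<in> S1" "b \<in> M" "x \<in> M" "y \<in> S2" 
    using hpath_last_in[OF assms(1)] hpath_hd_in[OF assms(2)] hpath_last_in[OF assms(2)] hpath_hd_in[OF assms(3)] by auto
  have iA: "a \<in> A" "b \<in> A" "x \<in> A" "y \<in> A" using i assms(5-7) by blast+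
  have ne0: "a \<noteq> y" "a \<noteq> b" "a \<noteq> x" "y \<noteq> b" "y \<noteq> x" using i assms(8-10) by blast+
  have ne: "\<phi> a \<noteq> \<phi> y" "\<phi> a \<noteq> \<phi> b" "\<phi> a \<noteq> \<phi> x" "\<phi> y \<noteq> \<phi> b" "\<phi> y \<noteq> \<phi> x"
    using ne0 by (simp_all add: phi_eq iA)
  have h: "hpath Eg (M \<union> T) (\<phi> a) (\<phi> y)"
    by (rule thread_piece[OF assms(2,6,4,12,13,16,17,19,15,18) ne(1,2,3,4,5) assms(20)])
  have 1: "hpath Eg (S1 \<union> (M \<union> T)) s (\<phi> y)"
    by (rule hpath_join[OF assms(1) h crossable_edge[OF assms(11)]]) (use assms disj in auto)
  show ?thesis
    by (rule hpath_join'[OF 1 assms(3)]) (use crossable_edge[OF assms(14)] assms disj in \<open>auto simp: insert_commute\<close>)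
qed

end

lemma thln_wlog:
  assumes "thln n V E" "n \<noteq> 3"
  obtains m A EA B EB \<phi> where "n = Suc m" "thsplit m V E A EA B EB \<phi>" "nfaults FV FE B EB \<le> nfaults FV FE A EA"
proof -
  obtain m A EA B EB \<phi> where s: "n = Suc m" "thsplit m V E A EA B EB \<phi>"
    by (rule thln_splitE[OF assms])
  show thesis
  proof (cases "nfaults FV FE B EB \<le> nfaults FV FE A EA")
    case True then show thesis using that[OF s] by blast
  next
    case False then show thesis using that[OF s(1) thsplit.swap[OF s(2)]] by simp
  qed
qed

section \<open>The 3-dimensional network\<close>

text \<open>The 3-dimensional network with at most one fault. By vertex transitivity the fault is
  the vertex 0 (encoded by 0) or the edge between 0 and a neighbour (encoded by the neighbour);
  8 encodes the absence of a fault.\<close>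

definition wadj :: "nat \<Rightarrow> nat \<Rightarrow> nat \<Rightarrow> bool" where
  "wadj k i j \<longleftrightarrow> i < 8 \<and> j \<in> set (wn i) \<and> \<not> (i = 0 \<and> j = k) \<and> \<not> (i = k \<and> j = 0)"

text \<open>\<open>wadj 0\<close> retains the edges at vertex 0; the faulty vertex is excluded only
  here. The order is the one in which the search assigns images.\<close>

definition wvs :: "nat \<Rightarrow> nat list" where
  "wvs k = (if k = 0 then [1,4,3,7,6,5,2] else [0,1,2,3,4,5,6,7])"

text \<open>One automorphism, as a list of images, for each possible image of vertex 0.\<close>

definition wauts :: "nat list list" where
  "wauts =
    [[0,1,2,3,4,5,6,7], [1,0,3,2,5,4,7,6], [2,3,0,1,7,6,5,4], [3,2,1,0,6,7,4,5], [4,5,1,0,7,6,3,2],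
     [5,4,0,1,6,7,2,3], [6,7,2,3,5,4,0,1], [7,6,3,2,4,5,1,0]]"

definition wpaths :: "nat \<Rightarrow> nat list list" where
  "wpaths k = (if k = 0 then [[1,5,4,7,6,3,2], [1,2,7,4,5,6,3], [1,5,6,3,2,7,4], [1,2,3,6,7,4,5], [1,5,4,7,2,3,6],
     [1,2,3,6,5,4,7], [2,1,5,4,7,6,3], [3,2,1,5,6,7,4], [3,2,1,5,4,7,6], [4,7,6,3,2,1,5],
     [4,5,1,2,3,6,7], [6,3,2,1,5,4,7]]
     else if k = 1 then [[0,3,6,5,4,7,2,1], [0,3,6,7,4,5,1,2], [0,4,5,1,2,7,6,3], [0,3,2,1,5,6,7,4], [0,4,7,6,3,2,1,5],
     [0,3,2,1,5,4,7,6], [0,4,5,1,2,3,6,7], [1,5,4,0,3,6,7,2], [1,2,7,6,5,4,0,3], [1,5,6,7,2,3,0,4],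
     [1,2,3,0,4,7,6,5], [1,5,4,0,3,2,7,6], [1,2,3,0,4,5,6,7], [2,1,5,6,7,4,0,3], [2,1,5,4,0,3,6,7],
     [3,0,4,5,1,2,7,6], [4,0,3,6,7,2,1,5], [4,0,3,2,1,5,6,7], [5,1,2,3,0,4,7,6], [6,3,0,4,5,1,2,7]]
     else if k = 3 then [[0,4,7,2,3,6,5,1], [0,1,5,4,7,6,3,2], [0,1,2,7,4,5,6,3], [0,1,5,6,3,2,7,4], [0,1,2,3,6,7,4,5],
     [0,1,5,4,7,2,3,6], [0,1,2,3,6,5,4,7], [1,0,4,5,6,7,2,3], [1,0,4,7,2,3,6,5], [1,0,4,5,6,3,2,7],
     [2,7,4,0,1,5,6,3], [2,3,6,7,4,0,1,5], [2,3,6,5,1,0,4,7], [3,2,7,6,5,1,0,4], [3,2,1,0,4,7,6,5],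
     [3,2,7,4,0,1,5,6], [3,2,1,0,4,5,6,7], [4,0,1,5,6,3,2,7], [5,1,0,4,7,2,3,6], [5,4,0,1,2,3,6,7]]
     else [[0,3,6,5,4,7,2,1], [0,1,5,4,7,6,3,2], [0,1,2,7,4,5,6,3], [0,1,5,6,3,2,7,4], [0,1,2,3,6,7,4,5],
     [0,1,5,4,7,2,3,6], [0,1,2,3,6,5,4,7], [1,0,3,6,5,4,7,2], [1,0,3,2,7,6,5,4], [1,0,3,2,7,4,5,6],
     [2,3,0,1,5,6,7,4], [2,1,0,3,6,7,4,5], [2,3,0,1,5,4,7,6], [2,1,0,3,6,5,4,7], [3,0,1,2,7,6,5,4],
     [3,0,1,2,7,4,5,6], [4,7,2,1,0,3,6,5], [4,5,1,0,3,2,7,6], [4,5,6,3,0,1,2,7], [5,4,7,2,1,0,3,6]])"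

text \<open>The end pairs of the paths in \<open>wpaths\<close>, as adjacency lists. Only soundness
  is claimed: an omitted pair could make the search fail, never make it wrong.\<close>

definition wends :: "nat \<Rightarrow> nat list list" where
  "wends k = (if k = 0 then [[], [2,3,4,5,6,7], [1,3], [1,2,4,6], [1,3,5,7], [1,4], [1,3,7], [1,4,6]]
     else if k = 1 then [[1,2,3,4,5,6,7], [0,2,3,4,5,6,7], [0,1,3,7], [0,1,2,6], [0,1,5,7], [0,1,4,6], [0,1,3,5,7],
     [0,1,2,4,6]]
     else if k = 3 then [[1,2,3,4,5,6,7], [0,3,5,7], [0,3,5,7], [0,1,2,4,5,6,7], [0,3,7], [0,1,2,3,6,7], [0,3,5],
     [0,1,2,3,4,5]]
     else [[1,2,3,4,5,6,7], [0,2,4,6], [0,1,4,5,6,7], [0,4,6], [0,1,2,3,5,6,7], [0,2,4,6], [0,1,2,3,4,5],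
     [0,2,4]])"

text \<open>Two disjoint paths that start in 0 and \<open>t\<close> and together span the fault-free
  network: 0 and \<open>t\<close> stand for the end points of the path sought, and the free ends,
  recorded in \<open>wpends\<close>, cross to the other copy.\<close>

definition wpairs :: "nat \<Rightarrow> (nat list \<times> nat list) list" where
  "wpairs t = (if t = 1 then [([0], [1,5,4,7,6,3,2]), ([0], [1,2,7,4,5,6,3]), ([0], [1,5,6,3,2,7,4]), ([0], [1,2,3,6,7,4,5]),
     ([0], [1,5,4,7,2,3,6]), ([0], [1,2,3,6,5,4,7]), ([0,3,6,5,4,7,2], [1]), ([0,4,5,6,7,2,3], [1]),
     ([0,3,2,7,6,5,4], [1]), ([0,4,7,2,3,6,5], [1]), ([0,3,2,7,4,5,6], [1]), ([0,4,5,6,3,2,7], [1]),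
     ([0,4,7,2], [1,5,6,3]), ([0,3,2], [1,5,6,7,4]), ([0,4,7,6,3,2], [1,5]), ([0,3,2], [1,5,4,7,6]),
     ([0,4,7], [1,5,6,3,2]), ([0,3], [1,2,7,6,5,4]), ([0,4,5], [1,2,7,6,3]), ([0,3], [1,2,7,4,5,6]),
     ([0,4,5,6,3], [1,2,7]), ([0,3,6,5], [1,2,7,4]), ([0,3,2,7,4], [1,5,6]), ([0,4], [1,5,6,3,2,7]),
     ([0,3,6], [1,2,7,4,5]), ([0,4,5], [1,2,3,6,7])]
     else if t = 2 then [([0], [2,3,6,7,4,5,1]), ([0], [2,1,5,4,7,6,3]), ([0,3,6,7,4,5,1], [2]), ([0,1], [2,7,4,5,6,3]),
     ([0,3,6,5,1], [2,7,4]), ([0,1], [2,3,6,7,4,5]), ([0,3,6], [2,7,4,5,1]), ([0,1], [2,3,6,5,4,7]),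
     ([0,1,5,4,7,6,3], [2]), ([0,3], [2,1,5,6,7,4]), ([0,4,7,6,3], [2,1,5]), ([0,3], [2,1,5,4,7,6]),
     ([0,4,7], [2,1,5,6,3]), ([0,1,5], [2,3,6,7,4]), ([0,1,5,4], [2,3,6,7]), ([0,3,6], [2,1,5,4,7])]
     else if t = 3 then [([0], [3,6,5,4,7,2,1]), ([0], [3,6,7,4,5,1,2]), ([0], [3,2,1,5,6,7,4]), ([0], [3,2,1,5,4,7,6]),
     ([0,1], [3,6,5,4,7,2]), ([0,4,5,6,7,2,1], [3]), ([0,1], [3,2,7,6,5,4]), ([0,4,5], [3,6,7,2,1]),
     ([0,1], [3,2,7,4,5,6]), ([0,4,5,6,7], [3,2,1]), ([0,4,7,6,5,1,2], [3]), ([0,1,5,4], [3,6,7,2]),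
     ([0,1,2], [3,6,7,4,5]), ([0,1,5,4,7,2], [3,6]), ([0,1,2], [3,6,5,4,7]), ([0,1,2,7,6,5,4], [3]),
     ([0,1,2,7,4,5,6], [3]), ([0,4], [3,6,7,2,1,5]), ([0,1,5,4], [3,2,7,6]), ([0,4], [3,2,1,5,6,7]),
     ([0,4,7,6], [3,2,1,5]), ([0,4,7], [3,2,1,5,6])]
     else if t = 4 then [([0], [4,7,2,3,6,5,1]), ([0], [4,5,1,2,7,6,3]), ([0], [4,7,6,3,2,1,5]), ([0], [4,5,1,2,3,6,7]),
     ([0,3,2], [4,7,6,5,1]), ([0,1], [4,5,6,7,2,3]), ([0,3,2,7,6,5,1], [4]), ([0,1], [4,7,2,3,6,5]),
     ([0,3,2,7,6], [4,5,1]), ([0,1], [4,5,6,3,2,7]), ([0,3], [4,7,6,5,1,2]), ([0,1,5], [4,7,6,3,2]),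
     ([0,3,6,7], [4,5,1,2]), ([0,1,5,6,7,2,3], [4]), ([0,1,2,3], [4,7,6,5]), ([0,3], [4,5,1,2,7,6]),
     ([0,1,2,3], [4,5,6,7]), ([0,3,6,7,2,1,5], [4]), ([0,1,5,6,3,2,7], [4]), ([0,1,5], [4,7,2,3,6]),
     ([0,1,2,3,6,5], [4,7]), ([0,3,6], [4,5,1,2,7])]
     else if t = 5 then [([0], [5,4,7,6,3,2,1]), ([0], [5,1,2,3,6,7,4]), ([0,1], [5,4,7,6,3,2]), ([0,4,7,2,1], [5,6,3]),
     ([0,1], [5,6,3,2,7,4]), ([0,4,7,6,3,2,1], [5]), ([0,1], [5,4,7,2,3,6]), ([0,4,7], [5,6,3,2,1]),
     ([0,1,2], [5,4,7,6,3]), ([0,3,6,7,4], [5,1,2]), ([0,4], [5,1,2,7,6,3]), ([0,1,2,3], [5,4,7,6]),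
     ([0,1,2,3,6,7,4], [5]), ([0,3,6], [5,1,2,7,4]), ([0,4], [5,1,2,3,6,7]), ([0,4,7], [5,1,2,3,6])]
     else if t = 6 then [([0], [6,3,2,7,4,5,1]), ([0], [6,7,4,5,1,2,3]), ([0], [6,3,2,1,5,4,7]), ([0,3,2], [6,7,4,5,1]),
     ([0,1], [6,5,4,7,2,3]), ([0,3,2,7,4], [6,5,1]), ([0,1], [6,3,2,7,4,5]), ([0,3,2,7,4,5,1], [6]),
     ([0,3,2,1], [6,5,4,7]), ([0,3], [6,7,4,5,1,2]), ([0,1,5,4,7], [6,3,2]), ([0,3], [6,5,1,2,7,4]),
     ([0,1,2,3], [6,7,4,5]), ([0,1,5,4,7,2,3], [6]), ([0,4,7], [6,5,1,2,3]), ([0,1,5], [6,3,2,7,4]),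
     ([0,1,5,4], [6,3,2,7]), ([0,4,7], [6,3,2,1,5]), ([0,3,2,1,5,4,7], [6])]
     else [([0], [7,4,5,6,3,2,1]), ([0], [7,6,3,2,1,5,4]), ([0], [7,4,5,1,2,3,6]), ([0,1], [7,4,5,6,3,2]),
     ([0,4,5,6,3], [7,2,1]), ([0,1], [7,2,3,6,5,4]), ([0,4,5], [7,6,3,2,1]), ([0,3,2,1], [7,4,5,6]),
     ([0,4,5,6,3,2,1], [7]), ([0,1,2], [7,4,5,6,3]), ([0,1,5,4], [7,6,3,2]), ([0,3,6], [7,4,5,1,2]),
     ([0,4], [7,2,1,5,6,3]), ([0,1,2,3], [7,4,5,6]), ([0,4], [7,6,3,2,1,5]), ([0,3,6], [7,2,1,5,4]),
     ([0,1,2,3,6,5,4], [7]), ([0,1,2,3,6], [7,4,5]), ([0,4,5,1,2,3,6], [7])])"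

definition wpends :: "nat \<Rightarrow> nat list list" where
  "wpends t = (if t = 1 then [[2,3,4,5,6,7], [2,3,4,5,6,7], [0,1,3,4,5,6,7], [0,1,2,4,5,6,7], [0,1,2,3,5,6,7],
     [0,1,2,3,4,6,7], [0,1,2,3,4,5], [0,1,2,3,4,5]]
     else if t = 2 then [[1,3], [0,2,3,4,5,6,7], [1,3], [0,1,2,4,5,6,7], [1,3,5,7], [1,3,4], [1,3,7], [1,3,4,6]]
     else if t = 3 then [[1,2,4,6], [0,2,3,4,5,6,7], [0,1,3,4,5,6,7], [1,2,4,6], [0,1,2,3,5,6,7], [1,2,4,6],
     [0,1,2,3,4,5,7], [1,2,4,6]]
     else if t = 4 then [[1,3,5,7], [0,2,3,4,5,6,7], [1,3,5,7], [0,1,2,4,5,6,7], [1,3,5,7], [0,1,2,3,4,6,7], [1,3,5,7],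
     [0,1,2,3,4,5,6]]
     else if t = 5 then [[1,4], [0,2,3,4,5,6,7], [1,3,4], [1,2,4,6], [0,1,2,3,5,6,7], [1,4], [1,3,4,7], [1,4,6]]
     else if t = 6 then [[1,3,7], [0,2,3,4,5,6,7], [1,3,7], [0,1,2,4,5,6,7], [1,3,5,7], [1,3,4,7], [1,3,7],
     [0,1,2,3,4,5,6]]
     else [[1,4,6], [0,2,3,4,5,6,7], [1,3,4,6], [1,2,4,6], [0,1,2,3,5,6,7], [1,4,6], [0,1,2,3,4,5,7],
     [1,4,6]])"

definition wham :: "nat list list" where
  "wham = [[0,3,6,5,4,7,2,1], [0,1,5,4,7,6,3,2], [0,1,2,7,4,5,6,3], [0,1,5,6,3,2,7,4], [0,1,2,3,6,7,4,5],
     [0,1,5,4,7,2,3,6], [0,1,2,3,6,5,4,7]]"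

text \<open>The matchings between two copies, each without its vertex 0, for which no Hamiltonian cycle
  uses exactly two matching edges, with Hamiltonian cycles that use four.\<close>

definition wleaves :: "(nat list \<times> nat list \<times> nat list \<times> nat list \<times> nat list) list" where
  "wleaves = [([3,7,6,4,5,2,0], [3,6], [2,1,5,4,7], [6,3], [4,7,2,1,5]), ([6,4,3,7,5,2,0], [3,6],
     [5,1,2,7,4], [3,6,7,4], [2,1,5]), ([3,4,5,6,7,2,0], [4,7], [2,1,5,6,3], [6,3], [7,4,5,1,2]),
     ([4,6,7,3,2,5,0], [3,6], [2,1,5,4,7], [7,4], [3,6,5,1,2]), ([7,3,4,6,2,5,0], [3,6], [5,1,2,7,4],
     [4,7,6,3], [5,1,2]), ([4,3,2,7,6,5,0], [4,7], [2,1,5,6,3], [7,4], [6,3,2,1,5]),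
     ([3,4,7,2,5,6,0], [3,6], [5,1,2,7,4], [7,4], [6,3,2,1,5]), ([4,3,6,5,2,7,0], [3,6], [5,1,2,7,4],
     [6,3], [7,4,5,1,2])]"

text \<open>Depth-first search through the injections (position to image) that extend the given list of
  assignments, cutting off as soon as an edge of the first graph is mapped to an edge of the second.\<close>

fun srch :: "nat list list \<Rightarrow> nat list list \<Rightarrow> nat list list \<Rightarrow> nat list \<Rightarrow> (nat \<times> nat) list \<Rightarrow> nat list \<Rightarrow> bool" where
  "srch L Al Bl [] pre av = (map snd pre \<in> set L)"
| "srch L Al Bl (k # ks) pre av = list_all (\<lambda>y. list_ex (\<lambda>(i, p). k \<in> set (Al ! i) \<and> y \<in> set (Bl ! p)) pre
     \<or> srch L Al Bl ks ((k, y) # pre) (remove1 y av)) av"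

text \<open>Among all branches, the one that assigns to each \<open>k\<close> the value
  \<open>g k\<close> is followed. Assignments are put in front of \<open>pre\<close>, hence the
  reversed order at a leaf.\<close>

lemma srch_sound:
  assumes "srch L Al Bl ks pre av" "\<And>i. i \<in> set ks \<Longrightarrow> g i \<in> set av" "inj_on g (set ks)" "distinct ks"
    "\<And>i p. (i, p) \<in> set pre \<Longrightarrow> p = g i" "distinct av"
  shows "(\<exists>i j. i \<in> fst ` set pre \<union> set ks \<and> j \<in> set ks \<and> j \<in> set (Al ! i) \<and> g j \<in> set (Bl ! g i)) \<or>
     map g (rev ks) @ map snd pre \<in> set L"
  using assms
proof (induction ks arbitrary: pre av)
  case Nil then show ?case by simp
next
  case (Cons k ks)
  have "g k \<in> set av" using Cons.prems(2) by simp
  then consider "list_ex (\<lambda>(i, p). k \<in> set (Al ! i) \<and> g k \<in> set (Bl ! p)) pre"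
    | "srch L Al Bl ks ((k, g k) # pre) (remove1 (g k) av)"
    using Cons.prems(1) by (auto simp: list_all_iff)
  then show ?case
  proof cases
    case 1
    then obtain i p where ip: "(i, p) \<in> set pre" "k \<in> set (Al ! i)" "g k \<in> set (Bl ! p)"
      by (auto simp: list_ex_iff)
    then have "i \<in> fst ` set pre" "p = g i" using Cons.prems(5) by force+
    then show ?thesis using ip by (intro disjI1 exI[of _ i] exI[of _ k]) auto
  next
    case 2
    have "(\<exists>i j. i \<in> fst ` set ((k, g k) # pre) \<union> set ks \<and> j \<in> set ks \<and> j \<in> set (Al ! i) \<and> g j \<in> set (Bl ! g i)) \<or>
       map g (rev ks) @ map snd ((k, g k) # pre) \<in> set L"
      by (rule Cons.IH[OF 2]) (use Cons.prems in \<open>auto simp: inj_on_def\<close>)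
    then show ?thesis by auto
  qed
qed

section \<open>Verification of the certificates and the exhaustive searches\<close>

lemma wpaths_ok:
  "\<forall>k \<in> set [0,1,3,4]. \<forall>xs \<in> set (wpaths k). xs \<noteq> [] \<and> distinct xs \<and> list_all (\<lambda>x. x \<in> set xs) (wvs k)
    \<and> list_all (\<lambda>x. x \<in> set (wvs k)) xs \<and> successively (wadj k) xs"
  by code_simp

lemma wends_ok:
  "\<forall>k \<in> set [0,1,3,4]. \<forall>i \<in> set [0..<8]. \<forall>j \<in> set (wends k ! i). \<exists>xs \<in> set (wpaths k).
    (hd xs = i \<and> last xs = j) \<or> (hd xs = j \<and> last xs = i)"
  by code_simp

lemma wpairs_ok:
  "\<forall>t \<in> set [1..<8]. \<forall>(p, q) \<in> set (wpairs t). p \<noteq> [] \<and> q \<noteq> [] \<and> distinct (p @ q) \<and> hd p = 0 \<and> hd q = t \<and>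
    list_all (\<lambda>x. x \<in> set (p @ q)) [0..<8] \<and> list_all (\<lambda>x. x < 8) (p @ q) \<and> successively (wadj 8) p \<and> successively (wadj 8) q"
  by code_simp

lemma wpends_ok:
  "\<forall>t \<in> set [1..<8]. \<forall>i \<in> set [0..<8]. \<forall>j \<in> set (wpends t ! i). \<exists>(p, q) \<in> set (wpairs t).
    (last p = i \<and> last q = j) \<or> (last p = j \<and> last q = i)"
  by code_simp

lemma wham_ok:
  "\<forall>t \<in> set [1..<8]. \<exists>p \<in> set wham. p \<noteq> [] \<and> distinct p \<and> hd p = 0 \<and> last p = t \<and>
    list_all (\<lambda>x. x \<in> set p) [0..<8] \<and> list_all (\<lambda>x. x < 8) p \<and> successively (wadj 8) p"
  by code_simp

lemma wcyc_ok:
  "\<forall>k \<in> set [0,1,3,4]. \<exists>p \<in> set (wpaths k). wadj k (last p) (hd p)"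
  by code_simp

lemma wauts_ok:
  "\<forall>v \<in> set [0..<8]. \<exists>a \<in> set wauts. length a = 8 \<and> distinct a \<and> a ! 0 = v \<and> list_all (\<lambda>x. x < 8) a \<and>
     list_all (\<lambda>i. list_all (\<lambda>j. j \<in> set (wn i) \<longleftrightarrow> a ! j \<in> set (wn (a ! i))) [0..<8]) [0..<8]"
  by code_simp

text \<open>Reads a leaf as a map on the vertices other than 0; leaves list the images in the
  reverse of the search order.\<close>

definition wval :: "nat list \<Rightarrow> nat \<Rightarrow> nat" where
  "wval l i = the (map_of (zip (rev (wvs 0)) l) i)"

text \<open>The Hamiltonian cycle runs through \<open>p\<close>, \<open>r\<close>, \<open>q\<close>,
  \<open>s\<close> in this order, with \<open>p\<close>, \<open>q\<close> in one copy and
  \<open>r\<close>, \<open>s\<close> in the other; the last four equations are its matching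
  edges.\<close>

lemma wleaves_ok:
  "\<forall>(l, p, q, r, s) \<in> set wleaves. p \<noteq> [] \<and> q \<noteq> [] \<and> r \<noteq> [] \<and> s \<noteq> [] \<and> distinct (p @ q) \<and> distinct (r @ s) \<and>
    list_all (\<lambda>x. x \<in> set (p @ q) \<and> x \<in> set (r @ s)) (wvs 0) \<and> list_all (\<lambda>x. x \<in> set (wvs 0)) (p @ q @ r @ s) \<and>
    successively (wadj 0) p \<and> successively (wadj 0) q \<and> successively (wadj 0) r \<and> successively (wadj 0) s \<and>
    wval l (last p) = hd r \<and> wval l (hd q) = last r \<and> wval l (last q) = hd s \<and> wval l (hd p) = last s"
  by code_simp

text \<open>The leaf list is empty: under every matching, the ends of some Hamiltonian path of the
  faulty copy are matched to the free ends of a path pair of the fault-free copy.\<close>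

lemma srch2:
  "\<forall>k \<in> set [0,1,3,4]. \<forall>t \<in> set [1,2,3,4]. srch [] (wends k) (wpends t) (wvs k) [] [0..<8]"
  by code_simp

lemma srch2':
  "\<forall>k \<in> set [0,1,3,4]. \<forall>t \<in> set [5,6,7]. srch [] (wends k) (wpends t) (wvs k) [] [0..<8]"
  by code_simp

text \<open>Together with \<open>srch1'\<close> this covers every combination of two faults except
  two faulty vertices, the one case with exceptional matchings.\<close>

lemma srch1:
  "\<forall>k \<in> set [0,1,3,4]. \<forall>k' \<in> set [1,3,4]. srch [] (wends k) (wends k') (wvs k) [] [0..<8]"
  by code_simp

lemma srch1':
  "\<forall>k \<in> set [1,3,4]. srch [] (wends k) (wends 0) (wvs k) [] [0..<8]"
  by code_simp

lemma srch1_leaf: "srch (map fst wleaves) (wends 0) (wends 0) (wvs 0) [] [0..<8]"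
  by code_simp

text \<open>An arbitrary coordinate map is composed with the automorphism that moves 0 to the
  coordinate of \<open>x\<close>.\<close>

lemma norm0:
  assumes "thln 3 V E" "x \<in> V"
  obtains f where "bij_betw f {0..<8::nat} V" "f 0 = x" "\<And>i. i < 8 \<Longrightarrow> {z. {f i, z} \<in> E} = f ` set (wn i)"
  using assms(1)
proof (cases rule: thln.cases)
  case (base f)
  obtain v where v: "v < 8" "f v = x" using base(1) assms(2) by (auto simp: bij_betw_def)
  obtain a where a: "length a = 8" "distinct a" "a ! 0 = v" "list_all (\<lambda>x. x < 8) a"
    "list_all (\<lambda>i. list_all (\<lambda>j. j \<in> set (wn i) \<longleftrightarrow> a ! j \<in> set (wn (a ! i))) [0..<8]) [0..<8]"
    using wauts_ok v(1) by force
  have a8: "a ! i < 8" if "i < 8" for i using a(1,4) that by (simp add: list_all_length)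
  have ij: "j \<in> set (wn i) \<longleftrightarrow> a ! j \<in> set (wn (a ! i))" if "i < 8" "j < 8" for i j
    using a(5) that by (simp add: list_all_iff)
  have injn: "inj_on (\<lambda>i. a ! i) {0..<8}" using a(1,2) by (auto simp: inj_on_def nth_eq_iff_index_eq)
  have "(\<lambda>i. a ! i) ` {0..<8} \<subseteq> {0..<8}" using a8 by auto
  then have surjn: "(\<lambda>i. a ! i) ` {0..<8} = {0..<8}"
    using injn by (intro card_subset_eq) (auto simp: card_image)
  have bn: "bij_betw (\<lambda>i. a ! i) {0..<8} {0..<8}" using injn surjn by (simp add: bij_betw_def)
  show ?thesis
  proof (rule that[of "f \<circ> (\<lambda>i. a ! i)"])
    show "bij_betw (f \<circ> (!) a) {0..<8} V" using bij_betw_trans[OF bn base(1)] .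
    show "(f \<circ> (!) a) 0 = x" using a(3) v by simp
    fix i :: nat assume i: "i < 8"
    have "set (wn (a ! i)) = (\<lambda>i. a ! i) ` set (wn i)"
    proof (rule set_eqI)
      fix z
      show "z \<in> set (wn (a ! i)) \<longleftrightarrow> z \<in> (\<lambda>i. a ! i) ` set (wn i)"
      proof
        assume z: "z \<in> set (wn (a ! i))"
        then have "z \<in> (\<lambda>i. a ! i) ` {0..<8}" using wn_less surjn by auto
        then obtain j where "j < 8" "z = a ! j" by auto
        then show "z \<in> (\<lambda>i. a ! i) ` set (wn i)" using ij[OF i] z by auto
      next
        assume "z \<in> (\<lambda>i. a ! i) ` set (wn i)"
        then obtain j where j: "j \<in> set (wn i)" "z = a ! j" by auto
        then show "z \<in> set (wn (a ! i))" using ij[OF i wn_less[OF j(1)]] by auto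
      qed
    qed
    then show "{z. {(f \<circ> (!) a) i, z} \<in> E} = (f \<circ> (!) a) ` set (wn i)"
      using base_nbrs[OF base(1,2) a8[OF i]] by (simp add: image_comp)
  qed
next
  case (step n V1 E1 V2 E2 \<phi>)
  then show ?thesis using thln_basic[OF step(4)] by simp
qed

lemma srch_top:
  assumes "srch L Al Bl ks [] [0..<8]" "\<And>i. i \<in> set ks \<Longrightarrow> g i < 8" "inj_on g (set ks)" "distinct ks"
  shows "(\<exists>i\<in>set ks. \<exists>j\<in>set ks. j \<in> set (Al ! i) \<and> g j \<in> set (Bl ! g i)) \<or> map g (rev ks) \<in> set L"
proof -
  have "(\<exists>i j. i \<in> fst ` set ([] :: (nat \<times> nat) list) \<union> set ks \<and> j \<in> set ks \<and> j \<in> set (Al ! i) \<and> g j \<in> set (Bl ! g i)) \<or>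
     map g (rev ks) @ map snd ([] :: (nat \<times> nat) list) \<in> set L"
    by (rule srch_sound[OF assms(1)]) (use assms in auto)
  then show ?thesis by auto
qed

lemma wvs_less: "i \<in> set (wvs k) \<Longrightarrow> i < 8"
  by (auto simp: wvs_def split: if_splits)

lemma wk_wvs: "wadj k i j \<Longrightarrow> i < 8 \<and> j < 8"
  using wn_less by (auto simp: wadj_def)

lemma norm_fault:
  assumes "thln 3 V E" "nfaults FV FE V E = 1"
  obtains f k where "k \<in> set [0,1,3,4]" "bij_betw f {0..<8::nat} V" "V - FV = f ` set (wvs k)"
    "\<And>i j. wadj k i j \<Longrightarrow> {f i, f j} \<in> E - FE"
proof -
  have fin: "finite V" "finite E" using thln_basic[OF assms(1)] by auto
  consider "card (FV \<inter> V) = 1" "card (FE \<inter> E) = 0" | "card (FV \<inter> V) = 0" "card (FE \<inter> E) = 1"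
    using assms(2) unfolding nfaults_def by linarith
  then show thesis
  proof cases
    case 1
    then obtain x where x: "FV \<inter> V = {x}" by (auto simp: card_1_singleton_iff)
    then have xV: "x \<in> V" by auto
    obtain f where f: "bij_betw f {0..<8::nat} V" "f 0 = x" "\<And>i. i < 8 \<Longrightarrow> {z. {f i, z} \<in> E} = f ` set (wn i)"
      by (rule norm0[OF assms(1) xV]) blast
    have "{0..<8} = insert 0 (set (wvs 0))" by (auto simp: wvs_def)
    then have "V = insert (f 0) (f ` set (wvs 0))" using f(1) by (metis bij_betw_def image_insert)
    moreover have "f 0 \<notin> f ` set (wvs 0)"
    proof
      assume "f 0 \<in> f ` set (wvs 0)"
      then obtain i where i: "i \<in> set (wvs 0)" "f 0 = f i" by blast
      have "0 = i" using f(1) wvs_less[OF i(1)] i(2) unfolding bij_betw_def inj_on_def by simp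
      then show False using i(1) by (simp add: wvs_def)
    qed
    moreover have "V - FV = V - {f 0}" using x f(2) by blast
    ultimately have "V - FV = f ` set (wvs 0)" by (metis Diff_insert_absorb)
    moreover have "{f i, f j} \<in> E - FE" if "wadj 0 i j" for i j
    proof -
      have "{f i, f j} \<in> E" using that f(3)[of i] unfolding wadj_def by blast
      then show ?thesis using 1(2) fin by auto
    qed
    ultimately show thesis using f(1) by (intro that[of 0 f]) auto
  next
    case 2
    then obtain e where e: "FE \<inter> E = {e}" by (auto simp: card_1_singleton_iff)
    obtain x y where xy: "x \<in> V" "e = {x, y}" using thln_basic[OF assms(1)] e by blast
    obtain f where f: "bij_betw f {0..<8::nat} V" "f 0 = x" "\<And>i. i < 8 \<Longrightarrow> {z. {f i, z} \<in> E} = f ` set (wn i)"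
      by (rule norm0[OF assms(1) xy(1)]) blast
    have "y \<in> {z. {f 0, z} \<in> E}" using e xy f(2) by auto
    then obtain k where k: "k \<in> set (wn 0)" "y = f k" using f(3)[of 0] by auto
    have k': "k \<in> set [0,1,3,4]" "k \<noteq> 0" "k < 8" using k by (auto simp: wn_def)
    have "set (wvs k) = {0..<8}" using k'(2) by (auto simp: wvs_def)
    then have "V - FV = f ` set (wvs k)" using f(1) 2(1) fin by (auto simp: bij_betw_def)
    moreover have "{f i, f j} \<in> E - FE" if w: "wadj k i j" for i j
    proof -
      have E: "{f i, f j} \<in> E" using w f(3)[of i] unfolding wadj_def by blast
      have inj: "\<And>a b. a < 8 \<Longrightarrow> b < 8 \<Longrightarrow> f a = f b \<Longrightarrow> a = b" using f(1) by (auto simp: bij_betw_def inj_on_def)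
      have ij: "i < 8" "j < 8" using wk_wvs[OF w] by auto
      have "{f i, f j} \<noteq> e"
      proof
        assume "{f i, f j} = e"
        then have "{f i, f j} = {f 0, f k}" using xy k f by simp
        then have "(f i = f 0 \<and> f j = f k) \<or> (f i = f k \<and> f j = f 0)" by (simp add: doubleton_eq_iff)
        then have "(i = 0 \<and> j = k) \<or> (i = k \<and> j = 0)" using inj ij k'(3) by (metis zero_less_numeral)
        then show False using w unfolding wadj_def by auto
      qed
      then show ?thesis using E e by auto
    qed
    ultimately show thesis using f(1) k' by (intro that[of k f]) auto
  qed
qed

lemma norm_free:
  assumes "thln 3 V E" "nfaults FV FE V E = 0" "x \<in> V"
  obtains f where "bij_betw f {0..<8::nat} V" "f 0 = x" "V - FV = V"
    "\<And>i j. wadj 8 i j \<Longrightarrow> {f i, f j} \<in> E - FE"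
proof -
  have fin: "finite V" "finite E" using thln_basic[OF assms(1)] by auto
  obtain f where f: "bij_betw f {0..<8::nat} V" "f 0 = x" "\<And>i. i < 8 \<Longrightarrow> {z. {f i, z} \<in> E} = f ` set (wn i)"
    by (rule norm0[OF assms(1,3)]) blast
  have "V - FV = V" using assms(2) fin unfolding nfaults_def by auto
  moreover have "{f i, f j} \<in> E - FE" if "wadj 8 i j" for i j
  proof -
    have "{f i, f j} \<in> E" using that f(3)[of i] unfolding wadj_def by blast
    then show ?thesis using assms(2) fin unfolding nfaults_def by auto
  qed
  ultimately show thesis using f(1,2) by (intro that[of f]) auto
qed

lemma wtransfer:
  assumes "inj_on f {0..<8::nat}" "\<And>i j. wadj k i j \<Longrightarrow> {f i, f j} \<in> E" "xs \<noteq> []" "distinct xs"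
    "set xs \<subseteq> {0..<8}" "successively (wadj k) xs"
  shows "hpath E (f ` set xs) (f (hd xs)) (f (last xs))"
proof (rule hpathI[of "map f xs"])
  have "inj_on f (set xs)" using assms(1,5) by (rule inj_on_subset)
  then show "distinct (map f xs)" using assms(4) by (simp add: distinct_map)
  show "successively (\<lambda>x y. {x, y} \<in> E) (map f xs)"
    unfolding successively_map by (rule successively_mono[OF assms(6)]) (rule assms(2))
qed (use assms in \<open>auto simp: hd_map last_map\<close>)

lemma ham_conn_at_3: "ham_conn_at TYPE('a) 3"
  unfolding ham_conn_at_def ham_conn_def
proof (intro allI impI ballI)
  fix V :: "'a set" and E FV FE s t
  assume t: "thln 3 V E" and n: "nfaults FV FE V E + 3 \<le> 3" and s: "s \<in> V - FV" and t': "t \<in> V - FV" and ne: "s \<noteq> t"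
  have n0: "nfaults FV FE V E = 0" using n by simp
  have sV: "s \<in> V" using s by auto
  obtain f where f: "bij_betw f {0..<8::nat} V" "f 0 = s" "V - FV = V"
    "\<And>i j. wadj 8 i j \<Longrightarrow> {f i, f j} \<in> E - FE" by (rule norm_free[OF t n0 sV]) blast
  have inj: "inj_on f {0..<8}" and im: "f ` {0..<8} = V" using f(1) by (auto simp: bij_betw_def)
  obtain j where j: "j < 8" "f j = t" using im t' by auto
  have "j \<noteq> 0" using j f(2) ne by metis
  then have "j \<in> set [1..<8]" using j(1) by simp
  then obtain p where p: "p \<noteq> []" "distinct p" "hd p = 0" "last p = j"
    "list_all (\<lambda>x. x \<in> set p) [0..<8]" "list_all (\<lambda>x. x < 8) p" "successively (wadj 8) p"
    using wham_ok by blast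
  have sp: "set p = {0..<8}" using p(5,6) by (auto simp: list_all_iff)
  have "hpath (E - FE) (f ` set p) (f (hd p)) (f (last p))"
    by (rule wtransfer[OF inj f(4) p(1,2) _ p(7)]) (use sp in auto)
  then show "hpath (E - FE) (V - FV) s t" using sp im f(2,3) p(3,4) j by simp
qed

lemma wpaths_hpath:
  assumes "inj_on f {0..<8::nat}" "\<And>i j. wadj k i j \<Longrightarrow> {f i, f j} \<in> E" "k \<in> set [0,1,3,4]" "xs \<in> set (wpaths k)"
  shows "hpath E (f ` set (wvs k)) (f (hd xs)) (f (last xs))"
proof -
  have p: "xs \<noteq> []" "distinct xs" "list_all (\<lambda>x. x \<in> set xs) (wvs k)"
    "list_all (\<lambda>x. x \<in> set (wvs k)) xs" "successively (wadj k) xs"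
    using wpaths_ok assms(3,4) by blast+
  have sp: "set xs = set (wvs k)" using p(3,4) by (auto simp: list_all_iff)
  then have "set xs \<subseteq> {0..<8}" using wvs_less by auto
  then show ?thesis using wtransfer[OF assms(1,2) p(1,2) _ p(5)] sp by simp
qed

lemma hcycle_at_3: "hcycle_at TYPE('a) 3"
  unfolding hcycle_at_def
proof (intro allI impI)
  fix V :: "'a set" and E FV FE
  assume t: "thln 3 V E" and n: "nfaults FV FE V E + 2 \<le> 3"
  consider "nfaults FV FE V E = 0" | "nfaults FV FE V E = 1" using n by linarith
  then have "\<exists>f k. k \<in> set [0,1,3,4] \<and> bij_betw f {0..<8::nat} V \<and> V - FV = f ` set (wvs k) \<and>
    (\<forall>i j. wadj k i j \<longrightarrow> {f i, f j} \<in> E - FE)"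
  proof cases
    case 1
    have "card V = 8" using thln_basic[OF t] by simp
    then obtain x where "x \<in> V" by fastforce
    then obtain f where f: "bij_betw f {0..<8::nat} V" "f 0 = x" "V - FV = V"
      "\<And>i j. wadj 8 i j \<Longrightarrow> {f i, f j} \<in> E - FE" using norm_free[OF t 1] by blast
    \<comment> \<open>Without a fault, the edge between 0 and 1 is treated as if it were faulty:
      \<open>wadj 1\<close> is contained in \<open>wadj 8\<close>, and the cycle certificates for
      \<open>k = 1\<close> apply.\<close>
    have "{f i, f j} \<in> E - FE" if w: "wadj 1 i j" for i j
    proof (rule f(4))
      show "wadj 8 i j" using w wn_less[of j i] unfolding wadj_def by auto
    qed
    moreover have "f ` set (wvs 1) = V"
    proof -
      have "set (wvs 1) = {0..<8}" by (auto simp: wvs_def)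
      then show ?thesis using f(1) by (simp add: bij_betw_def)
    qed
    ultimately show ?thesis using f by (intro exI[of _ f] exI[of _ 1]) auto
  next
    case 2
    show ?thesis by (rule norm_fault[OF t 2]) blast
  qed
  then obtain f k where f: "k \<in> set [0,1,3,4]" "bij_betw f {0..<8::nat} V" "V - FV = f ` set (wvs k)"
    "\<And>i j. wadj k i j \<Longrightarrow> {f i, f j} \<in> E - FE" by blast
  have inj: "inj_on f {0..<8}" using f(2) by (auto simp: bij_betw_def)
  obtain p where p: "p \<in> set (wpaths k)" "wadj k (last p) (hd p)" using wcyc_ok f(1) by blast
  have "hpath (E - FE) (V - FV) (f (hd p)) (f (last p))"
    using wpaths_hpath[OF inj f(4) f(1) p(1)] f(3) by simp
  moreover have "{f (hd p), f (last p)} \<in> E - FE" using f(4)[OF p(2)] by (simp add: insert_commute)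
  moreover have "3 \<le> card (V - FV)" using card_faultfree(1)[OF t, of FV FE] n by simp
  ultimately show "hcycle (E - FE) (V - FV)" unfolding hcycle_def by blast
qed

section \<open>The two critical configurations in dimension 4\<close>

context thsplit begin

lemma crossable_all:
  assumes "fB = 0" "ncross = 0" "x \<in> A - FV"
  shows "crossable x"
proof (rule ccontr)
  assume "\<not> crossable x"
  then have "x \<in> {x \<in> A - FV. \<not> crossable x}" using assms(3) by auto
  moreover have "finite {x \<in> A - FV. \<not> crossable x}" using finA by auto
  ultimately have "card {x \<in> A - FV. \<not> crossable x} > 0" by (auto simp: card_gt_0_iff)
  then show False using card_not_cr assms(1,2) by simp
qed

text \<open>In coordinates the matching becomes an injection of \<open>{0..<8}\<close> into itself,
  the object over which the search runs.\<close>

lemma matching: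
  assumes "bij_betw f {0..<8::nat} A" "bij_betw g {0..<8::nat} B"
  obtains h where "\<And>i. i < 8 \<Longrightarrow> h i < 8 \<and> g (h i) = \<phi> (f i)" "inj_on h {0..<8}"
proof -
  have "\<exists>j. j < 8 \<and> g j = \<phi> (f i)" if "i < 8" for i
  proof -
    have "f i \<in> A" using assms(1) that by (auto simp: bij_betw_def)
    then have "\<phi> (f i) \<in> g ` {0..<8}" using phi_in assms(2) by (auto simp: bij_betw_def)
    then show ?thesis by auto
  qed
  then obtain h where h: "\<And>i. i < 8 \<Longrightarrow> h i < 8 \<and> g (h i) = \<phi> (f i)" by metis
  have "inj_on h {0..<8}"
  proof (rule inj_onI)
    fix i j assume ij: "i \<in> {0..<8}" "j \<in> {0..<8}" "h i = h j"
    then have "\<phi> (f i) = \<phi> (f j)" using h[of i] h[of j] by simp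
    moreover have "f i \<in> A" "f j \<in> A" using assms(1) ij by (auto simp: bij_betw_def)
    ultimately have "f i = f j" using phi_eq by simp
    then show "i = j" using assms(1) ij by (auto simp: bij_betw_def inj_on_def)
  qed
  then show thesis using that h by blast
qed

text \<open>In dimension 3 Hamilton-connectedness tolerates no fault, so it does not cover
  \<open>A\<close>, and \<open>B\<close> cannot spare a vertex. The path leaves \<open>s\<close> in
  \<open>B\<close>, crosses \<open>A\<close> along a Hamiltonian path and returns to
  \<open>t\<close>, with the two crossings supplied by the search.\<close>

lemma ham_conn_dim4:
  assumes "m = 3" "fA = 1" "fB = 0" "ncross = 0" "s \<in> B" "t \<in> B" "s \<noteq> t"
  shows "hpath Eg (V - FV) s t"
proof -
  obtain f k where f: "k \<in> set [0,1,3,4]" "bij_betw f {0..<8::nat} A" "A - FV = f ` set (wvs k)"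
    "\<And>i j. wadj k i j \<Longrightarrow> {f i, f j} \<in> EA - FE"
    by (rule norm_fault[OF tA[unfolded assms(1)] assms(2)]) blast
  obtain g where g: "bij_betw g {0..<8::nat} B" "g 0 = s" "B - FV = B"
    "\<And>i j. wadj 8 i j \<Longrightarrow> {g i, g j} \<in> EB - FE"
    by (rule norm_free[OF tB[unfolded assms(1)] assms(3,5)]) blast
  have injf: "inj_on f {0..<8}" and imf: "f ` {0..<8} = A" using f(2) by (auto simp: bij_betw_def)
  have injg: "inj_on g {0..<8}" and img: "g ` {0..<8} = B" using g(1) by (auto simp: bij_betw_def)
  obtain u where u: "u < 8" "g u = t" using img assms(6) by auto
  have "u \<noteq> 0" using u g(2) assms(7) by metis
  then have u': "u \<in> set [1..<8]" using u(1) by simp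
  obtain h where h: "\<And>i. i < 8 \<Longrightarrow> h i < 8 \<and> g (h i) = \<phi> (f i)" "inj_on h {0..<8}"
    by (rule matching[OF f(2) g(1)]) blast
  have "u \<in> set [1,2,3,4] \<or> u \<in> set [5,6,7]" using u' by auto
  then have "srch [] (wends k) (wpends u) (wvs k) [] [0..<8]" using srch2 srch2' f(1) by blast
  then have "(\<exists>i\<in>set (wvs k). \<exists>j\<in>set (wvs k). j \<in> set (wends k ! i) \<and> h j \<in> set (wpends u ! h i)) \<or>
      map h (rev (wvs k)) \<in> set []"
  proof (rule srch_top)
    show "distinct (wvs k)" by (simp add: wvs_def)
    show "\<And>i. i \<in> set (wvs k) \<Longrightarrow> h i < 8" using h(1) wvs_less by simp
    show "inj_on h (set (wvs k))" by (rule inj_on_subset[OF h(2)]) (use wvs_less in auto)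
  qed
  then obtain i j where ij: "i \<in> set (wvs k)" "j \<in> set (wvs k)" "j \<in> set (wends k ! i)" "h j \<in> set (wpends u ! h i)"
    by auto
  have ij8: "i < 8" "j < 8" using ij wvs_less by auto
  obtain xs where xs: "xs \<in> set (wpaths k)" "(hd xs = i \<and> last xs = j) \<or> (hd xs = j \<and> last xs = i)"
    using wends_ok f(1) ij(3) ij8(1) by (metis atLeastLessThan_iff atLeast_upt set_upt zero_le)
  have h1: "hpath Eg (A - FV) (f i) (f j)"
    using wpaths_hpath[OF injf f(4) f(1) xs(1)] xs(2) f(3) hpath_rev hpath_mono[OF _ EA_sub] by metis
  have hij: "h i \<in> set [0..<8]" using h(1)[OF ij8(1)] by simp
  obtain p q where pq: "(p, q) \<in> set (wpairs u)" "(last p = h i \<and> last q = h j) \<or> (last p = h j \<and> last q = h i)"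
    using wpends_ok u' hij ij(4) by blast
  have w: "p \<noteq> []" "q \<noteq> []" "distinct (p @ q)" "hd p = 0" "hd q = u"
    "list_all (\<lambda>x. x \<in> set (p @ q)) [0..<8]" "list_all (\<lambda>x. x < 8) (p @ q)" "successively (wadj 8) p" "successively (wadj 8) q"
    using wpairs_ok u' pq(1) by blast+
  have spq: "set p \<union> set q = {0..<8}" using w(6,7) by (auto simp: list_all_iff)
  have hpp: "hpath Eg (g ` set p) s (g (last p))"
    using hpath_mono[OF wtransfer[OF injg g(4) w(1) _ _ w(8)] EB_sub] w(3,4) spq g(2) by auto
  have hpq: "hpath Eg (g ` set q) t (g (last q))"
    using hpath_mono[OF wtransfer[OF injg g(4) w(2) _ _ w(9)] EB_sub] w(3,5) spq u(2) by auto
  have dpq: "g ` set p \<inter> g ` set q = {}"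
    using w(3) spq injg inj_on_image_Int[of g "{0..<8}" "set p" "set q"] by auto
  have upq: "g ` set p \<union> g ` set q = B" using spq img by (simp flip: image_Un)
  have cre: "{g (h a), f a} \<in> Eg" if "a \<in> set (wvs k)" for a
  proof -
    have "crossable (f a)" using crossable_all[OF assms(3,4)] f(3) that by blast
    then show ?thesis using crossable_edge[of "f a"] h(1) wvs_less[OF that] by (simp add: insert_commute)
  qed
  have main: "hpath Eg (V - FV) s t" if "hpath Eg (A - FV) (f a) (f b)" "last p = h a" "last q = h b"
    "a \<in> set (wvs k)" "b \<in> set (wvs k)" for a b
  proof -
    have 1: "hpath Eg (g ` set p \<union> (A - FV)) s (f b)"
      by (rule hpath_join[OF hpp that(1)]) (use cre[OF that(4)] that(2) upq disj in auto)
    have VV: "V - FV = g ` set p \<union> (A - FV) \<union> g ` set q" using upq V g(3) by auto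
    show ?thesis
      by (rule hpath_join'[OF 1 hpath_rev[OF hpq] _ _ VV])
        (use cre[OF that(5)] that(3) upq dpq disj in \<open>auto simp: insert_commute\<close>)
  qed
  show ?thesis using pq(2) main[OF h1] main[OF hpath_rev[OF h1]] ij(1,2) by blast
qed

lemma hcycle_dim4:
  assumes "m = 3" "fA = 1" "fB = 1" "ncross = 0"
  shows "hcycle Eg (V - FV)"
proof -
  obtain f k where f: "k \<in> set [0,1,3,4]" "bij_betw f {0..<8::nat} A" "A - FV = f ` set (wvs k)"
    "\<And>i j. wadj k i j \<Longrightarrow> {f i, f j} \<in> EA - FE"
    by (rule norm_fault[OF tA[unfolded assms(1)] assms(2)]) blast
  obtain g k' where g: "k' \<in> set [0,1,3,4]" "bij_betw g {0..<8::nat} B" "B - FV = g ` set (wvs k')"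
    "\<And>i j. wadj k' i j \<Longrightarrow> {g i, g j} \<in> EB - FE"
    by (rule norm_fault[OF tB[unfolded assms(1)] assms(3)]) blast
  have injf: "inj_on f {0..<8}" and imf: "f ` {0..<8} = A" using f(2) by (auto simp: bij_betw_def)
  have injg: "inj_on g {0..<8}" and img: "g ` {0..<8} = B" using g(2) by (auto simp: bij_betw_def)
  obtain h where h: "\<And>i. i < 8 \<Longrightarrow> h i < 8 \<and> g (h i) = \<phi> (f i)" "inj_on h {0..<8}"
    by (rule matching[OF f(2) g(2)]) blast
  define L where "L = (if k = 0 \<and> k' = 0 then map fst wleaves else [])"
  have "srch L (wends k) (wends k') (wvs k) [] [0..<8]"
  proof (cases "k = 0 \<and> k' = 0")
    case True then show ?thesis using srch1_leaf L_def by simp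
  next
    case False
    then have "k' \<in> set [1,3,4] \<or> (k \<in> set [1,3,4] \<and> k' = 0)" using f(1) g(1) by auto
    moreover have "L = []" using False L_def by auto
    ultimately show ?thesis using srch1 srch1' f(1) by blast
  qed
  then have hit: "(\<exists>i\<in>set (wvs k). \<exists>j\<in>set (wvs k). j \<in> set (wends k ! i) \<and> h j \<in> set (wends k' ! h i)) \<or>
      map h (rev (wvs k)) \<in> set L"
  proof (rule srch_top)
    show "distinct (wvs k)" by (simp add: wvs_def)
    show "\<And>i. i \<in> set (wvs k) \<Longrightarrow> h i < 8" using h(1) wvs_less by simp
    show "inj_on h (set (wvs k))" by (rule inj_on_subset[OF h(2)]) (use wvs_less in auto)
  qed
  have c3: "3 \<le> card (V - FV)"
  proof -
    have "(2::nat) ^ m \<le> card (A - FV) + 1" using card_faultfree(1)[OF tA, of FV FE] assms(2) by simp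
    moreover have "card (A - FV) \<le> card (V - FV)" using V finA finB by (intro card_mono) auto
    ultimately show ?thesis using assms(1) by simp
  qed
  have cre: "{f a, g (h a)} \<in> Eg" if "a \<in> set (wvs k)" "h a \<in> set (wvs k')" for a
  proof -
    have fa: "f a \<in> A - FV" using f(3) that by blast
    have "g (h a) \<in> B - FV" using g(3) that by blast
    then have "\<phi> (f a) \<in> B - FV" using h(1) wvs_less[OF that(1)] by simp
    moreover have "{f a, \<phi> (f a)} \<notin> FE"
    proof
      assume "{f a, \<phi> (f a)} \<in> FE"
      then have "{f a, \<phi> (f a)} \<in> FE \<inter> {{u, \<phi> u} | u. u \<in> A}" using fa by blast
      moreover have "finite (FE \<inter> {{u, \<phi> u} | u. u \<in> A})" using finA by simp
      ultimately show False using assms(4) unfolding ncross_def by auto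
    qed
    ultimately have "crossable (f a)" using fa unfolding crossable_def by auto
    then show ?thesis using crossable_edge[of "f a"] h(1) wvs_less[OF that(1)] by simp
  qed
  have VV: "V - FV = (A - FV) \<union> (B - FV)" using V by auto
  show ?thesis
    using hit
  proof
    assume "\<exists>i\<in>set (wvs k). \<exists>j\<in>set (wvs k). j \<in> set (wends k ! i) \<and> h j \<in> set (wends k' ! h i)"
    then obtain i j where ij: "i \<in> set (wvs k)" "j \<in> set (wvs k)" "j \<in> set (wends k ! i)" "h j \<in> set (wends k' ! h i)"
      by auto
    have ij8: "i < 8" "j < 8" using ij wvs_less by auto
    obtain xs where xs: "xs \<in> set (wpaths k)" "(hd xs = i \<and> last xs = j) \<or> (hd xs = j \<and> last xs = i)"
      using wends_ok f(1) ij(3) ij8(1) by (metis atLeastLessThan_iff atLeast_upt set_upt zero_le)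
    have h1: "hpath Eg (A - FV) (f i) (f j)"
      using wpaths_hpath[OF injf f(4) f(1) xs(1)] xs(2) f(3) hpath_rev hpath_mono[OF _ EA_sub] by metis
    have hij: "h i \<in> set [0..<8]" using h(1)[OF ij8(1)] by simp
    obtain ys where ys: "ys \<in> set (wpaths k')" "(hd ys = h i \<and> last ys = h j) \<or> (hd ys = h j \<and> last ys = h i)"
      using wends_ok g(1) hij ij(4) by blast
    have h2: "hpath Eg (B - FV) (g (h j)) (g (h i))"
      using wpaths_hpath[OF injg g(4) g(1) ys(1)] ys(2) g(3) hpath_rev hpath_mono[OF _ EB_sub] by metis
    \<comment> \<open>A priori the matching could send \<open>i\<close> or \<open>j\<close> to the
      faulty vertex 0; as ends of a path in the fault-free part, their images avoid it.\<close>
    have "g (h i) \<in> g ` set (wvs k')" "g (h j) \<in> g ` set (wvs k')"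
      using hpath_hd_in[OF h2] hpath_last_in[OF h2] g(3) by auto
    moreover have "set (wvs k') \<subseteq> {0..<8}" "h i \<in> {0..<8}" "h j \<in> {0..<8}" using wvs_less h(1) ij8 by auto
    ultimately have "h i \<in> set (wvs k')" "h j \<in> set (wvs k')"
      using inj_on_image_mem_iff[OF injg] by blast+
    then have "{f i, g (h i)} \<in> Eg" "{f j, g (h j)} \<in> Eg" using cre ij by auto
    moreover from this have "hpath Eg ((A - FV) \<union> (B - FV)) (f i) (g (h i))"
      by (intro hpath_join[OF h1 h2]) (use disj in auto)
    ultimately show ?thesis using VV c3 unfolding hcycle_def by metis
  next
    assume leaf: "map h (rev (wvs k)) \<in> set L"
    then have k0: "k = 0" "k' = 0" unfolding L_def by (auto split: if_splits)
    obtain p q r s where w: "(map h (rev (wvs 0)), p, q, r, s) \<in> set wleaves"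
      using leaf k0 unfolding L_def by auto
    let ?l = "map h (rev (wvs 0))"
    have w1: "p \<noteq> []" "q \<noteq> []" "r \<noteq> []" "s \<noteq> []" "distinct (p @ q)" "distinct (r @ s)"
      "list_all (\<lambda>x. x \<in> set (p @ q) \<and> x \<in> set (r @ s)) (wvs 0)" "list_all (\<lambda>x. x \<in> set (wvs 0)) (p @ q @ r @ s)"
      "successively (wadj 0) p" "successively (wadj 0) q" "successively (wadj 0) r" "successively (wadj 0) s"
      "wval ?l (last p) = hd r" "wval ?l (hd q) = last r" "wval ?l (last q) = hd s" "wval ?l (hd p) = last s"
      using bspec[OF wleaves_ok w, unfolded prod.case] by blast+
    have wv: "wval ?l i = h i" if "i \<in> set (wvs 0)" for i
      unfolding wval_def using that by (simp add: map_of_zip_map)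
    have spq: "set p \<union> set q = set (wvs 0)" "set r \<union> set s = set (wvs 0)"
      using w1(7,8) by (auto simp: list_all_iff)
    have w08: "set (wvs 0) \<subseteq> {0..<8}" using wvs_less by auto
    have in0: "hd p \<in> set (wvs 0)" "last p \<in> set (wvs 0)" "hd q \<in> set (wvs 0)" "last q \<in> set (wvs 0)"
      "hd r \<in> set (wvs 0)" "last r \<in> set (wvs 0)" "hd s \<in> set (wvs 0)" "last s \<in> set (wvs 0)"
      using spq w1(1-4) hd_in_set last_in_set by blast+
    have P: "hpath Eg (f ` set p) (f (hd p)) (f (last p))"
      by (rule hpath_mono[OF wtransfer[OF injf f(4)[unfolded k0] w1(1) _ _ w1(9)] EA_sub]) (use spq w08 w1(5) in auto)
    have Q: "hpath Eg (f ` set q) (f (hd q)) (f (last q))"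
      by (rule hpath_mono[OF wtransfer[OF injf f(4)[unfolded k0] w1(2) _ _ w1(10)] EA_sub]) (use spq w08 w1(5) in auto)
    have R: "hpath Eg (g ` set r) (g (hd r)) (g (last r))"
      by (rule hpath_mono[OF wtransfer[OF injg g(4)[unfolded k0] w1(3) _ _ w1(11)] EB_sub]) (use spq w08 w1(6) in auto)
    have S: "hpath Eg (g ` set s) (g (hd s)) (g (last s))"
      by (rule hpath_mono[OF wtransfer[OF injg g(4)[unfolded k0] w1(4) _ _ w1(12)] EB_sub]) (use spq w08 w1(6) in auto)
    have dpq: "f ` set p \<inter> f ` set q = {}"
      using w1(5) spq w08 injf inj_on_image_Int[of f "{0..<8}" "set p" "set q"] by auto
    have drs: "g ` set r \<inter> g ` set s = {}"
      using w1(6) spq w08 injg inj_on_image_Int[of g "{0..<8}" "set r" "set s"] by auto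
    have uA: "f ` set p \<union> f ` set q = A - FV" using f(3) k0 spq by (simp flip: image_Un)
    have uB: "g ` set r \<union> g ` set s = B - FV" using g(3) k0 spq by (simp flip: image_Un)
    have e: "{f (last p), g (hd r)} \<in> Eg" "{g (last r), f (hd q)} \<in> Eg" "{f (last q), g (hd s)} \<in> Eg"
      "{f (hd p), g (last s)} \<in> Eg"
      using cre[of "last p"] cre[of "hd q"] cre[of "last q"] cre[of "hd p"] in0 w1(13-16) k0 wv
      by (simp_all add: insert_commute)
    have 1: "hpath Eg (f ` set p \<union> g ` set r) (f (hd p)) (g (last r))"
      by (rule hpath_join[OF P R e(1)]) (use uA uB disj in auto)
    have 2: "hpath Eg ((f ` set p \<union> g ` set r) \<union> f ` set q) (f (hd p)) (f (last q))"
      by (rule hpath_join[OF 1 Q e(2)]) (use uA uB disj dpq in auto)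
    have 3: "hpath Eg (((f ` set p \<union> g ` set r) \<union> f ` set q) \<union> g ` set s) (f (hd p)) (g (last s))"
      by (rule hpath_join[OF 2 S e(3)]) (use uA uB disj drs in auto)
    have "((f ` set p \<union> g ` set r) \<union> f ` set q) \<union> g ` set s = V - FV" using uA uB VV by auto
    then show ?thesis using 3 e(4) c3 unfolding hcycle_def by metis
  qed
qed

end

section \<open>Hamilton-connectedness and Hamiltonian cycles\<close>

definition drop1 :: "'a set \<Rightarrow> 'a set set \<Rightarrow> 'a set \<Rightarrow> 'a set set \<Rightarrow> bool" where
  "drop1 FV FE FV' FE' \<longleftrightarrow> (\<exists>x\<in>FV. FV' = FV - {x} \<and> FE' = FE) \<or> (\<exists>e\<in>FE. FV' = FV \<and> FE' = FE - {e})"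

lemma drop1_vertex:
  assumes "x \<in> FV" "x \<in> V" "finite V" "nfaults FV FE V E = Suc k"
  shows "nfaults (FV - {x}) FE V E = k" "drop1 FV FE (FV - {x}) FE"
proof -
  have "(FV - {x}) \<inter> V = (FV \<inter> V) - {x}" by auto
  then have "Suc (card ((FV - {x}) \<inter> V)) = card (FV \<inter> V)"
    using assms card_Suc_Diff1[of "FV \<inter> V" x] by simp
  then show "nfaults (FV - {x}) FE V E = k" using assms(4) unfolding nfaults_def by simp
qed (use assms in \<open>auto simp: drop1_def\<close>)

lemma drop1_edge:
  assumes "e \<in> FE" "e \<in> E" "finite E" "nfaults FV FE V E = Suc k"
  shows "nfaults FV (FE - {e}) V E = k" "drop1 FV FE FV (FE - {e})"
proof -
  have "(FE - {e}) \<inter> E = (FE \<inter> E) - {e}" by auto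
  then have "Suc (card ((FE - {e}) \<inter> E)) = card (FE \<inter> E)"
    using assms card_Suc_Diff1[of "FE \<inter> E" e] by simp
  then show "nfaults FV (FE - {e}) V E = k" using assms(4) unfolding nfaults_def by simp
qed (use assms in \<open>auto simp: drop1_def\<close>)

lemma drop1_ex:
  assumes "thln m V E" "nfaults FV FE V E = Suc k"
  obtains FV' FE' where "drop1 FV FE FV' FE'" "nfaults FV' FE' V E = k"
proof -
  have fin: "finite V" "finite E" using thln_basic[OF assms(1)] by auto
  have "FV \<inter> V \<noteq> {} \<or> FE \<inter> E \<noteq> {}" using assms(2) unfolding nfaults_def by auto
  then show thesis
  proof
    assume "FV \<inter> V \<noteq> {}"
    then obtain x where "x \<in> FV" "x \<in> V" by blast
    then show thesis using drop1_vertex[OF _ _ fin(1) assms(2)] that by blast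
  next
    assume "FE \<inter> E \<noteq> {}"
    then obtain e where "e \<in> FE" "e \<in> E" by blast
    then show thesis using drop1_edge[OF _ _ fin(2) assms(2)] that by blast
  qed
qed

lemma drop1_sub: "drop1 FV FE FV' FE' \<Longrightarrow> FV' \<subseteq> FV \<and> FE' \<subseteq> FE"
  unfolding drop1_def by auto

lemma Diff_insert_edge: "E - (FE - {e}) \<subseteq> insert e (E - FE)" by auto

lemma drop_hcycle:
  assumes "drop1 FV FE FV' FE'" "hcycle (E - FE') S" "S \<inter> FV' = {}"
  obtains a b where "hpath (E - FE) (S - FV) a b" "a \<noteq> b"
  using assms(1) unfolding drop1_def
proof (elim disjE bexE conjE)
  fix x assume x: "x \<in> FV" "FV' = FV - {x}" "FE' = FE"
  have S: "S - FV = S - {x}" using x assms(3) by auto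
  show thesis by (rule hcycle_drop_vertex[OF assms(2)[unfolded x(3)], of x]) (use S that in metis)
next
  fix e assume e: "e \<in> FE" "FV' = FV" "FE' = FE - {e}"
  have S: "S - FV = S" using e assms(3) by auto
  have "hcycle (insert e (E - FE)) S" using hcycle_mono[OF assms(2)[unfolded e(3)] Diff_insert_edge] .
  then show thesis by (rule hcycle_drop_edge) (use S that in metis)
qed

text \<open>Only the start is assumed fault-free. If the far end is the reinstated vertex, the path
  is merely shortened; \<open>drop_two\<close> needs this for pieces that may end anywhere.\<close>

lemma drop_hpath:
  assumes "drop1 FV FE FV' FE'" "hpath (E - FE') S s t" "S \<inter> FV' = {}" "s \<notin> FV"
  shows "(\<exists>a. hpath (E - FE) (S - FV) s a \<and> (t \<notin> FV \<longrightarrow> a = t)) \<or>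
    (\<exists>S1 S2 a b. hpath (E - FE) S1 s a \<and> hpath (E - FE) S2 b t \<and> S1 \<union> S2 = S - FV \<and> S1 \<inter> S2 = {})"
  using assms(1) unfolding drop1_def
proof (elim disjE bexE conjE)
  fix x assume x: "x \<in> FV" "FV' = FV - {x}" "FE' = FE"
  have S: "S - FV = S - {x}" using x assms(3) by auto
  show ?thesis
  proof (cases "x \<in> S")
    case True
    have "s \<noteq> x" using x(1) assms(4) by auto
    then show ?thesis using hpath_drop_vertex[OF assms(2) True] x S by metis
  next
    case False
    then show ?thesis using S assms(2) x(3) by (intro disjI1 exI[of _ t]) auto
  qed
next
  fix e assume e: "e \<in> FE" "FV' = FV" "FE' = FE - {e}"
  have S: "S - FV = S" using e assms(3) by auto
  have "hpath (insert e (E - FE)) S s t" using hpath_mono[OF assms(2)[unfolded e(3)] Diff_insert_edge] .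
  from hpath_drop_edge[OF this] show ?thesis using S by metis
qed

lemma hpath_cross:
  assumes "hpath E S a b" "P a" "v \<in> S" "\<not> P v"
  obtains S1 S2 x y where "hpath E S1 a x" "hpath E S2 y b" "{x, y} \<in> E" "S1 \<union> S2 = S" "S1 \<inter> S2 = {}" "P x" "\<not> P y"
proof -
  obtain p where p: "p \<noteq> []" "distinct p" "set p = S" "hd p = a" "last p = b"
    "successively (\<lambda>x y. {x, y} \<in> E) p" using assms(1) unfolding hpath_def by blast
  let ?q = "takeWhile P p" and ?r = "dropWhile P p"
  have pq: "?q @ ?r = p" by simp
  have q: "?q \<noteq> []" using p(1,4) assms(2) by (cases p) auto
  have r: "?r \<noteq> []" using p(3) assms(3,4) by auto
  have h: "hpath E (set ?q) (hd ?q) (last ?q) \<and> hpath E (set ?r) (hd ?r) (last ?r) \<and> {last ?q, hd ?r} \<in> E \<and>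
     set ?q \<inter> set ?r = {}"
    by (rule hpath_append_split[OF q r]) (use p pq in auto)
  moreover have "hd ?q = a" using q p(4) pq by (metis hd_append2)
  moreover have "last ?r = b" using r p(5) pq by (metis last_appendR)
  moreover have "set ?q \<union> set ?r = S" using p(3) pq by (metis set_append)
  moreover have "P (last ?q)" using q last_in_set[OF q] set_takeWhileD by metis
  moreover have "\<not> P (hd ?r)" using r hd_dropWhile by metis
  ultimately show thesis by (intro that[of "set ?q" "last ?q" "set ?r" "hd ?r"]) auto
qed

lemma hcycle_cross:
  assumes "hcycle E S" "u \<in> S" "P u" "v \<in> S" "\<not> P v"
  obtains x y where "hpath E S x y" "{x, y} \<in> E" "P x" "\<not> P y"
proof -
  obtain a b where ab: "hpath E S a b" "{a, b} \<in> E" using assms(1) unfolding hcycle_def by blast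
  show thesis
  proof (cases "P a")
    case True
    obtain S1 S2 x y where s: "hpath E S1 a x" "hpath E S2 y b" "{x, y} \<in> E" "S1 \<union> S2 = S" "S1 \<inter> S2 = {}" "P x" "\<not> P y"
      by (rule hpath_cross[where P = P, OF ab(1) True assms(4,5)])
    show thesis using hcycle_edge[OF ab s(1,2,4,5)] s(3,6,7) by (intro that[of x y])
  next
    case False
    obtain S1 S2 x y where s: "hpath E S1 a x" "hpath E S2 y b" "{x, y} \<in> E" "S1 \<union> S2 = S" "S1 \<inter> S2 = {}" "\<not> P x" "\<not> \<not> P y"
      by (rule hpath_cross[where P = "\<lambda>x. \<not> P x", OF ab(1) False assms(2)]) (use assms(3) in auto)
    have "hpath E S y x" using hpath_rev[OF hcycle_edge[OF ab s(1,2,4,5)]] .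
    then show thesis using s(3,6,7) by (intro that[of y x]) (auto simp: insert_commute)
  qed
qed

section \<open>Induction steps for spanning cycles and spanning paths\<close>

context thsplit begin

lemma V_faultfree: "V - FV = (A - FV) \<union> (B - FV)"
  using V by auto

lemma card_A_faultfree: "card (A - FV) + fA \<ge> 2 ^ m"
  using card_faultfree(1)[OF tA] .

lemma hcycle_through:
  assumes "hcycle Eg S" "S \<subseteq> A - FV" "T \<subseteq> B - FV" "ham_conn Eg T"
    "2 * card {x \<in> S. \<not> crossable x \<or> \<phi> x \<notin> T} + 1 < card S"
  shows "hcycle Eg (S \<union> T)"
proof -
  let ?X = "{x \<in> S. \<not> crossable x \<or> \<phi> x \<notin> T}"
  have fin: "finite S" using hcycle_finite[OF assms(1)] .
  then have "finite ?X" by simp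
  then obtain x y where xy: "hpath Eg S x y" "{x, y} \<in> Eg" "x \<notin> ?X" "y \<notin> ?X" "x \<noteq> y"
    by (rule hcycle_generic[OF assms(1) _ assms(5)])
  have i: "x \<in> S" "y \<in> S" using hpath_hd_in[OF xy(1)] hpath_last_in[OF xy(1)] by auto
  have c: "crossable x" "crossable y" "\<phi> x \<in> T" "\<phi> y \<in> T" using xy i by auto
  have "\<phi> y \<noteq> \<phi> x" using phi_eq i assms(2) xy(5) by auto
  then have h: "hpath Eg T (\<phi> y) (\<phi> x)" using ham_connD[OF assms(4)] c by blast
  have 1: "hpath Eg (S \<union> T) x (\<phi> x)"
    by (rule extend_to_B[OF xy(1) _ c(2) h]) (use assms in auto)
  moreover have "{x, \<phi> x} \<in> Eg" using crossable_edge c by blast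
  moreover have "3 \<le> card (S \<union> T)"
  proof -
    have "3 \<le> card S" using assms(1) unfolding hcycle_def by blast
    also have "\<dots> \<le> card (S \<union> T)" using hpath_finite[OF 1] by (intro card_mono) auto
    finally show ?thesis .
  qed
  ultimately show ?thesis unfolding hcycle_def by blast
qed

lemma not_cr_eq: "{x \<in> A - FV. \<not> crossable x \<or> \<phi> x \<notin> B - FV} = {x \<in> A - FV. \<not> crossable x}"
  unfolding crossable_def by auto

lemma hcycle_step:
  assumes H: "ham_conn_at TYPE('a) m" and C: "hcycle_at TYPE('a) m" and n: "nfaults FV FE V E + 2 \<le> Suc m"
    and le: "fB \<le> fA"
  shows "hcycle Eg (V - FV)"
proof -
  have sum: "fA + fB + ncross + 1 \<le> m" using n nfaults_split by simp
  have pow: "2 * m + 2 \<le> 2 ^ m" using pow_ge m3 by simp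
  show ?thesis
  proof (cases "fA + 2 \<le> m")
    case True
    then have cA: "hcycle Eg (A - FV)" using C tA EA_sub hcycle_mono unfolding hcycle_at_def by blast
    show ?thesis
    proof (cases "fB + 3 \<le> m")
      case T2: True
      have "ham_conn Eg (B - FV)" by (rule ham_conn_B[OF H T2])
      then show ?thesis unfolding V_faultfree
      proof (rule hcycle_through[OF cA subset_refl subset_refl])
        show "2 * card {x \<in> A - FV. \<not> crossable x \<or> \<phi> x \<notin> B - FV} + 1 < card (A - FV)"
          unfolding not_cr_eq using card_not_cr card_A_faultfree sum pow by linarith
      qed
    next
      case False
      \<comment> \<open>Both halves have \<open>m - 2\<close> faults here, so
        \<open>2 * (m - 2) \<le> m - 1\<close>.\<close>
      then have "m = 3" "fA = 1" "fB = 1" "ncross = 0" using True sum le m3 by linarith+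
      then show ?thesis by (rule hcycle_dim4)
    qed
  next
    case False
    \<comment> \<open>All \<open>m - 1\<close> faults lie in \<open>A\<close>, one more than its
      cycles tolerate. Ignoring one gives a cycle that this fault opens into a path, and
      \<open>B\<close> closes it again.\<close>
    then have a: "fA = Suc (m - 2)" "fB = 0" "ncross = 0" using sum m3 by linarith+
    obtain FV' FE' where d: "drop1 FV FE FV' FE'" "nfaults FV' FE' A EA = m - 2"
      by (rule drop1_ex[OF tA a(1)])
    have "hcycle (EA - FE') (A - FV')" using C tA d(2) m3 unfolding hcycle_at_def by simp
    then obtain a b where ab: "hpath (EA - FE) (A - FV' - FV) a b" "a \<noteq> b"
      by (rule drop_hcycle[OF d(1)]) auto
    have "A - FV' - FV = A - FV" using drop1_sub[OF d(1)] by auto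
    then have h: "hpath Eg (A - FV) a b" using ab hpath_mono[OF _ EA_sub] by simp
    have c: "crossable a" "crossable b" using crossable_all[OF a(2,3)] hpath_hd_in[OF h] hpath_last_in[OF h] by auto
    have "\<phi> b \<noteq> \<phi> a" using phi_eq crossable_in c ab(2) by blast
    moreover have "\<phi> b \<in> B - FV" "\<phi> a \<in> B - FV" using crossable_in c by auto
    moreover have "fB + 3 \<le> m" using a m3 by simp
    ultimately have "hpath Eg (B - FV) (\<phi> b) (\<phi> a)" using ham_connD[OF ham_conn_B[OF H]] by blast
    then have 1: "hpath Eg (V - FV) a (\<phi> a)" unfolding V_faultfree by (intro extend_to_B[OF h _ c(2)]) auto
    moreover have "{a, \<phi> a} \<in> Eg" using crossable_edge c by blast
    moreover have "3 \<le> card (V - FV)"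
    proof -
      have "card (A - FV) \<le> card (V - FV)" using hpath_finite[OF 1] V_faultfree by (intro card_mono) auto
      then show ?thesis using card_A_faultfree sum pow m3 by linarith
    qed
    ultimately show ?thesis unfolding hcycle_def by blast
  qed
qed

lemma ham_conn_step_few:
  assumes H: "ham_conn_at TYPE('a) m" and n: "nfaults FV FE V E + 2 \<le> m"
    and a: "fA + 3 \<le> m" and b: "fB + 3 \<le> m"
    and s: "s \<in> A - FV" and t: "t \<in> V - FV" and ne: "s \<noteq> t"
  shows "hpath Eg (V - FV) s t"
proof -
  have sum: "fA + fB + ncross + 2 \<le> m" using n nfaults_split by simp
  have pow: "2 * m + 2 \<le> 2 ^ m" using pow_ge m3 by simp
  show ?thesis
  proof (cases "t \<in> A")
    case True
    have "hpath Eg (A - FV) s t" by (rule ham_connD[OF ham_conn_A[OF H a] s]) (use True t ne in auto)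
    then show ?thesis unfolding V_faultfree
    proof (rule detour_B[OF _ subset_refl _ ham_conn_B[OF H b]])
      show "2 * card {x \<in> A - FV. \<not> crossable x \<or> \<phi> x \<notin> B - FV} + 1 < card (A - FV)"
        unfolding not_cr_eq using card_not_cr card_A_faultfree sum pow by linarith
    qed auto
  next
    case False
    then have tB': "t \<in> B - FV" using t V by auto
    obtain u where u: "u \<in> A" "\<phi> u = t" using phi_ex tB' by blast
    \<comment> \<open>The crossing point must differ from the start \<open>s\<close> and from
      \<open>u\<close>, whose partner is already the target \<open>t\<close>.\<close>
    let ?X = "{x \<in> A - FV. \<not> crossable x} \<union> {s, u}"
    have "card ?X \<le> fB + ncross + 2"
      using card_Un_le[of "{x \<in> A - FV. \<not> crossable x}" "{s, u}"] card_not_cr card_insert_le_m1[of 2 "{u}" s]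
      by (auto simp: card_insert_if split: if_splits)
    also have "\<dots> < card (A - FV)" using card_A_faultfree sum pow by linarith
    finally have "\<not> A - FV \<subseteq> ?X" using card_mono[of ?X "A - FV"] finA by auto
    then obtain x where x: "x \<in> A - FV" "crossable x" "x \<noteq> s" "x \<noteq> u" by auto
    have h: "hpath Eg (A - FV) s x" by (rule ham_connD[OF ham_conn_A[OF H a] s x(1)]) (use x in auto)
    have "\<phi> x \<noteq> t" using x u phi_eq by auto
    then have "hpath Eg (B - FV) (\<phi> x) t" using crossable_in[OF x(2)] tB' by (intro ham_connD[OF ham_conn_B[OF H b]]) auto
    then show ?thesis unfolding V_faultfree by (intro extend_to_B[OF h _ x(2)]) auto
  qed
qed

text \<open>The path goes from \<open>\<phi> x\<close> at once to \<open>x\<close>, through all of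
  \<open>A\<close> to a cycle neighbour \<open>y\<close> of \<open>x\<close>, and back into
  \<open>B\<close>. Of the two cycle neighbours only one can have partner \<open>t\<close>. Sparing
  \<open>\<phi> x\<close> in \<open>B\<close> costs one unit of fault tolerance, hence
  \<open>4 \<le> m\<close>.\<close>

lemma ham_conn_step_cross:
  assumes H: "ham_conn_at TYPE('a) m" and C: "hcycle_at TYPE('a) m" and m4: "4 \<le> m"
    and a: "fA + 2 \<le> m" and b: "fB = 0" "ncross = 0"
    and s: "x \<in> A - FV" and t: "t \<in> B" "t \<noteq> \<phi> x"
  shows "hpath Eg (V - FV) (\<phi> x) t"
proof -
  have cA: "hcycle Eg (A - FV)" using C tA a EA_sub hcycle_mono unfolding hcycle_at_def by blast
  obtain p q where pq: "p \<noteq> q" "p \<noteq> x" "q \<noteq> x" "hpath Eg (A - FV) x p" "hpath Eg (A - FV) x q"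
    by (rule hcycle_at[OF cA s])
  have pqA: "p \<in> A - FV" "q \<in> A - FV" using hpath_last_in pq by metis+
  then have "\<phi> p \<noteq> \<phi> q" using phi_eq pq(1) by auto
  then obtain y where y: "y \<in> A - FV" "y \<noteq> x" "\<phi> y \<noteq> t" "hpath Eg (A - FV) x y" using pq pqA by metis
  have cx: "crossable x" "crossable y" using crossable_all[OF b] s y by auto
  have bb: "B \<inter> FV = {}" using b(1) finB unfolding nfaults_def by auto
  have "ham_conn Eg (B - FV - {\<phi> x})" by (rule ham_conn_B_del[OF H]) (use b m4 in auto)
  moreover have "\<phi> y \<noteq> \<phi> x" using phi_eq y s by auto
  ultimately have h: "hpath Eg (B - FV - {\<phi> x}) (\<phi> y) t"
    by (intro ham_connD) (use y(3) t crossable_in[OF cx(2)] bb in auto)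
  have 1: "hpath Eg ((A - FV) \<union> (B - FV - {\<phi> x})) x t"
    by (rule extend_to_B[OF y(4) _ cx(2) h]) auto
  show ?thesis
    by (rule hpath_join'[OF hpath_single 1]) (use crossable_edge[OF cx(1)] crossable_in[OF cx(1)] disj V_faultfree in \<open>auto simp: insert_commute\<close>)
qed

text \<open>Both end points lie in the fault-free half \<open>B = K \<union> D\<close> and have faulty partners. The Hamiltonian
  cycle of \<open>A\<close> has an edge \<open>{x, y}\<close> whose partners lie in \<open>K\<close> and \<open>D\<close>; a Hamiltonian path of \<open>K\<close>
  passes through the partner of \<open>x\<close>, and one of its two neighbours there leads over to \<open>D\<close>.\<close>

lemma ham_conn_step_halves:
  assumes C: "hcycle_at TYPE('a) m" and H': "ham_conn_at TYPE('a) m'" and m': "m = Suc m'"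
    and spl: "thsplit m' B EB K EK D ED \<theta>"
    and a: "fA + 2 \<le> m" and b: "fB = 0" "ncross = 0"
    and s: "s \<in> K" and t: "t \<in> B" "s \<noteq> t"
    and far: "\<And>x. x \<in> A - FV \<Longrightarrow> \<phi> x \<noteq> s \<and> \<phi> x \<noteq> t"
  shows "hpath Eg (V - FV) s t"
proof -
  interpret I: thsplit m' B EB K EK D ED \<theta> FV FE by (rule spl)
  have bb: "B \<inter> FV = {}" and be: "EB - FE = EB" using b(1) finB finEB unfolding nfaults_def by auto
  have nfB: "nfaults FV FE K EK = 0" "nfaults FV FE D ED = 0" "I.ncross = 0" using I.nfaults_split b(1) by simp_all
  have KD: "K - FV = K" "D - FV = D" using bb I.V by auto
  have "ham_conn I.Eg K" using I.ham_conn_A[OF H'] nfB I.m3 KD by simp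
  then have HK: "ham_conn Eg K" by (rule ham_conn_mono) (use EB_sub in auto)
  have "ham_conn I.Eg D" using I.ham_conn_B[OF H'] nfB I.m3 KD by simp
  then have HD: "ham_conn Eg D" by (rule ham_conn_mono) (use EB_sub in auto)
  have te: "{x, \<theta> x} \<in> Eg \<and> \<theta> x \<in> D" if "x \<in> K" for x
    using I.crossable_edge[OF I.crossable_all[OF nfB(2,3)], of x] that KD EB_sub I.phi_in by auto
  have cA: "hcycle Eg (A - FV)" using C tA a EA_sub hcycle_mono unfolding hcycle_at_def by blast
  have pow: "2 * m' + 2 \<le> 2 ^ m'" using pow_ge I.m3 by simp
  \<comment> \<open>\<open>A\<close> has fewer than \<open>2 ^ m'\<close> faulty vertices, so
    neither half of \<open>B\<close> has faulty partners only.\<close>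
  have ex: "\<exists>u\<in>A - FV. \<phi> u \<in> Z" if Z: "Z \<subseteq> B" "card Z = 2 ^ m'" for Z
  proof -
    have "card (\<phi> ` (FV \<inter> A)) \<le> card (FV \<inter> A)" using finA by (intro card_image_le) auto
    also have "\<dots> < card Z" using a Z pow m' unfolding nfaults_def by linarith
    finally have "\<not> Z \<subseteq> \<phi> ` (FV \<inter> A)" using card_mono[of "\<phi> ` (FV \<inter> A)" Z] finA by auto
    then obtain z where "z \<in> Z" "z \<notin> \<phi> ` (FV \<inter> A)" by blast
    then show ?thesis using phi_ex[of z] Z(1) by blast
  qed
  obtain u where u: "u \<in> A - FV" "\<phi> u \<in> K" using ex[of K] I.V I.cardA by auto
  obtain v where v: "v \<in> A - FV" "\<phi> v \<in> D" using ex[of D] I.V I.cardB by auto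
  have "\<phi> v \<notin> K" using v(2) I.disj by auto
  then obtain x y where xy: "hpath Eg (A - FV) x y" "\<phi> x \<in> K" "\<phi> y \<notin> K"
    by (rule hcycle_cross[where P = "\<lambda>z. \<phi> z \<in> K", OF cA u v(1)])
  have xyA: "x \<in> A - FV" "y \<in> A - FV" using hpath_hd_in[OF xy(1)] hpath_last_in[OF xy(1)] by auto
  have yD: "\<phi> y \<in> D" using xy(3) xyA phi_in I.V by auto
  have e: "{\<phi> x, x} \<in> Eg" "{y, \<phi> y} \<in> Eg"
    using crossable_edge[OF crossable_all[OF b]] xyA by (auto simp: insert_commute)
  have VV: "V - FV = (A - FV) \<union> K \<union> D" using V_faultfree bb I.V by auto
  show ?thesis
  proof (cases "t \<in> K")
    case False
    then have tD: "t \<in> D" using t I.V by auto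
    have 1: "hpath Eg K s (\<phi> x)" using ham_connD[OF HK s xy(2)] far[OF xyA(1)] by auto
    have 2: "hpath Eg D (\<phi> y) t" using ham_connD[OF HD yD tD] far[OF xyA(2)] by auto
    have 3: "hpath Eg (K \<union> (A - FV)) s y"
      by (rule hpath_join[OF 1 xy(1) e(1)]) (use I.V disj in auto)
    show ?thesis
      by (rule hpath_join'[OF 3 2 e(2)]) (use I.V I.disj disj VV in auto)
  next
    case True
    have 1: "hpath Eg K s t" using ham_connD[OF HK s True t(2)] .
    have "\<phi> x \<noteq> s" "\<phi> x \<noteq> t" using far[OF xyA(1)] by auto
    then obtain S1 S2 c d where cd: "hpath Eg S1 s c" "hpath Eg S2 d t" "{c, \<phi> x} \<in> Eg" "{\<phi> x, d} \<in> Eg"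
      "S1 \<union> S2 = K - {\<phi> x}" "S1 \<inter> S2 = {}"
      using hpath_drop_vertex[OF 1 xy(2)] by metis
    have cdK: "c \<in> K" "d \<in> K" "c \<noteq> d" using hpath_last_in[OF cd(1)] hpath_hd_in[OF cd(2)] cd(5,6) by auto
    show ?thesis
    proof (cases "\<theta> c = \<phi> y")
      case False
      then have h: "hpath Eg D (\<theta> c) (\<phi> y)" using ham_connD[OF HD _ yD] te[OF cdK(1)] by auto
      have 2: "hpath Eg (S1 \<union> D) s (\<phi> y)"
        by (rule hpath_join[OF cd(1) h]) (use te[OF cdK(1)] cd(5) I.disj in auto)
      have 3: "hpath Eg (S1 \<union> D \<union> (A - FV)) s x"
        by (rule hpath_join[OF 2 hpath_rev[OF xy(1)]]) (use e cd(5) I.V disj in \<open>auto simp: insert_commute\<close>)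
      have 4: "hpath Eg ({\<phi> x} \<union> S2) (\<phi> x) t"
        by (rule hpath_join[OF hpath_single cd(2,4)]) (use cd(5) in auto)
      show ?thesis
        by (rule hpath_join'[OF 3 4]) (use e cd(5,6) xy(2) I.V I.disj disj VV in \<open>auto simp: insert_commute\<close>)
    next
      case True
      then have "\<theta> d \<noteq> \<phi> y" using I.phi_eq[of c d] cdK by auto
      then have h: "hpath Eg D (\<phi> y) (\<theta> d)" using ham_connD[OF HD yD] te[OF cdK(2)] by auto
      have 2: "hpath Eg (S1 \<union> {\<phi> x}) s (\<phi> x)"
        by (rule hpath_join[OF cd(1) hpath_single cd(3)]) (use cd(5) in auto)
      have 3: "hpath Eg (S1 \<union> {\<phi> x} \<union> (A - FV)) s y"
        by (rule hpath_join[OF 2 xy(1) e(1)]) (use cd(5) xy(2) I.V disj in auto)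
      have 4: "hpath Eg (S1 \<union> {\<phi> x} \<union> (A - FV) \<union> D) s (\<theta> d)"
        by (rule hpath_join[OF 3 h e(2)]) (use cd(5) xy(2) I.V I.disj disj in auto)
      show ?thesis
        by (rule hpath_join'[OF 4 cd(2)]) (use te[OF cdK(2)] cd(5,6) xy(2) I.V I.disj disj VV in \<open>auto simp: insert_commute\<close>)
    qed
  qed
qed

text \<open>The hypothesis \<open>H'\<close> reaches down two dimensions, because \<open>B\<close>
  itself is split when both end points lie in \<open>B\<close> and have faulty partners.\<close>

lemma ham_conn_step:
  assumes H: "ham_conn_at TYPE('a) m" and C: "hcycle_at TYPE('a) m" and H': "\<And>m'. m = Suc m' \<Longrightarrow> 3 \<le> m' \<Longrightarrow> ham_conn_at TYPE('a) m'"
    and n: "nfaults FV FE V E + 2 \<le> m" and le: "fB \<le> fA"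
    and s: "s \<in> V - FV" and t: "t \<in> V - FV" and ne: "s \<noteq> t"
  shows "hpath Eg (V - FV) s t"
proof -
  have sum: "fA + fB + ncross + 2 \<le> m" using n nfaults_split by simp
  have pow: "2 * m + 2 \<le> 2 ^ m" using pow_ge m3 by simp
  show ?thesis
  proof (cases "fA + 3 \<le> m")
    case True
    have b: "fB + 3 \<le> m" using True le by simp
    show ?thesis
    proof (cases "s \<in> A")
      case sA: True
      then show ?thesis using ham_conn_step_few[OF H n True b _ t ne] s by auto
    next
      case False
      then have "s \<in> B - FV" using s V by auto
      then show ?thesis using thsplit.ham_conn_step_few[OF swap H n b True _ t ne] by auto
    qed
  next
    case False
    then have a: "fA = Suc (m - 3)" "fB = 0" "ncross = 0" using sum m3 by linarith+
    have a2: "fA + 2 \<le> m" using sum by simp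
    have bb: "B \<inter> FV = {}" using a(2) finB unfolding nfaults_def by auto
    have cA: "hcycle Eg (A - FV)" using C tA a2 EA_sub hcycle_mono unfolding hcycle_at_def by blast
    have HB: "ham_conn Eg (B - FV)" by (rule ham_conn_B[OF H]) (use a m3 in simp)
    have c: "\<And>x. x \<in> A - FV \<Longrightarrow> crossable x" using crossable_all[OF a(2,3)] .
    \<comment> \<open>\<open>A\<close> has \<open>m - 2\<close> faults, too many for
      Hamilton-connectedness, but its cycle gives two spanning paths from \<open>u\<close>; at most
      one of them ends at the partner of \<open>v\<close>.\<close>
    have AB: "hpath Eg (V - FV) u v" if u: "u \<in> A - FV" and v: "v \<in> B" for u v
    proof -
      obtain p q where pq: "p \<noteq> q" "hpath Eg (A - FV) u p" "hpath Eg (A - FV) u q"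
        by (rule hcycle_at[OF cA u])
      have pqA: "p \<in> A - FV" "q \<in> A - FV" using hpath_last_in pq by metis+
      then have "\<phi> p \<noteq> \<phi> q" using phi_eq pq(1) by auto
      then obtain y where y: "y \<in> A - FV" "\<phi> y \<noteq> v" "hpath Eg (A - FV) u y" using pq pqA by metis
      have "hpath Eg (B - FV) (\<phi> y) v" using ham_connD[OF HB] crossable_in[OF c[OF y(1)]] v bb y(2) by auto
      then show ?thesis unfolding V_faultfree by (intro extend_to_B[OF y(3) _ c[OF y(1)]]) auto
    qed
    consider "s \<in> A" "t \<in> A" | "s \<in> A" "t \<in> B" | "s \<in> B" "t \<in> A" | "s \<in> B" "t \<in> B" using s t V by auto
    then show ?thesis
    proof cases
      case 1
      obtain FV' FE' where d: "drop1 FV FE FV' FE'" "nfaults FV' FE' A EA = m - 3"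
        by (rule drop1_ex[OF tA a(1)])
      have sub: "FV' \<subseteq> FV" using drop1_sub[OF d(1)] by auto
      have "ham_conn (EA - FE') (A - FV')" using H tA d(2) m3 unfolding ham_conn_at_def by simp
      then have h: "hpath (EA - FE') (A - FV') s t" by (rule ham_connD) (use 1 s t sub ne in auto)
      have AF: "A - FV' - FV = A - FV" using sub by auto
      have "(\<exists>a. hpath (EA - FE) (A - FV' - FV) s a \<and> (t \<notin> FV \<longrightarrow> a = t)) \<or>
         (\<exists>S1 S2 a b. hpath (EA - FE) S1 s a \<and> hpath (EA - FE) S2 b t \<and> S1 \<union> S2 = A - FV' - FV \<and> S1 \<inter> S2 = {})"
        by (rule drop_hpath[OF d(1) h]) (use s in auto)
      then consider "hpath (EA - FE) (A - FV) s t"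
        | S1 S2 x y where "hpath (EA - FE) S1 s x" "hpath (EA - FE) S2 y t" "S1 \<union> S2 = A - FV" "S1 \<inter> S2 = {}"
        unfolding AF using t by blast
      then show ?thesis
      proof cases
        case 1
        have "hpath Eg (A - FV) s t" using hpath_mono[OF 1 EA_sub] .
        then show ?thesis unfolding V_faultfree
        proof (rule detour_B[OF _ subset_refl _ HB])
          show "2 * card {x \<in> A - FV. \<not> crossable x \<or> \<phi> x \<notin> B - FV} + 1 < card (A - FV)"
            unfolding not_cr_eq using card_not_cr card_A_faultfree sum pow by linarith
        qed auto
      next
        case 2
        have i: "x \<in> A - FV" "y \<in> A - FV" using hpath_last_in[OF 2(1)] hpath_hd_in[OF 2(2)] 2(3) by auto
        have "hpath Eg (S1 \<union> S2 \<union> (B - FV)) s t"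
          by (rule link_pieces[OF hpath_mono[OF 2(1) EA_sub] hpath_mono[OF 2(2) EA_sub] _ _ 2(4) c[OF i(1)] c[OF i(2)] _ _ _ HB])
            (use 2(3) crossable_in[OF c[OF i(1)]] crossable_in[OF c[OF i(2)]] in auto)
        then show ?thesis using 2(3) V_faultfree by simp
      qed
    next
      case 2 then show ?thesis using AB s by auto
    next
      case 3 then show ?thesis using AB[of t s] t hpath_rev by auto
    next
      case 4
      show ?thesis
      proof (cases "m = 3")
        case True
        then show ?thesis using ham_conn_dim4 a 4 ne by simp
      next
        case False
        then have m4: "4 \<le> m" using m3 by simp
        consider x where "x \<in> A - FV" "\<phi> x = s" | x where "x \<in> A - FV" "\<phi> x = t"
          | "\<And>x. x \<in> A - FV \<Longrightarrow> \<phi> x \<noteq> s \<and> \<phi> x \<noteq> t" by blast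
        then show ?thesis
        proof cases
          case (1 x)
          then show ?thesis using ham_conn_step_cross[OF H C m4 a2 a(2,3), of x t] 4 ne by auto
        next
          case (2 x)
          then have "hpath Eg (V - FV) t s" using ham_conn_step_cross[OF H C m4 a2 a(2,3), of x s] 4 ne by auto
          then show ?thesis by (rule hpath_rev)
        next
          case 3
          obtain m' K EK D ED \<theta> where d: "m = Suc m'" "thsplit m' B EB K EK D ED \<theta>"
            by (rule thln_splitE[OF tB False])
          have m'3: "3 \<le> m'" using thsplit.m3[OF d(2)] .
          note main = ham_conn_step_halves[OF C H'[OF d(1) m'3] d(1) _ a2 a(2,3) _ 4(2) ne 3]
          have "s \<in> K \<or> s \<in> D" using 4(1) d(2) unfolding thsplit_def by auto
          then show ?thesis using main[OF d(2)] main[OF thsplit.swap[OF d(2)]] by blast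
        qed
      qed
    qed
  qed
qed

end

text \<open>The two claims need each other: cycles tolerate one more fault in the half
  \<open>A\<close> than Hamilton-connectedness, and closing a cycle needs a spanning path of
  \<open>B\<close> between given ends.\<close>

theorem thln_ham_conn_hcycle:
  assumes "3 \<le> n" shows "ham_conn_at TYPE('a) n \<and> hcycle_at TYPE('a) n"
  using assms
proof (induction n rule: less_induct)
  case (less n)
  show ?case
  proof (cases "n = 3")
    case True then show ?thesis using ham_conn_at_3 hcycle_at_3 by auto
  next
    case False
    have IH: "ham_conn_at TYPE('a) k" "hcycle_at TYPE('a) k" if "3 \<le> k" "k < n" for k using less that by auto
    have "ham_conn_at TYPE('a) n"
      unfolding ham_conn_at_def ham_conn_def
    proof (intro allI impI ballI)
      fix V :: "'a set" and E FV FE s t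
      assume th: "thln n V E" and nn: "nfaults FV FE V E + 3 \<le> n" and s: "s \<in> V - FV" and t: "t \<in> V - FV" and ne: "s \<noteq> t"
      obtain m A EA B EB \<phi> where sp: "n = Suc m" "thsplit m V E A EA B EB \<phi>" "nfaults FV FE B EB \<le> nfaults FV FE A EA"
        by (rule thln_wlog[OF th False])
      interpret thsplit m V E A EA B EB \<phi> FV FE by (rule sp(2))
      show "hpath (E - FE) (V - FV) s t"
      proof (rule ham_conn_step[OF IH(1) IH(2) IH(1) _ sp(3) s t ne])
        show "nfaults FV FE V E + 2 \<le> m" using nn sp(1) by simp
      qed (use sp(1) m3 in auto)
    qed
    moreover have "hcycle_at TYPE('a) n"
      unfolding hcycle_at_def
    proof (intro allI impI)
      fix V :: "'a set" and E FV FE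
      assume th: "thln n V E" and nn: "nfaults FV FE V E + 2 \<le> n"
      obtain m A EA B EB \<phi> where sp: "n = Suc m" "thsplit m V E A EA B EB \<phi>" "nfaults FV FE B EB \<le> nfaults FV FE A EA"
        by (rule thln_wlog[OF th False])
      interpret thsplit m V E A EA B EB \<phi> FV FE by (rule sp(2))
      show "hcycle (E - FE) (V - FV)"
        by (rule hcycle_step[OF IH(1) IH(2) _ sp(3)]) (use nn sp(1) m3 in auto)
    qed
    ultimately show ?thesis by simp
  qed
qed

section \<open>Degrees and covers by two disjoint paths\<close>

context thsplit begin

lemma nbrs_A: "x \<in> A \<Longrightarrow> nbrs E x = insert (\<phi> x) (nbrs EA x)"
proof (rule set_eqI)
  fix z assume x: "x \<in> A"
  show "z \<in> nbrs E x \<longleftrightarrow> z \<in> insert (\<phi> x) (nbrs EA x)"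
  proof
    assume "z \<in> nbrs E x"
    then have e: "{x, z} \<in> E" by (simp add: nbrs_def)
    have "{x, z} \<notin> EB" using EB_in x disj by blast
    then consider "{x, z} \<in> EA" | "{x, z} \<in> {{u, \<phi> u} | u. u \<in> A}" using e unfolding E by blast
    then show "z \<in> insert (\<phi> x) (nbrs EA x)"
    proof cases
      case 2
      then have "z = \<phi> x" using x phi_in disj by (auto simp: doubleton_eq_iff)
      then show ?thesis by simp
    qed (simp add: nbrs_def)
  next
    assume "z \<in> insert (\<phi> x) (nbrs EA x)"
    then show "z \<in> nbrs E x" using x unfolding E nbrs_def by auto
  qed
qed

lemma nbrs_EA: "nbrs EA x \<subseteq> A"
  using EA_in unfolding nbrs_def by blast

end

lemma thln_degree: "thln n V E \<Longrightarrow> x \<in> V \<Longrightarrow> card (nbrs E x) = n"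
proof (induction n arbitrary: V E x rule: less_induct)
  case (less n)
  show ?case
  proof (cases "n = 3")
    case True
    obtain f where f: "bij_betw f {0..<8::nat} V" "f 0 = x" "\<And>i. i < 8 \<Longrightarrow> {z. {f i, z} \<in> E} = f ` set (wn i)"
      by (rule norm0[OF less.prems(1)[unfolded True] less.prems(2)]) blast
    have inj: "inj_on f (set (wn 0))"
      using f(1) wn_less by (auto simp: bij_betw_def intro: inj_on_subset)
    have "nbrs E x = f ` set (wn 0)" using f(2) f(3)[of 0] unfolding nbrs_def by simp
    then show ?thesis using card_image[OF inj] wn_card[of 0] True by simp
  next
    case False
    obtain m A EA B EB \<phi> where sp: "n = Suc m" "thsplit m V E A EA B EB \<phi>"
      by (rule thln_splitE[OF less.prems(1) False])
    have main: "card (nbrs E x) = n" if "thsplit m V E A EA B EB \<phi>" "x \<in> A" for A EA B EB \<phi>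
    proof -
      interpret thsplit m V E A EA B EB \<phi> by (rule that(1))
      have "card (nbrs EA x) = m" using less.IH[OF _ tA that(2)] sp(1) by simp
      moreover have "\<phi> x \<notin> nbrs EA x" using nbrs_EA phi_in[OF that(2)] disj by blast
      moreover have "finite (nbrs EA x)" using nbrs_EA finA finite_subset by blast
      ultimately show ?thesis using nbrs_A[OF that(2)] sp(1) by simp
    qed
    have "x \<in> A \<or> x \<in> B" using less.prems(2) sp(2) unfolding thsplit_def by auto
    then show ?thesis using main[OF sp(2)] main[OF thsplit.swap[OF sp(2)]] by blast
  qed
qed

text \<open>Inside one half the partners of \<open>x\<close> and \<open>y\<close> are different and
  lie outside, so induction applies. For vertices in different halves the only candidates are the
  two partners.\<close>

lemma thln_codegree: "thln n V E \<Longrightarrow> x \<in> V \<Longrightarrow> y \<in> V \<Longrightarrow> x \<noteq> y \<Longrightarrow> card (nbrs E x \<inter> nbrs E y) \<le> 2"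
proof (induction n arbitrary: V E x y rule: less_induct)
  case (less n)
  show ?case
  proof (cases "n = 3")
    case True
    obtain f where f: "bij_betw f {0..<8::nat} V" "f 0 = x" "\<And>i. i < 8 \<Longrightarrow> {z. {f i, z} \<in> E} = f ` set (wn i)"
      by (rule norm0[OF less.prems(1)[unfolded True] less.prems(2)]) blast
    obtain j where j: "j < 8" "f j = y" using f(1) less.prems(3) by (auto simp: bij_betw_def)
    have "j \<noteq> 0" using j f(2) less.prems(4) by metis
    have sub: "set (wn i) \<subseteq> {0..<8}" for i using wn_less by auto
    have inj: "inj_on f {0..<8}" using f(1) by (auto simp: bij_betw_def)
    have "nbrs E x = f ` set (wn 0)" "nbrs E y = f ` set (wn j)"
      using f(2) f(3)[of 0] j f(3)[of j] unfolding nbrs_def by auto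
    then have "nbrs E x \<inter> nbrs E y = f ` (set (wn 0) \<inter> set (wn j))"
      using inj_on_image_Int[OF inj sub sub] by simp
    then have "card (nbrs E x \<inter> nbrs E y) \<le> card (set (wn 0) \<inter> set (wn j))"
      by (simp add: card_image_le)
    also have "\<dots> \<le> 2" using wn_codeg[of 0 j] j(1) \<open>j \<noteq> 0\<close> by simp
    finally show ?thesis .
  next
    case False
    obtain m A EA B EB \<phi> where sp: "n = Suc m" "thsplit m V E A EA B EB \<phi>"
      by (rule thln_splitE[OF less.prems(1) False])
    have main: "card (nbrs E x \<inter> nbrs E y) \<le> 2" if s: "thsplit m V E A EA B EB \<phi>" and x: "x \<in> A" for A EA B EB \<phi>
    proof -
      interpret thsplit m V E A EA B EB \<phi> by (rule s)
      show ?thesis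
      proof (cases "y \<in> A")
        case True
        have "\<phi> x \<notin> A" "\<phi> y \<notin> A" "\<phi> x \<noteq> \<phi> y"
          using phi_in x True disj phi_eq less.prems(4) by blast+
        then have "nbrs E x \<inter> nbrs E y = nbrs EA x \<inter> nbrs EA y"
          unfolding nbrs_A[OF x] nbrs_A[OF True] using nbrs_EA by blast
        then show ?thesis using less.IH[OF _ tA x True less.prems(4)] sp(1) by simp
      next
        case False
        then have y: "y \<in> B" using less.prems(3) V by auto
        let ?I = "inv_into A \<phi>"
        have ny: "nbrs E y = insert (?I y) (nbrs EB y)" using thsplit.nbrs_A[OF swap y] .
        have "nbrs EB y \<subseteq> B" using thsplit.nbrs_EA[OF swap] .
        then have "nbrs E x \<inter> nbrs E y \<subseteq> {\<phi> x, ?I y}"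
          unfolding nbrs_A[OF x] ny using nbrs_EA[of x] disj by blast
        then have "card (nbrs E x \<inter> nbrs E y) \<le> card {\<phi> x, ?I y}" by (intro card_mono) auto
        also have "\<dots> \<le> 2" by (simp add: card_insert_if)
        finally show ?thesis .
      qed
    qed
    have "x \<in> A \<or> x \<in> B" using less.prems(2) sp(2) unfolding thsplit_def by auto
    then show ?thesis using main[OF sp(2)] main[OF thsplit.swap[OF sp(2)]] by blast
  qed
qed

section \<open>Counting fault-free neighbours\<close>

definition good_nbrs :: "'a set \<Rightarrow> 'a set set \<Rightarrow> 'a set \<Rightarrow> 'a set set \<Rightarrow> 'a \<Rightarrow> 'a set" where
  "good_nbrs FV FE V E x = {z \<in> V - FV. {x, z} \<in> E - FE}"

lemma good_nbrs_sub: "good_nbrs FV FE V E x \<subseteq> V - FV"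
  unfolding good_nbrs_def by auto

lemma nbrs_sub: "thln n V E \<Longrightarrow> nbrs E x \<subseteq> V"
  using thln_basic unfolding nbrs_def by (fastforce simp: doubleton_eq_iff)

lemma nbrs_gd:
  assumes "thln n V E"
  shows "card (nbrs E x) \<le> card (good_nbrs FV FE V E x) + card (FV \<inter> nbrs E x) + card {e \<in> FE \<inter> E. x \<in> e}"
proof -
  have fin: "finite V" "finite E" using thln_basic[OF assms] by auto
  have nV: "nbrs E x \<subseteq> V" using nbrs_sub[OF assms] .
  let ?Y = "{z \<in> nbrs E x. {x, z} \<in> FE}"
  have fn: "finite (nbrs E x)" using nV fin finite_subset by blast
  have "nbrs E x \<subseteq> good_nbrs FV FE V E x \<union> (FV \<inter> nbrs E x) \<union> ?Y"
    using nV unfolding good_nbrs_def nbrs_def by auto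
  moreover have "finite (good_nbrs FV FE V E x)" using good_nbrs_sub[of FV FE V E x] fin finite_subset by blast
  ultimately have "card (nbrs E x) \<le> card (good_nbrs FV FE V E x \<union> (FV \<inter> nbrs E x) \<union> ?Y)"
    using fn by (intro card_mono) auto
  also have "\<dots> \<le> card (good_nbrs FV FE V E x) + card (FV \<inter> nbrs E x) + card ?Y"
    using card_Un_le[of "good_nbrs FV FE V E x \<union> (FV \<inter> nbrs E x)" ?Y] card_Un_le[of "good_nbrs FV FE V E x" "FV \<inter> nbrs E x"]
    by linarith
  also have "card ?Y \<le> card {e \<in> FE \<inter> E. x \<in> e}"
  proof (rule card_inj_on_le[of "\<lambda>z. {x, z}"])
    show "inj_on (\<lambda>z. {x, z}) ?Y" by (auto simp: inj_on_def doubleton_eq_iff)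
    show "(\<lambda>z. {x, z}) ` ?Y \<subseteq> {e \<in> FE \<inter> E. x \<in> e}" by (auto simp: nbrs_def)
    show "finite {e \<in> FE \<inter> E. x \<in> e}" using fin by simp
  qed
  finally show ?thesis by simp
qed

lemma good_nbrs_single:
  assumes "thln n V E" "x \<in> V"
  shows "n \<le> card (good_nbrs FV FE V E x) + nfaults FV FE V E"
proof -
  have fin: "finite V" "finite E" using thln_basic[OF assms(1)] by auto
  have "card (FV \<inter> nbrs E x) \<le> card (FV \<inter> V)" using nbrs_sub[OF assms(1)] fin by (intro card_mono) auto
  moreover have "card {e \<in> FE \<inter> E. x \<in> e} \<le> card (FE \<inter> E)" using fin by (intro card_mono) auto
  ultimately show ?thesis
    using nbrs_gd[OF assms(1), of x FV FE] thln_degree[OF assms] unfolding nfaults_def by linarith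
qed

text \<open>The slack 3 is the possible double count: at most two faulty common neighbours and the
  edge \<open>{x, y}\<close> affect both vertices, every other fault only one.\<close>

lemma good_nbrs_two:
  assumes "thln n V E" "x \<in> V" "y \<in> V" "x \<noteq> y"
  shows "2 * n \<le> card (good_nbrs FV FE V E x) + card (good_nbrs FV FE V E y) + nfaults FV FE V E + 3"
proof -
  have fin: "finite V" "finite E" using thln_basic[OF assms(1)] by auto
  have fn: "finite (nbrs E z)" for z using nbrs_sub[OF assms(1)] fin finite_subset by blast
  let ?P = "FV \<inter> nbrs E x" and ?Q = "FV \<inter> nbrs E y"
  have "card ?P + card ?Q = card (?P \<union> ?Q) + card (?P \<inter> ?Q)" using fn by (intro card_Un_Int) auto
  moreover have "card (?P \<union> ?Q) \<le> card (FV \<inter> V)" using nbrs_sub[OF assms(1)] fin by (intro card_mono) auto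
  moreover have "card (?P \<inter> ?Q) \<le> card (nbrs E x \<inter> nbrs E y)" using fn by (intro card_mono) auto
  moreover have "card (nbrs E x \<inter> nbrs E y) \<le> 2" by (rule thln_codegree[OF assms])
  moreover have "card {e \<in> FE \<inter> E. x \<in> e} + card {e \<in> FE \<inter> E. y \<in> e} \<le> card (FE \<inter> E) + 1"
  proof -
    let ?X = "{e \<in> FE \<inter> E. x \<in> e}" and ?Y = "{e \<in> FE \<inter> E. y \<in> e}"
    have "card ?X + card ?Y = card (?X \<union> ?Y) + card (?X \<inter> ?Y)" using fin by (intro card_Un_Int) auto
    moreover have "card (?X \<union> ?Y) \<le> card (FE \<inter> E)" using fin by (intro card_mono) auto
    moreover have "?X \<inter> ?Y \<subseteq> {{x, y}}"
    proof
      fix e assume e: "e \<in> ?X \<inter> ?Y"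
      obtain a b where "e = {a, b}" using thln_basic[OF assms(1)] e by blast
      then show "e \<in> {{x, y}}" using e assms(4) by auto
    qed
    then have "card (?X \<inter> ?Y) \<le> 1" using card_mono[of "{{x, y}}" "?X \<inter> ?Y"] by simp
    ultimately show ?thesis by linarith
  qed
  ultimately show ?thesis
    using nbrs_gd[OF assms(1), of x FV FE] nbrs_gd[OF assms(1), of y FV FE]
      thln_degree[OF assms(1,2)] thln_degree[OF assms(1,3)] unfolding nfaults_def by linarith
qed

text \<open>The body of \<open>two_dpc\<close> for one quadruple, isolated so that its symmetries
  can reduce the cases.\<close>

definition joined_pairs :: "'a set set \<Rightarrow> 'a set \<Rightarrow> 'a \<Rightarrow> 'a \<Rightarrow> 'a \<Rightarrow> 'a \<Rightarrow> bool" where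
  "joined_pairs E S p q u v \<longleftrightarrow> (\<exists>S1 S2. S1 \<union> S2 = S \<and> S1 \<inter> S2 = {} \<and>
     (hpath E S1 p u \<and> hpath E S2 q v \<or> hpath E S1 p v \<and> hpath E S2 q u))"

lemma joined_pairsI: "hpath E S1 p u \<Longrightarrow> hpath E S2 q v \<Longrightarrow> S1 \<inter> S2 = {} \<Longrightarrow> S1 \<union> S2 = S \<Longrightarrow> joined_pairs E S p q u v"
  unfolding joined_pairs_def by blast

lemma joined_pairs_swap2: "joined_pairs E S p q u v \<Longrightarrow> joined_pairs E S p q v u"
  unfolding joined_pairs_def by blast

lemma joined_pairs_swap1: "joined_pairs E S p q u v \<Longrightarrow> joined_pairs E S q p u v"
  unfolding joined_pairs_def by (metis Int_commute Un_commute)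

lemma joined_pairs_rev: "joined_pairs E S p q u v \<Longrightarrow> joined_pairs E S u v p q"
  unfolding joined_pairs_def
proof (elim exE conjE disjE)
  fix S1 S2 assume "S1 \<union> S2 = S" "S1 \<inter> S2 = {}" "hpath E S1 p u" "hpath E S2 q v"
  then show "\<exists>S1 S2. S1 \<union> S2 = S \<and> S1 \<inter> S2 = {} \<and>
     (hpath E S1 u p \<and> hpath E S2 v q \<or> hpath E S1 u q \<and> hpath E S2 v p)" by (intro exI[of _ S1] exI[of _ S2]) (simp add: hpath_rev)
next
  fix S1 S2 assume "S1 \<union> S2 = S" "S1 \<inter> S2 = {}" "hpath E S1 p v" "hpath E S2 q u"
  then show "\<exists>S1 S2. S1 \<union> S2 = S \<and> S1 \<inter> S2 = {} \<and>
     (hpath E S1 u p \<and> hpath E S2 v q \<or> hpath E S1 u q \<and> hpath E S2 v p)" by (intro exI[of _ S2] exI[of _ S1]) (auto simp: hpath_rev)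
qed

lemma two_dpc_iff: "two_dpc E S \<longleftrightarrow> (\<forall>p\<in>S. \<forall>q\<in>S. \<forall>u\<in>S. \<forall>v\<in>S. distinct [p, q, u, v] \<longrightarrow> joined_pairs E S p q u v)"
  unfolding two_dpc_def joined_pairs_def ..

section \<open>Two-path covers by the position of the four end points\<close>

context thsplit begin

context
  assumes H: "ham_conn_at TYPE('a) m" and m6: "6 \<le> m" and n1: "nfaults FV FE V E \<le> 1"
begin

lemma nfAB: "fA \<le> 1" "fB \<le> 1" "fB + ncross \<le> 1" "fA + fB + ncross \<le> 1"
  using n1 nfaults_split by simp_all

text \<open>One fault, two spared vertices and the 3 of Hamilton-connectedness: this is the origin
  of \<open>6 \<le> m\<close>.\<close>

lemma ham_conn_A_del_two: "finite X \<Longrightarrow> card X \<le> 2 \<Longrightarrow> ham_conn Eg (A - FV - X)"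
  using ham_conn_A_del[OF H] nfAB m6 by simp

lemma ham_conn_B_del_two: "finite X \<Longrightarrow> card X \<le> 2 \<Longrightarrow> ham_conn Eg (B - FV - X)"
  using ham_conn_B_del[OF H] nfAB m6 by simp

lemma pow14: "14 \<le> (2::nat) ^ m"
  using pow_ge[OF m3] m6 by linarith

lemma ham_conn_A_one: "ham_conn Eg (A - FV)" and ham_conn_B_one: "ham_conn Eg (B - FV)"
  using ham_conn_A_del_two[of "{}"] ham_conn_B_del_two[of "{}"] by simp_all

lemma one_cr:
  assumes "p \<in> A - FV" "q \<in> A - FV" "p \<noteq> q" shows "crossable p \<or> crossable q"
proof (rule ccontr)
  assume "\<not> (crossable p \<or> crossable q)"
  then have "{p, q} \<subseteq> {x \<in> A - FV. \<not> crossable x}" using assms by auto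
  moreover have "finite {x \<in> A - FV. \<not> crossable x}" using finA by auto
  ultimately have "card {p, q} \<le> card {x \<in> A - FV. \<not> crossable x}" by (intro card_mono)
  then show False using card_not_cr nfAB(3) assms(3) by simp
qed

text \<open>The digits count the end points in \<open>A\<close> and in \<open>B\<close>. One path
  covers \<open>A\<close> without \<open>q\<close> and \<open>v\<close>; the other goes from
  \<open>q\<close> through all of \<open>B\<close> to \<open>v\<close>.\<close>

lemma pairs_40:
  assumes "p \<in> A - FV" "q \<in> A - FV" "u \<in> A - FV" "v \<in> A - FV" "distinct [p, q, u, v]" "crossable q" "crossable v"
  shows "joined_pairs Eg (V - FV) p q u v"
proof -
  have 1: "hpath Eg (A - FV - {q, v}) p u"
    by (rule ham_connD[OF ham_conn_A_del_two]) (use assms in \<open>auto simp: card_insert_if\<close>)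
  have "\<phi> q \<noteq> \<phi> v" using phi_eq assms by auto
  then have "hpath Eg (B - FV) (\<phi> q) (\<phi> v)" using ham_connD[OF ham_conn_B_one] crossable_in[OF assms(6)] crossable_in[OF assms(7)] by auto
  then have 2: "hpath Eg ({q} \<union> (B - FV)) q (\<phi> v)"
    by (intro extend_to_B[OF hpath_single]) (use assms in auto)
  have 3: "hpath Eg ({q} \<union> (B - FV) \<union> {v}) q v"
    by (rule hpath_join[OF 2 hpath_single]) (use crossable_edge[OF assms(7)] assms disj in \<open>auto simp: insert_commute\<close>)
  show ?thesis by (rule joined_pairsI[OF 1 3]) (use assms disj V_faultfree in auto)
qed

text \<open>Normally the path from \<open>q\<close> covers \<open>B\<close>. If \<open>v\<close> is
  the partner of \<open>q\<close>, it is a single edge, and the path in \<open>A\<close> makes a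
  detour through the rest of \<open>B\<close>.\<close>

lemma pairs_31:
  assumes "p \<in> A - FV" "q \<in> A - FV" "u \<in> A - FV" "v \<in> B - FV" "distinct [p, q, u, v]" "crossable q"
  shows "joined_pairs Eg (V - FV) p q u v"
proof -
  have 1: "hpath Eg (A - FV - {q}) p u"
    by (rule ham_connD[OF ham_conn_A_del_two]) (use assms in \<open>auto simp: card_insert_if\<close>)
  show ?thesis
  proof (cases "\<phi> q = v")
    case False
    then have "hpath Eg (B - FV) (\<phi> q) v" using ham_connD[OF ham_conn_B_one] crossable_in[OF assms(6)] assms by auto
    then have 2: "hpath Eg ({q} \<union> (B - FV)) q v"
      by (intro extend_to_B[OF hpath_single]) (use assms in auto)
    show ?thesis by (rule joined_pairsI[OF 1 2]) (use assms disj V_faultfree in auto)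
  next
    case True
    have 2: "hpath Eg ({q} \<union> {v}) q v"
      by (rule hpath_join[OF hpath_single hpath_single]) (use crossable_edge[OF assms(6)] True assms disj in auto)
    have 3: "hpath Eg ((A - FV - {q}) \<union> (B - FV - {v})) p u"
    proof (rule detour_B[OF 1])
      show "ham_conn Eg (B - FV - {v})" by (rule ham_conn_B_del_two) auto
      have "{x \<in> A - FV - {q}. \<not> crossable x \<or> \<phi> x \<notin> B - FV - {v}} \<subseteq> {x \<in> A - FV. \<not> crossable x}"
        using True phi_eq[of _ q] crossable_in assms(2) by auto
      then have "card {x \<in> A - FV - {q}. \<not> crossable x \<or> \<phi> x \<notin> B - FV - {v}} \<le> card {x \<in> A - FV. \<not> crossable x}"
        using finA by (intro card_mono) auto
      also have "\<dots> \<le> 1" using card_not_cr nfAB(3) by simp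
      finally have c: "card {x \<in> A - FV - {q}. \<not> crossable x \<or> \<phi> x \<notin> B - FV - {v}} \<le> 1" .
      have "card (A - FV) \<ge> 13" using card_A_faultfree pow14 nfAB by linarith
      then have "card (A - FV - {q}) \<ge> 12" using assms(2) finA by simp
      then show "2 * card {x \<in> A - FV - {q}. \<not> crossable x \<or> \<phi> x \<notin> B - FV - {v}} + 1 < card (A - FV - {q})"
        using c by linarith
    qed auto
    show ?thesis by (rule joined_pairsI[OF 3 2]) (use assms disj V_faultfree in auto)
  qed
qed

lemma pairs_22_parallel:
  assumes "p \<in> A - FV" "u \<in> A - FV" "q \<in> B - FV" "v \<in> B - FV" "distinct [p, q, u, v]"
  shows "joined_pairs Eg (V - FV) p q u v"
proof -
  have "hpath Eg (A - FV) p u" "hpath Eg (B - FV) q v" using ham_connD[OF ham_conn_A_one] ham_connD[OF ham_conn_B_one] assms by auto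
  then show ?thesis by (rule joined_pairsI) (use disj V_faultfree in auto)
qed

text \<open>If \<open>u\<close> is the partner of \<open>p\<close>, the edge suffices and
  \<open>q\<close> takes the rest. Otherwise a neighbour \<open>z\<close> of \<open>v\<close> is
  reserved: \<open>q\<close> runs through the rest of \<open>A\<close>, crosses to \<open>z\<close>
  and stops at \<open>v\<close>, while \<open>p\<close> crosses at once and covers \<open>B\<close>
  without \<open>z\<close> and \<open>v\<close>.\<close>

lemma pairs_22_crossing:
  assumes "p \<in> A - FV" "q \<in> A - FV" "u \<in> B - FV" "v \<in> B - FV" "distinct [p, q, u, v]" "crossable p" "\<phi> p \<noteq> v"
  shows "joined_pairs Eg (V - FV) p q u v"
proof (cases "\<phi> p = u")
  case True
  obtain v' where v': "v' \<in> A" "\<phi> v' = v" using phi_ex assms(4) by blast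
  let ?X = "{x \<in> A - FV. \<not> crossable x} \<union> {p, q, v'}"
  have "card ?X \<le> card {x \<in> A - FV. \<not> crossable x} + card {p, q, v'}" by (rule card_Un_le)
  also have "\<dots> \<le> 4" using card_not_cr nfAB(3) card_insert_le_m1[of 3 "{q, v'}" p] by (auto simp: card_insert_if)
  finally have "card ?X < card (A - FV)" using card_A_faultfree pow14 nfAB by linarith
  then have "\<not> A - FV \<subseteq> ?X" using card_mono[of ?X "A - FV"] finA by auto
  then obtain x where x: "x \<in> A - FV" "crossable x" "x \<noteq> p" "x \<noteq> q" "x \<noteq> v'" by auto
  have 1: "hpath Eg ({p} \<union> {u}) p u"
    by (rule hpath_join[OF hpath_single hpath_single]) (use crossable_edge[OF assms(6)] True assms disj in auto)
  have h: "hpath Eg (A - FV - {p}) q x"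
    by (rule ham_connD[OF ham_conn_A_del_two]) (use assms x in auto)
  have "\<phi> x \<noteq> u" "\<phi> x \<noteq> v" using phi_eq x v' assms(1) True by auto
  then have h2: "hpath Eg (B - FV - {u}) (\<phi> x) v"
    by (intro ham_connD[OF ham_conn_B_del_two]) (use assms crossable_in[OF x(2)] in auto)
  have 2: "hpath Eg ((A - FV - {p}) \<union> (B - FV - {u})) q v"
    by (rule extend_to_B[OF h _ x(2) h2]) auto
  show ?thesis by (rule joined_pairsI[OF 1 2]) (use assms disj V_faultfree in auto)
next
  case False
  let ?I = "inv_into A \<phi>"
  let ?good_A = "good_nbrs FV FE B EB v"
  let ?Y = "{z \<in> B - FV. \<not> thsplit.crossable B A ?I FV FE z}"
  \<comment> \<open>Excluding \<open>u\<close> and \<open>\<phi> p\<close> keeps the ends of the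
    path in \<open>B\<close> available; excluding both partners makes the crossing point
    \<open>x\<close> differ from \<open>p\<close> and \<open>q\<close>.\<close>
  let ?X = "?Y \<union> {u, \<phi> p, \<phi> q}"
  have finG: "finite ?good_A" using good_nbrs_sub[of FV FE B EB v] finB finite_subset by blast
  have "card ?X \<le> card ?Y + card {u, \<phi> p, \<phi> q}" by (rule card_Un_le)
  also have "card {u, \<phi> p, \<phi> q} \<le> 3" by (auto simp: card_insert_if)
  also have "card ?Y \<le> fA + ncross" using thsplit.card_not_cr[OF swap, of FV FE] unfolding fc_swap .
  finally have "card ?X + fB \<le> 4" using nfAB by simp
  moreover have "m \<le> card ?good_A + fB" using good_nbrs_single[OF tB] assms(4) by blast
  ultimately have "card ?X < card ?good_A" using m6 nfAB(2) by linarith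
  then have "\<not> ?good_A \<subseteq> ?X" using card_mono[of ?X ?good_A] finB by auto
  then obtain z where z: "z \<in> ?good_A" "z \<notin> ?X" by blast
  have zB: "z \<in> B - FV" "{v, z} \<in> EB - FE" using z(1) unfolding good_nbrs_def by auto
  then obtain x where x: "x \<in> A" "\<phi> x = z" using phi_ex by blast
  have cx: "crossable x" using crossable_swap[OF x(1)] z(2) zB x by auto
  have xpq: "x \<noteq> p" "x \<noteq> q" "z \<noteq> u" "z \<noteq> \<phi> p" using z(2) x by auto
  have zv: "z \<noteq> v" using EB_in zB(2) by blast
  have h: "hpath Eg (A - FV - {p}) q x"
    by (rule ham_connD[OF ham_conn_A_del_two]) (use assms xpq crossable_in[OF cx] in auto)
  have h1: "hpath Eg ({z} \<union> {v}) z v"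
    by (rule hpath_join[OF hpath_single hpath_single]) (use zB EB_sub zv in \<open>auto simp: insert_commute\<close>)
  have 2: "hpath Eg ((A - FV - {p}) \<union> ({z} \<union> {v})) q v"
    by (rule extend_to_B[OF h _ cx]) (use h1 x zB assms in auto)
  have h3: "hpath Eg (B - FV - {z, v}) (\<phi> p) u"
    by (rule ham_connD[OF ham_conn_B_del_two]) (use assms xpq False crossable_in[OF assms(6)] in \<open>auto simp: card_insert_if\<close>)
  have 1: "hpath Eg ({p} \<union> (B - FV - {z, v})) p u"
    by (rule extend_to_B[OF hpath_single _ assms(6) h3]) (use assms in auto)
  show ?thesis by (rule joined_pairsI[OF 1 2]) (use assms disj V_faultfree zB in auto)
qed

lemma pairs_31': 
  assumes "p \<in> A - FV" "q \<in> A - FV" "u \<in> A - FV" "v \<in> B - FV" "distinct [p, q, u, v]"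
  shows "joined_pairs Eg (V - FV) p q u v"
  using one_cr[OF assms(1,2)] pairs_31[OF assms] joined_pairs_swap1[OF pairs_31[OF assms(2,1,3,4)]] assms(5) by auto

lemma pairs_22_crossing':
  assumes "p \<in> A - FV" "q \<in> A - FV" "u \<in> B - FV" "v \<in> B - FV" "distinct [p, q, u, v]"
  shows "joined_pairs Eg (V - FV) p q u v"
proof -
  have main: "joined_pairs Eg (V - FV) p q u v" if "p \<in> A - FV" "q \<in> A - FV" "distinct [p, q, u, v]" "crossable p" for p q
  proof (cases "\<phi> p = v")
    case True
    then show ?thesis
      using joined_pairs_swap2[OF pairs_22_crossing[OF that(1,2) assms(4,3) _ that(4)]] that(3) by auto
  next
    case False then show ?thesis using pairs_22_crossing that assms by blast
  qed
  show ?thesis using one_cr[OF assms(1,2)] main[OF assms(1,2,5)] joined_pairs_swap1[OF main[OF assms(2,1)]] assms(5) by auto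
qed

lemma pairs_40':
  assumes "p \<in> A - FV" "q \<in> A - FV" "u \<in> A - FV" "v \<in> A - FV" "distinct [p, q, u, v]"
  shows "joined_pairs Eg (V - FV) p q u v"
proof -
  have "crossable p \<or> crossable q" "crossable u \<or> crossable v" using one_cr assms by auto
  moreover have "crossable q \<Longrightarrow> crossable u \<Longrightarrow> joined_pairs Eg (V - FV) p q u v"
    by (rule joined_pairs_swap2[OF pairs_40]) (use assms in auto)
  moreover have "crossable p \<Longrightarrow> crossable v \<Longrightarrow> joined_pairs Eg (V - FV) p q u v"
    by (rule joined_pairs_swap1[OF pairs_40]) (use assms in auto)
  moreover have "crossable p \<Longrightarrow> crossable u \<Longrightarrow> joined_pairs Eg (V - FV) p q u v"
    by (rule joined_pairs_swap1[OF joined_pairs_swap2[OF pairs_40]]) (use assms in auto)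
  ultimately show ?thesis using pairs_40[OF assms] by blast
qed

end

lemma pairs_in_halves:
  assumes H: "ham_conn_at TYPE('a) m" and m6: "6 \<le> m" and n1: "nfaults FV FE V E \<le> 1"
    and p: "p \<in> A - FV" and o: "q \<in> V - FV" "u \<in> V - FV" "v \<in> V - FV" and d: "distinct [p, q, u, v]"
  shows "joined_pairs Eg (V - FV) p q u v"
proof -
  note L40 = pairs_40'[OF H m6 n1] and L31 = pairs_31'[OF H m6 n1] and L22a = pairs_22_parallel[OF H m6 n1]
    and L22b = pairs_22_crossing'[OF H m6 n1] and M31 = thsplit.pairs_31'[OF swap H m6 n1]
  consider "q \<in> A" "u \<in> A" "v \<in> A" | "q \<in> A" "u \<in> A" "v \<in> B" | "q \<in> A" "u \<in> B" "v \<in> A" | "q \<in> A" "u \<in> B" "v \<in> B"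
    | "q \<in> B" "u \<in> A" "v \<in> A" | "q \<in> B" "u \<in> A" "v \<in> B" | "q \<in> B" "u \<in> B" "v \<in> A" | "q \<in> B" "u \<in> B" "v \<in> B"
    using o V by auto
  then show ?thesis
  proof cases
    case 1 then show ?thesis using L40 p o d by auto
  next
    case 2 then show ?thesis using L31 p o d by auto
  next
    case 3 then show ?thesis by (intro joined_pairs_swap2[OF L31]) (use p o d in auto)
  next
    case 4 then show ?thesis using L22b p o d by auto
  next
    case 5 then show ?thesis by (intro joined_pairs_rev[OF L31]) (use p o d in auto)
  next
    case 6 then show ?thesis using L22a p o d by auto
  next
    case 7 then show ?thesis by (intro joined_pairs_swap2[OF L22a]) (use p o d in auto)
  next
    case 8 then show ?thesis by (intro joined_pairs_swap1[OF joined_pairs_rev[OF M31]]) (use p o d in auto)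
  qed
qed

end

theorem thln_two_dpc:
  fixes V :: "'a set"
  assumes th: "thln n V E" and n: "7 \<le> n" "nfaults FV FE V E \<le> 1"
  shows "two_dpc (E - FE) (V - FV)"
  unfolding two_dpc_iff
proof (intro ballI impI)
  fix p q u v assume a: "p \<in> V - FV" "q \<in> V - FV" "u \<in> V - FV" "v \<in> V - FV" "distinct [p, q, u, v]"
  have "n \<noteq> 3" using n(1) by simp
  then obtain m A EA B EB \<phi> where sp: "n = Suc m" "thsplit m V E A EA B EB \<phi>"
    by (rule thln_splitE[OF th])
  have m6: "6 \<le> m" using sp(1) n(1) by simp
  then have H: "ham_conn_at TYPE('a) m" using thln_ham_conn_hcycle[where 'a='a, of m] by simp
  have "p \<in> A \<or> p \<in> B" using a(1) sp(2) unfolding thsplit_def by auto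
  then show "joined_pairs (E - FE) (V - FV) p q u v"
    using thsplit.pairs_in_halves[OF sp(2) H m6 n(2) _ a(2-5)] thsplit.pairs_in_halves[OF thsplit.swap[OF sp(2)] H m6 n(2) _ a(2-5)] a(1)
    by auto
qed

section \<open>Near-Hamiltonian cycles\<close>

text \<open>Putting \<open>w\<close> in front of a neighbour on the path splits off the part before
  it, which must have two different ends to be threaded through \<open>B\<close>. If one neighbour
  leaves only \<open>a\<close> there, the other lies further along; hence two neighbours are
  required.\<close>

lemma insert_hpath:
  assumes h: "hpath E S a b" and w: "w \<notin> S" and d: "d1 \<in> S" "d2 \<in> S" "d1 \<noteq> d2" "{w, d1} \<in> E" "{w, d2} \<in> E"
  shows "hpath E (insert w S) w b \<or>
    (\<exists>S1 S2 e. hpath E S1 a e \<and> hpath E S2 w b \<and> a \<noteq> e \<and> S1 \<union> S2 = insert w S \<and> S1 \<inter> S2 = {})"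
proof (cases "d1 = a \<or> d2 = a")
  case True
  have "hpath E ({w} \<union> S) w b" by (rule hpath_join[OF hpath_single h]) (use True d w in auto)
  then show ?thesis by simp
next
  case False
  obtain S1 S2 e where s: "hpath E S1 a e" "hpath E S2 d1 b" "{e, d1} \<in> E" "S1 \<union> S2 = S" "S1 \<inter> S2 = {}"
    using False by (auto intro: hpath_pred[OF h d(1)])
  show ?thesis
  proof (cases "a = e")
    case False
    have "hpath E ({w} \<union> S2) w b" by (rule hpath_join[OF hpath_single s(2) d(4)]) (use w s(4) in auto)
    moreover have "S1 \<union> ({w} \<union> S2) = insert w S" "S1 \<inter> ({w} \<union> S2) = {}" using s(4,5) w by blast+
    ultimately show ?thesis using s(1) False by blast
  next
    case True
    then have S1: "S1 = {a}" using s(1) hpath_eq_ends by metis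
    have "d2 \<in> S2" using d(2) s(4) S1 \<open>\<not> (d1 = a \<or> d2 = a)\<close> by auto
    then obtain T1 T2 e2 where t: "hpath E T1 d1 e2" "hpath E T2 d2 b" "{e2, d2} \<in> E" "T1 \<union> T2 = S2" "T1 \<inter> T2 = {}"
      using d(3) by (auto intro: hpath_pred[OF s(2)])
    have 1: "hpath E ({a} \<union> T1) a e2"
      by (rule hpath_join[OF hpath_single t(1)]) (use s(3,5) True S1 t(4) in auto)
    have 2: "hpath E ({w} \<union> T2) w b" by (rule hpath_join[OF hpath_single t(2) d(5)]) (use w s(4) t(4) in auto)
    have "a \<noteq> e2" using hpath_last_in[OF t(1)] t(4) s(5) S1 by auto
    moreover have "({a} \<union> T1) \<union> ({w} \<union> T2) = insert w S" using s(4) t(4) unfolding S1 by blast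
    moreover have "({a} \<union> T1) \<inter> ({w} \<union> T2) = {}" using s(4,5) t(4,5) w unfolding S1 by blast
    ultimately show ?thesis using 1 2 by blast
  qed
qed

text \<open>A Posa rotation along \<open>{x, d1}\<close> makes the successor of \<open>d1\<close>
  the new end. It has no effect when \<open>d1\<close> is the predecessor of \<open>x\<close>; then
  \<open>d2\<close> serves.\<close>

lemma hpath_rotate2:
  assumes h: "hpath E S s x" and d: "d1 \<in> S" "d2 \<in> S" "d1 \<noteq> d2" "d1 \<noteq> x" "d2 \<noteq> x" "{x, d1} \<in> E" "{x, d2} \<in> E"
  obtains y where "hpath E S s y" "y \<noteq> x"
proof -
  obtain S1 S2 e where s: "hpath E S1 s d1" "hpath E S2 e x" "{d1, e} \<in> E" "S1 \<union> S2 = S" "S1 \<inter> S2 = {}"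
    by (rule hpath_succ[OF h d(1,4)])
  show thesis
  proof (cases "e = x")
    case False
    have "hpath E (S1 \<union> S2) s e"
      by (rule hpath_join[OF s(1) hpath_rev[OF s(2)]]) (use d(6) s(5) in \<open>auto simp: insert_commute\<close>)
    then show thesis using that[of e] False s(4) by simp
  next
    case True
    then have S2: "S2 = {x}" using s(2) hpath_eq_ends by metis
    have "d2 \<in> S1" using d(2,5) s(4) S2 by auto
    then obtain T1 T2 g where t: "hpath E T1 s d2" "hpath E T2 g d1" "{d2, g} \<in> E" "T1 \<union> T2 = S1" "T1 \<inter> T2 = {}"
      using d(3) by (auto intro: hpath_succ[OF s(1)])
    have xn: "x \<notin> S1" using s(5) S2 by auto
    have 1: "hpath E (T1 \<union> {x}) s x"
      by (rule hpath_join[OF t(1) hpath_single]) (use d(7) t(4) xn in \<open>auto simp: insert_commute\<close>)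
    have 2: "hpath E (T1 \<union> {x} \<union> T2) s g"
      by (rule hpath_join[OF 1 hpath_rev[OF t(2)] d(6)]) (use t(4,5) xn in auto)
    have "T1 \<union> {x} \<union> T2 = S" using t(4) s(4) S2 by auto
    moreover have "g \<noteq> x" using hpath_hd_in[OF t(2)] t(4) xn by auto
    ultimately show thesis using that[of g] 2 by simp
  qed
qed

text \<open>Only one vertex is reinstated as faulty, so at most one end of the path is, and the path
  is read from the other end.\<close>

lemma drop_hpath_any:
  assumes "drop1 FV FE FV' FE'" "hpath (E - FE') S s t" "S \<inter> FV' = {}" "s \<noteq> t"
  shows "(\<exists>a b. hpath (E - FE) (S - FV) a b) \<or>
    (\<exists>S1 S2 a b c d. hpath (E - FE) S1 a b \<and> hpath (E - FE) S2 c d \<and> S1 \<union> S2 = S - FV \<and> S1 \<inter> S2 = {})"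
proof (cases "s \<in> FV")
  case False
  then show ?thesis using drop_hpath[OF assms(1-3) False] by blast
next
  case True
  have "t \<notin> FV"
  proof
    assume t: "t \<in> FV"
    have "s \<in> S" "t \<in> S" using hpath_hd_in[OF assms(2)] hpath_last_in[OF assms(2)] by auto
    then show False using t True assms(1,3,4) unfolding drop1_def by auto
  qed
  then show ?thesis using drop_hpath[OF assms(1) hpath_rev[OF assms(2)] assms(3)] by blast
qed

text \<open>\<open>w\<close> may also lie in \<open>S\<close>, so spanning cycles are
  included.\<close>

definition near_cycle :: "'a set set \<Rightarrow> 'a set \<Rightarrow> bool" where
  "near_cycle E R \<longleftrightarrow> (\<exists>S w. S \<subseteq> R \<and> hcycle E S \<and> R \<subseteq> insert w S)"

definition near_cycle_at :: "'a itself \<Rightarrow> nat \<Rightarrow> bool" where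
  "near_cycle_at _ n \<longleftrightarrow> (\<forall>(V::'a set) E FV FE. thln n V E \<longrightarrow> nfaults FV FE V E + 9 \<le> 2 * n \<longrightarrow> near_cycle (E - FE) (V - FV))"

lemma card_ge2_ex: "2 \<le> card X \<Longrightarrow> \<exists>x y. x \<in> X \<and> y \<in> X \<and> x \<noteq> y"
  by (metis One_nat_def card.empty card_1_singletonE card.infinite le_numeral_extra(2) not_less_eq_eq
      numeral_2_eq_2 card_le_Suc0_iff_eq zero_le)

section \<open>Closing pieces of the larger half through the other half\<close>

context thsplit begin

lemma two_dpc_B: "7 \<le> m \<Longrightarrow> fB \<le> 1 \<Longrightarrow> two_dpc Eg (B - FV)"
  using two_dpc_mono[OF thln_two_dpc[OF tB] EB_sub] .

lemma ham_conn_B_del': "fB + 3 \<le> m \<Longrightarrow> ham_conn Eg (B - FV)"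
  using ham_conn_B thln_ham_conn_hcycle[where 'a='a, OF m3] by blast

lemma close_piece:
  assumes "hpath Eg Q a b" "Q \<subseteq> A" "crossable a" "crossable b" "3 \<le> card Q" "ham_conn Eg (B - FV)"
  shows "hcycle Eg (Q \<union> (B - FV))"
proof -
  have "a \<noteq> b" using hpath_card1[OF assms(1)] assms(5) by auto
  then have "\<phi> b \<noteq> \<phi> a" using phi_eq crossable_in assms(3,4) by blast
  then have h: "hpath Eg (B - FV) (\<phi> b) (\<phi> a)" using ham_connD[OF assms(6)] crossable_in[OF assms(3)] crossable_in[OF assms(4)] by auto
  have 1: "hpath Eg (Q \<union> (B - FV)) a (\<phi> a)" by (rule extend_to_B[OF assms(1,2,4) h]) auto
  moreover have "card Q \<le> card (Q \<union> (B - FV))" using hpath_finite[OF 1] by (intro card_mono) auto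
  ultimately show ?thesis using crossable_edge[OF assms(3)] assms(5) unfolding hcycle_def by (metis le_trans)
qed

text \<open>\<open>S1\<close> is closed by a path of \<open>B\<close> between the partners of its
  ends, with \<open>S2\<close> threaded into that path.\<close>

lemma close_two_pieces:
  assumes "hpath Eg S1 a e" "hpath Eg S2 f b" "a \<noteq> e" "f \<noteq> b" "S1 \<subseteq> A" "S2 \<subseteq> A" "S1 \<inter> S2 = {}"
    "crossable a" "crossable b" "crossable e" "crossable f" "two_dpc Eg (B - FV)"
  shows "hcycle Eg (S1 \<union> S2 \<union> (B - FV))"
proof -
  let ?T = "B - FV"
  have i: "a \<in> S1" "e \<in> S1" "f \<in> S2" "b \<in> S2"
    using hpath_hd_in[OF assms(1)] hpath_last_in[OF assms(1)] hpath_hd_in[OF assms(2)] hpath_last_in[OF assms(2)] by auto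
  have iA: "a \<in> A" "e \<in> A" "f \<in> A" "b \<in> A" using i assms(5,6) by auto
  have ne: "a \<noteq> f" "a \<noteq> b" "e \<noteq> f" "e \<noteq> b" using i assms(7) by auto
  have h: "hpath Eg (S2 \<union> ?T) (\<phi> e) (\<phi> a)"
    by (rule thread_piece[OF assms(2,6,4,11,9) _ _ _ _ _ _ _ _ _ _ assms(12)])
      (use crossable_in[OF assms(8)] crossable_in[OF assms(9)] crossable_in[OF assms(10)] crossable_in[OF assms(11)] ne assms(3) iA in \<open>auto simp: phi_eq\<close>)
  have 1: "hpath Eg (S1 \<union> (S2 \<union> ?T)) a (\<phi> a)"
    by (rule hpath_join[OF assms(1) h crossable_edge[OF assms(10)]]) (use assms disj in auto)
  have "card {a, e, f} \<le> card (S1 \<union> (S2 \<union> ?T))" using hpath_finite[OF 1] i by (intro card_mono) auto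
  then have "3 \<le> card (S1 \<union> (S2 \<union> ?T))" using ne assms(3) by simp
  then show ?thesis using 1 crossable_edge[OF assms(8)] unfolding hcycle_def by (metis Un_assoc)
qed

lemma near_cycleI:
  assumes "hcycle Eg (Q \<union> (B - FV))" "Q \<subseteq> A - FV" "A - FV \<subseteq> insert w Q"
  shows "near_cycle Eg (V - FV)"
  unfolding near_cycle_def V_faultfree using assms by (intro exI[of _ "Q \<union> (B - FV)"] exI[of _ w]) auto

lemma good_nbrs_A: "x \<in> good_nbrs FV FE A EA y \<Longrightarrow> {y, x} \<in> Eg \<and> x \<in> A - FV \<and> x \<noteq> y"
  using EA_in EA_sub unfolding good_nbrs_def by blast

lemma good_nbrs_sym: "x \<in> good_nbrs FV FE A EA y \<Longrightarrow> y \<in> A - FV \<Longrightarrow> y \<in> good_nbrs FV FE A EA x"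
  unfolding good_nbrs_def by (auto simp: insert_commute)

text \<open>At most one fault lies outside \<open>A\<close>, so \<open>a\<close> is the only vertex
  that cannot cross. It either stops being an end or becomes the missed vertex.\<close>

lemma near_cycle_uncrossable_end:
  assumes m7: "7 \<le> m" and a: "fA + 8 \<le> 2 * m" and b: "fB + ncross \<le> 1"
    and h: "hpath Eg Q a b" and Q: "Q \<subseteq> A - FV" "A - FV \<subseteq> insert w Q" and nc: "\<not> crossable a"
  shows "near_cycle Eg (V - FV)"
proof -
  have HB: "ham_conn Eg (B - FV)" by (rule ham_conn_B_del') (use b m7 in simp)
  have DB: "two_dpc Eg (B - FV)" by (rule two_dpc_B) (use b m7 in simp_all)
  have fR: "finite (A - FV)" using finA by simp
  have fQ: "finite Q" using Q(1) fR finite_subset by blast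
  have "card (A - FV) \<le> card (insert w Q)" using Q(2) fQ by (intro card_mono) auto
  also have "\<dots> \<le> card Q + 1" by (simp add: card_insert_if fQ)
  finally have cQ: "5 \<le> card Q" using card_A_faultfree pow_ge7[OF m7] a by linarith
  have aR: "a \<in> A - FV" using hpath_hd_in[OF h] Q by auto
  have crossable: "crossable x" if "x \<in> A - FV" "x \<noteq> a" for x
  proof (rule ccontr)
    assume "\<not> crossable x"
    then have "{x, a} \<subseteq> {x \<in> A - FV. \<not> crossable x}" using that nc aR by auto
    then have "card {x, a} \<le> card {x \<in> A - FV. \<not> crossable x}" using finA by (intro card_mono) auto
    then show False using card_not_cr b that(2) by simp
  qed
  have ab: "a \<noteq> b" using hpath_card1[OF h] cQ by auto
  have bR: "b \<in> A - FV" using hpath_last_in[OF h] Q by auto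
  obtain S1 S2 a' where s: "hpath Eg S1 a a" "hpath Eg S2 a' b" "{a, a'} \<in> Eg" "S1 \<union> S2 = Q" "S1 \<inter> S2 = {}"
    by (rule hpath_succ[OF h hpath_hd_in[OF h] ab])
  have S1: "S1 = {a}" using hpath_eq_ends[OF s(1)] .
  have S2: "S2 = Q - {a}" using s(4,5) S1 by auto
  have cS2: "4 \<le> card S2" using cQ S2 hpath_hd_in[OF h] fQ by simp
  have S2R: "S2 \<subseteq> A - FV" using S2 Q by auto
  have a': "a' \<in> A - FV" "a' \<noteq> a" using hpath_hd_in[OF s(2)] S2 Q by auto
  show ?thesis
  proof (cases "A - FV \<subseteq> Q")
    case True
    have "hcycle Eg (S2 \<union> (B - FV))"
      by (rule close_piece[OF s(2) _ crossable crossable _ HB]) (use a' bR ab S2R cS2 in auto)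
    then show ?thesis by (rule near_cycleI[where w = a]) (use S2 True Q in auto)
  next
    case False
    then have w: "w \<in> A - FV" "w \<notin> Q" using Q by auto
    have wa: "w \<noteq> a" using w hpath_hd_in[OF h] by auto
    let ?good_A = "good_nbrs FV FE A EA a"
    consider "w \<in> ?good_A" | "w \<notin> ?good_A" "2 \<le> card ?good_A" | "w \<notin> ?good_A" "card ?good_A \<le> 1" by linarith
    then show ?thesis
    proof cases
      case 1
      have h1: "hpath Eg ({w} \<union> Q) w b"
        by (rule hpath_join[OF hpath_single h]) (use good_nbrs_A[OF 1] w in \<open>auto simp: insert_commute\<close>)
      have "hcycle Eg (({w} \<union> Q) \<union> (B - FV))"
        by (rule close_piece[OF h1 _ crossable crossable _ HB]) (use w wa bR ab Q cQ fQ in auto)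
      then show ?thesis by (rule near_cycleI) (use w Q in auto)
    next
      case 2
      obtain d1 d2 where d: "d1 \<in> ?good_A" "d2 \<in> ?good_A" "d1 \<noteq> d2" using card_ge2_ex[OF 2(2)] by blast
      have dQ: "d1 \<in> Q" "d2 \<in> Q" using good_nbrs_A[OF d(1)] good_nbrs_A[OF d(2)] d 2(1) Q by auto
      obtain y where y: "hpath Eg Q b y" "y \<noteq> a"
        by (rule hpath_rotate2[OF hpath_rev[OF h] dQ d(3)]) (use good_nbrs_A[OF d(1)] good_nbrs_A[OF d(2)] in auto)
      have yR: "y \<in> A - FV" using hpath_last_in[OF y(1)] Q by auto
      have "hcycle Eg (Q \<union> (B - FV))"
        by (rule close_piece[OF y(1) _ crossable crossable _ HB]) (use y yR bR ab Q cQ in auto)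
      then show ?thesis by (rule near_cycleI) (use Q in auto)
    next
      case 3
      have "2 * m \<le> card ?good_A + card (good_nbrs FV FE A EA w) + fA + 3"
        by (rule good_nbrs_two[OF tA]) (use aR w wa in auto)
      \<comment> \<open>With \<open>fA \<le> 2 * m - 8\<close> the vertices \<open>a\<close> and
        \<open>w\<close> have at least five usable neighbours together, and \<open>a\<close> has at
        most one of them.\<close>
      then have "2 \<le> card (good_nbrs FV FE A EA w)" using 3 a by linarith
      then obtain d1 d2 where d: "d1 \<in> good_nbrs FV FE A EA w" "d2 \<in> good_nbrs FV FE A EA w" "d1 \<noteq> d2"
        using card_ge2_ex by blast
      have dS: "x \<in> S2 \<and> {w, x} \<in> Eg" if x: "x \<in> good_nbrs FV FE A EA w" for x
      proof -
        have "x \<noteq> a" using good_nbrs_sym[OF x w(1)] 3(1) by auto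
        then show ?thesis using good_nbrs_A[OF x] Q S2 by auto
      qed
      have wS2: "w \<notin> S2" using w S2 by auto
      have "hpath Eg (insert w S2) w b \<or>
        (\<exists>S1 T e. hpath Eg S1 a' e \<and> hpath Eg T w b \<and> a' \<noteq> e \<and> S1 \<union> T = insert w S2 \<and> S1 \<inter> T = {})"
        by (rule insert_hpath[OF s(2) wS2 _ _ d(3)]) (use dS d in auto)
      then have "hcycle Eg (insert w S2 \<union> (B - FV))"
      proof (elim disjE exE conjE)
        assume h1: "hpath Eg (insert w S2) w b"
        show ?thesis
          by (rule close_piece[OF h1 _ crossable crossable _ HB]) (use w wa bR ab S2R cS2 wS2 S2 fQ in auto)
      next
        fix X T e assume x: "hpath Eg X a' e" "hpath Eg T w b" "a' \<noteq> e" "X \<union> T = insert w S2" "X \<inter> T = {}"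
        have e: "e \<in> X" using hpath_last_in[OF x(1)] .
        have "e \<in> insert w S2" using e x(4) by auto
        then have e': "e \<in> A - FV" "e \<noteq> a" using S2R w wa S2 by auto
        have "w \<noteq> b" using w hpath_last_in[OF h] by auto
        then have "hcycle Eg (X \<union> T \<union> (B - FV))"
          by (intro close_two_pieces[OF x(1,2,3) _ _ _ x(5) crossable crossable crossable crossable DB]) (use x(4) S2R w wa bR ab a' e' in auto)
        then show ?thesis using x(4) by simp
      qed
      then show ?thesis by (rule near_cycleI[where w = a]) (use S2 Q w in auto)
    qed
  qed
qed

text \<open>After two faults are reinstated, one piece is the single vertex \<open>a\<close>, while
  \<open>w\<close> may be missing already. Adjacent, \<open>a\<close> and \<open>w\<close> form a
  piece with two ends. Otherwise they have at least four usable neighbours together, all in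
  \<open>S\<close>, so one of them can be inserted and the other is missed.\<close>

lemma near_cycle_single_piece:
  assumes m7: "7 \<le> m" and a: "fA + 7 \<le> 2 * m" and b: "fB = 0" "ncross = 0"
    and h: "hpath Eg S f b" and S: "S \<subseteq> A - FV" "a \<in> A - FV" "a \<notin> S" "A - FV \<subseteq> insert w (insert a S)"
  shows "near_cycle Eg (V - FV)"
proof -
  have HB: "ham_conn Eg (B - FV)" by (rule ham_conn_B_del') (use b m7 in simp)
  have DB: "two_dpc Eg (B - FV)" by (rule two_dpc_B) (use b m7 in simp_all)
  have fS: "finite S" using hpath_finite[OF h] .
  have crossable: "\<And>x. x \<in> A - FV \<Longrightarrow> crossable x" using crossable_all[OF b] .
  have "card (A - FV) \<le> card (insert w (insert a S))" using S(4) fS by (intro card_mono) auto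
  also have "\<dots> \<le> card S + 2" using fS by (simp add: card_insert_if)
  finally have cS: "5 \<le> card S" using card_A_faultfree pow_ge7[OF m7] a by linarith
  have fb: "f \<noteq> b" using hpath_card1[OF h] cS by auto
  have i: "f \<in> A - FV" "b \<in> A - FV" using hpath_hd_in[OF h] hpath_last_in[OF h] S by auto
  show ?thesis
  proof (cases "A - FV \<subseteq> insert a S")
    case True
    have "hcycle Eg (S \<union> (B - FV))" by (rule close_piece[OF h _ crossable crossable _ HB]) (use i S cS in auto)
    then show ?thesis by (rule near_cycleI[where w = a]) (use S True in auto)
  next
    case False
    then have w: "w \<in> A - FV" "w \<notin> S" "w \<noteq> a" using S by auto
    show ?thesis
    proof (cases "w \<in> good_nbrs FV FE A EA a")
      case True
      have h1: "hpath Eg ({a} \<union> {w}) a w"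
        by (rule hpath_join[OF hpath_single hpath_single]) (use good_nbrs_A[OF True] in auto)
      have "hcycle Eg (({a} \<union> {w}) \<union> S \<union> (B - FV))"
        by (rule close_two_pieces[OF h1 h _ _ _ _ _ crossable crossable crossable crossable DB]) (use w S i fb in auto)
      then show ?thesis by (rule near_cycleI) (use w S in auto)
    next
      case False
      have F2: "a \<notin> good_nbrs FV FE A EA w" using False good_nbrs_sym w by blast
      have main: "near_cycle Eg (V - FV)" if x: "x \<in> A - FV" "x \<notin> S" "y \<notin> good_nbrs FV FE A EA x" "2 \<le> card (good_nbrs FV FE A EA x)"
        "A - FV \<subseteq> insert y (insert x S)" for x y
      proof -
        obtain d1 d2 where d: "d1 \<in> good_nbrs FV FE A EA x" "d2 \<in> good_nbrs FV FE A EA x" "d1 \<noteq> d2"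
          using card_ge2_ex[OF x(4)] by blast
        have dS: "z \<in> S \<and> {x, z} \<in> Eg" if z: "z \<in> good_nbrs FV FE A EA x" for z
          using good_nbrs_A[OF z] x z by auto
        have "hpath Eg (insert x S) x b \<or>
          (\<exists>S1 T e. hpath Eg S1 f e \<and> hpath Eg T x b \<and> f \<noteq> e \<and> S1 \<union> T = insert x S \<and> S1 \<inter> T = {})"
          by (rule insert_hpath[OF h x(2) _ _ d(3)]) (use dS d in auto)
        then have "hcycle Eg (insert x S \<union> (B - FV))"
        proof (elim disjE exE conjE)
          assume h1: "hpath Eg (insert x S) x b"
          show ?thesis by (rule close_piece[OF h1 _ crossable crossable _ HB]) (use x i S cS fS in auto)
        next
          fix X T e assume t: "hpath Eg X f e" "hpath Eg T x b" "f \<noteq> e" "X \<union> T = insert x S" "X \<inter> T = {}"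
          have "e \<in> insert x S" using hpath_last_in[OF t(1)] t(4) by auto
          then have e': "e \<in> A - FV" using S x by auto
          have "x \<noteq> b" using x hpath_last_in[OF h] by auto
          then have "hcycle Eg (X \<union> T \<union> (B - FV))"
            by (intro close_two_pieces[OF t(1,2,3) _ _ _ t(5) crossable crossable crossable crossable DB]) (use t(4) S x i e' in auto)
          then show ?thesis using t(4) by simp
        qed
        then show ?thesis by (rule near_cycleI[where w = y]) (use x S in auto)
      qed
      have "2 * m \<le> card (good_nbrs FV FE A EA a) + card (good_nbrs FV FE A EA w) + fA + 3"
        by (rule good_nbrs_two[OF tA]) (use S w in auto)
      then have "2 \<le> card (good_nbrs FV FE A EA a) \<or> 2 \<le> card (good_nbrs FV FE A EA w)" using a by linarith
      then show ?thesis using main[OF S(2,3) False] main[OF w(1,2) F2] S(4) by (auto simp: insert_commute)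
    qed
  qed
qed

text \<open>The three cases: no fault of \<open>A\<close>, one fault or two faults have to be ignored.\<close>

lemma near_cycle_step:
  assumes NC: "near_cycle_at TYPE('a) m" and m7: "7 \<le> m" and n: "nfaults FV FE V E + 9 \<le> 2 * Suc m"
    and le: "fB \<le> fA"
  shows "near_cycle Eg (V - FV)"
proof -
  have sum: "fA + fB + ncross + 7 \<le> 2 * m" using n nfaults_split by simp
  have pow: "16 * m + 16 \<le> 2 ^ m" using pow_ge7[OF m7] .
  have fR: "finite (A - FV)" using finA by simp
  consider "fA + 9 \<le> 2 * m" | "fA = Suc (2 * m - 9)" "fB + ncross \<le> 1"
    | "fA = Suc (2 * m - 8)" "fB = 0" "ncross = 0" using sum m7 by linarith
  then show ?thesis
  proof cases
    case 1
    have "near_cycle (EA - FE) (A - FV)" using NC tA 1 unfolding near_cycle_at_def by blast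
    then obtain S w where S: "S \<subseteq> A - FV" "hcycle (EA - FE) S" "A - FV \<subseteq> insert w S" unfolding near_cycle_def by blast
    have HB: "ham_conn Eg (B - FV)" by (rule ham_conn_B_del') (use sum le in linarith)
    have fS: "finite S" using hcycle_finite[OF S(2)] .
    have "card (A - FV) \<le> card (insert w S)" using S(3) fS by (intro card_mono) auto
    also have "\<dots> \<le> card S + 1" using fS by (simp add: card_insert_if)
    finally have cS: "card (A - FV) \<le> card S + 1" .
    have "{x \<in> S. \<not> crossable x \<or> \<phi> x \<notin> B - FV} \<subseteq> {x \<in> A - FV. \<not> crossable x}" using S(1) crossable_in by auto
    then have "card {x \<in> S. \<not> crossable x \<or> \<phi> x \<notin> B - FV} \<le> card {x \<in> A - FV. \<not> crossable x}" using finA by (intro card_mono) auto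
    then have "2 * card {x \<in> S. \<not> crossable x \<or> \<phi> x \<notin> B - FV} + 1 < card S"
      using card_not_cr cS card_A_faultfree pow sum by linarith
    then have "hcycle Eg (S \<union> (B - FV))"
      using hcycle_through[OF hcycle_mono[OF S(2) EA_sub] S(1) subset_refl HB] by blast
    then show ?thesis using near_cycleI S(1,3) by blast
  next
    case 2
    obtain FV' FE' where d: "drop1 FV FE FV' FE'" "nfaults FV' FE' A EA = 2 * m - 9"
      by (rule drop1_ex[OF tA 2(1)])
    have "near_cycle (EA - FE') (A - FV')" using NC tA d(2) m7 unfolding near_cycle_at_def by simp
    then obtain S w where S: "S \<subseteq> A - FV'" "hcycle (EA - FE') S" "A - FV' \<subseteq> insert w S" unfolding near_cycle_def by blast
    have "S \<inter> FV' = {}" using S(1) by auto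
    then obtain a b where ab: "hpath (EA - FE) (S - FV) a b" "a \<noteq> b"
      by (rule drop_hcycle[OF d(1) S(2)])
    have h: "hpath Eg (S - FV) a b" using hpath_mono[OF ab(1) EA_sub] .
    have Q: "S - FV \<subseteq> A - FV" "A - FV \<subseteq> insert w (S - FV)" using S drop1_sub[OF d(1)] by auto
    have a8: "fA + 8 \<le> 2 * m" using 2 m7 by simp
    consider "\<not> crossable a" | "\<not> crossable b" | "crossable a" "crossable b" by blast
    then show ?thesis
    proof cases
      case 1 then show ?thesis using near_cycle_uncrossable_end[OF m7 a8 2(2) h Q] by blast
    next
      case 2 then show ?thesis using near_cycle_uncrossable_end[OF m7 a8 \<open>fB + ncross \<le> 1\<close> hpath_rev[OF h] Q] by blast
    next
      case 3
      have HB: "ham_conn Eg (B - FV)" by (rule ham_conn_B_del') (use 2 m7 in linarith)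
      have fQ: "finite (S - FV)" using hpath_finite[OF h] .
      have "card (A - FV) \<le> card (insert w (S - FV))" using Q(2) fQ by (intro card_mono) auto
      also have "\<dots> \<le> card (S - FV) + 1" using fQ by (simp add: card_insert_if)
      finally have "3 \<le> card (S - FV)" using card_A_faultfree pow a8 by linarith
      then have "hcycle Eg ((S - FV) \<union> (B - FV))" using close_piece[OF h _ 3 _ HB] Q(1) by blast
      then show ?thesis using near_cycleI Q by blast
    qed
  next
    case 3
    have crossable: "\<And>x. x \<in> A - FV \<Longrightarrow> crossable x" using crossable_all[OF 3(2,3)] .
    have HB: "ham_conn Eg (B - FV)" by (rule ham_conn_B_del') (use 3 m7 in linarith)
    have DB: "two_dpc Eg (B - FV)" by (rule two_dpc_B) (use 3 m7 in simp_all)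
    have a7: "fA + 7 \<le> 2 * m" using 3 m7 by simp
    obtain FV' FE' where d: "drop1 FV FE FV' FE'" "nfaults FV' FE' A EA = 2 * m - 8"
      by (rule drop1_ex[OF tA 3(1)])
    have "nfaults FV' FE' A EA = Suc (2 * m - 9)" using d(2) m7 by simp
    then obtain FV'' FE'' where d': "drop1 FV' FE' FV'' FE''" "nfaults FV'' FE'' A EA = 2 * m - 9"
      by (rule drop1_ex[OF tA])
    have "near_cycle (EA - FE'') (A - FV'')" using NC tA d'(2) m7 unfolding near_cycle_at_def by simp
    then obtain S w where S: "S \<subseteq> A - FV''" "hcycle (EA - FE'') S" "A - FV'' \<subseteq> insert w S" unfolding near_cycle_def by blast
    have "S \<inter> FV'' = {}" using S(1) by auto
    then obtain a b where ab: "hpath (EA - FE') (S - FV') a b" "a \<noteq> b"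
      by (rule drop_hcycle[OF d'(1) S(2)])
    have SF: "S - FV' - FV = S - FV" using drop1_sub[OF d(1)] by auto
    have Q: "S - FV \<subseteq> A - FV" "A - FV \<subseteq> insert w (S - FV)"
      using S drop1_sub[OF d(1)] drop1_sub[OF d'(1)] by auto
    have "(\<exists>a b. hpath (EA - FE) (S - FV) a b) \<or>
      (\<exists>S1 S2 a b c d. hpath (EA - FE) S1 a b \<and> hpath (EA - FE) S2 c d \<and> S1 \<union> S2 = S - FV \<and> S1 \<inter> S2 = {})"
      using drop_hpath_any[OF d(1) ab(1) _ ab(2)] unfolding SF by blast
    then show ?thesis
    proof (elim disjE exE conjE)
      fix a b assume h0: "hpath (EA - FE) (S - FV) a b"
      have h: "hpath Eg (S - FV) a b" using hpath_mono[OF h0 EA_sub] .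
      have fQ: "finite (S - FV)" using hpath_finite[OF h] .
      have "card (A - FV) \<le> card (insert w (S - FV))" using Q(2) fQ by (intro card_mono) auto
      also have "\<dots> \<le> card (S - FV) + 1" using fQ by (simp add: card_insert_if)
      finally have "3 \<le> card (S - FV)" using card_A_faultfree pow a7 by linarith
      then have "hcycle Eg ((S - FV) \<union> (B - FV))"
        using close_piece[OF h _ crossable crossable _ HB] Q(1) hpath_hd_in[OF h] hpath_last_in[OF h] by blast
      then show ?thesis using near_cycleI Q by blast
    next
      fix S1 S2 a b e g assume s: "hpath (EA - FE) S1 a b" "hpath (EA - FE) S2 e g" "S1 \<union> S2 = S - FV" "S1 \<inter> S2 = {}"
      note h = hpath_mono[OF s(1) EA_sub] hpath_mono[OF s(2) EA_sub]
      have i: "a \<in> S1" "b \<in> S1" "e \<in> S2" "g \<in> S2"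
        using hpath_hd_in[OF h(1)] hpath_last_in[OF h(1)] hpath_hd_in[OF h(2)] hpath_last_in[OF h(2)] by auto
      have SR: "S1 \<subseteq> A - FV" "S2 \<subseteq> A - FV" using s(3) Q(1) by auto
      \<comment> \<open>A piece consisting of one vertex cannot be threaded, which is why these
        cases are separated.\<close>
      consider "a = b" | "e = g" | "a \<noteq> b" "e \<noteq> g" by blast
      then show ?thesis
      proof cases
        case 1
        then have "S1 = {a}" using hpath_eq_ends[of Eg S1 a] h(1) by simp
        then have "A - FV \<subseteq> insert w (insert a S2)" "a \<notin> S2" using Q(2) s(3,4) by auto
        then show ?thesis using near_cycle_single_piece[OF m7 a7 3(2,3) h(2) SR(2)] SR(1) i(1) by blast
      next
        case 2
        then have "S2 = {e}" using hpath_eq_ends[of Eg S2 e] h(2) by simp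
        then have "A - FV \<subseteq> insert w (insert e S1)" "e \<notin> S1" using Q(2) s(3,4) by auto
        then show ?thesis using near_cycle_single_piece[OF m7 a7 3(2,3) h(1) SR(1)] SR(2) i(3) by blast
      next
        case 3
        have "hcycle Eg (S1 \<union> S2 \<union> (B - FV))"
          by (rule close_two_pieces[OF h 3 _ _ s(4) crossable crossable crossable crossable DB]) (use SR i in auto)
        then show ?thesis using near_cycleI Q unfolding s(3) by blast
      qed
    qed
  qed
qed

end

theorem thln_near_cycle:
  assumes "7 \<le> n" shows "near_cycle_at TYPE('a) n"
  using assms
proof (induction n rule: dec_induct)
  case base
  show ?case unfolding near_cycle_at_def
  proof (intro allI impI)
    fix V :: "'a set" and E FV FE assume "thln 7 V E" "nfaults FV FE V E + 9 \<le> 2 * 7"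
    then have "hcycle (E - FE) (V - FV)" using thln_ham_conn_hcycle[where 'a='a, of 7] unfolding hcycle_at_def by simp
    then show "near_cycle (E - FE) (V - FV)" unfolding near_cycle_def by blast
  qed
next
  case (step n)
  show ?case unfolding near_cycle_at_def
  proof (intro allI impI)
    fix V :: "'a set" and E FV FE
    assume th: "thln (Suc n) V E" and nn: "nfaults FV FE V E + 9 \<le> 2 * Suc n"
    have n3: "Suc n \<noteq> 3" using step.hyps by simp
    obtain m A EA B EB \<phi> where sp: "Suc n = Suc m" "thsplit m V E A EA B EB \<phi>" "nfaults FV FE B EB \<le> nfaults FV FE A EA"
      by (rule thln_wlog[OF th n3])
    have m: "m = n" using sp(1) by simp
    show "near_cycle (E - FE) (V - FV)"
      by (rule thsplit.near_cycle_step[OF sp(2) _ _ _ sp(3)]) (use m step nn in auto)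
  qed
qed

section \<open>Near-Hamiltonian paths\<close>

definition near_path :: "'a set set \<Rightarrow> 'a set \<Rightarrow> 'a \<Rightarrow> 'a \<Rightarrow> bool" where
  "near_path E R s t \<longleftrightarrow> (\<exists>S w. S \<subseteq> R \<and> hpath E S s t \<and> R \<subseteq> insert w S)"

lemma near_path_rev: "near_path E R s t \<Longrightarrow> near_path E R t s"
  unfolding near_path_def using hpath_rev by metis

definition near_path_at :: "'a itself \<Rightarrow> nat \<Rightarrow> bool" where
  "near_path_at _ n \<longleftrightarrow> (\<forall>(V::'a set) E FV FE s t. thln n V E \<longrightarrow> nfaults FV FE V E + 10 \<le> 2 * n \<longrightarrow>
     s \<in> V - FV \<longrightarrow> t \<in> V - FV \<longrightarrow> s \<noteq> t \<longrightarrow> (\<exists>z\<in>good_nbrs FV FE V E s. z \<noteq> t) \<longrightarrow> (\<exists>z\<in>good_nbrs FV FE V E t. z \<noteq> s) \<longrightarrow>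
     near_path (E - FE) (V - FV) s t)"

lemma card_ge2_avoid: "2 \<le> card X \<Longrightarrow> \<exists>z\<in>X. z \<noteq> y"
  using card_ge2_ex by metis

lemma card_ge3_avoid:
  assumes "3 \<le> card X" shows "\<exists>z\<in>X. z \<noteq> y \<and> z \<noteq> y'"
proof (rule ccontr)
  assume "\<not> ?thesis"
  then have "X \<subseteq> {y, y'}" by auto
  then have "card X \<le> card {y, y'}" by (intro card_mono) auto
  then show False using assms by (simp add: card_insert_if split: if_splits)
qed

text \<open>A single fault meets at most one of two disjoint pieces. The empty edge would be
  contained in both, hence the condition \<open>{} \<notin> E\<close>.\<close>

lemma drop1_unaffected:
  assumes d: "drop1 FV FE FV' FE'" and e: "{} \<notin> E"
    and h: "hpath (E - FE') S1 a b" "hpath (E - FE') S2 c g" "S1 \<inter> S2 = {}" "S1 \<inter> FV' = {}" "S2 \<inter> FV' = {}"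
  shows "(hpath (E - FE) S1 a b \<and> S1 \<inter> FV = {}) \<or> (hpath (E - FE) S2 c g \<and> S2 \<inter> FV = {})"
  using d unfolding drop1_def
proof (elim disjE bexE conjE)
  fix x assume x: "x \<in> FV" "FV' = FV - {x}" "FE' = FE"
  show ?thesis
  proof (cases "x \<in> S1")
    case True
    then have "S2 \<inter> FV = {}" using h(3,5) x by auto
    then show ?thesis using h(2) x by simp
  next
    case False
    then have "S1 \<inter> FV = {}" using h(4) x by auto
    then show ?thesis using h(1) x by simp
  qed
next
  fix e assume x: "e \<in> FE" "FV' = FV" "FE' = FE - {e}"
  show ?thesis
  proof (cases "e \<in> E \<and> e \<subseteq> S1")
    case True
    then have "e \<noteq> {}" using assms(2) by metis
    then have "\<not> e \<subseteq> S2" using h(3) True by blast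
    then have "hpath (E - FE) S2 c g" by (intro hpath_subgraph[OF h(2)]) (use x in auto)
    then show ?thesis using h(5) x by simp
  next
    case False
    then have "hpath (E - FE) S1 a b" by (intro hpath_subgraph[OF h(1)]) (use x in auto)
    then show ?thesis using h(4) x by simp
  qed
qed

text \<open>The faults return in the reverse of the order in which they were ignored. The first may
  cut the path in two, and the second then meets only one of the pieces.\<close>

lemma drop_two:
  assumes d1: "drop1 FV FE FV' FE'" and d2: "drop1 FV' FE' FV'' FE''" and e: "{} \<notin> E"
    and h: "hpath (E - FE'') S s t" "S \<inter> FV'' = {}" and st: "s \<notin> FV" "t \<notin> FV"
  obtains (one) "hpath (E - FE) (S - FV) s t"
    | (two) S1 S2 a b where "hpath (E - FE) S1 s a" "hpath (E - FE) S2 b t" "S1 \<union> S2 = S - FV" "S1 \<inter> S2 = {}"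
    | (three) S1 M S2 a b x y where "hpath (E - FE) S1 s a" "hpath (E - FE) M b x" "hpath (E - FE) S2 y t"
        "S1 \<union> M \<union> S2 = S - FV" "S1 \<inter> S2 = {}" "S1 \<inter> M = {}" "S2 \<inter> M = {}"
proof -
  have sub: "FV' \<subseteq> FV" "FV'' \<subseteq> FV'" using drop1_sub[OF d1] drop1_sub[OF d2] by auto
  have st': "s \<notin> FV'" "t \<notin> FV'" using st sub by auto
  from drop_hpath[OF d2 h st'(1)] show thesis
  proof (elim disjE exE conjE)
    fix a assume a: "hpath (E - FE') (S - FV') s a" "t \<notin> FV' \<longrightarrow> a = t"
    then have h1: "hpath (E - FE') (S - FV') s t" using st' by simp
    have SF: "S - FV' - FV = S - FV" using sub by auto
    have "(\<exists>a. hpath (E - FE) (S - FV' - FV) s a \<and> (t \<notin> FV \<longrightarrow> a = t)) \<or>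
      (\<exists>S1 S2 a b. hpath (E - FE) S1 s a \<and> hpath (E - FE) S2 b t \<and> S1 \<union> S2 = S - FV' - FV \<and> S1 \<inter> S2 = {})"
      by (rule drop_hpath[OF d1 h1 _ st(1)]) auto
    then show thesis unfolding SF using one two st(2) by blast
  next
    fix S1 S2 a b assume s: "hpath (E - FE') S1 s a" "hpath (E - FE') S2 b t" "S1 \<union> S2 = S - FV'" "S1 \<inter> S2 = {}"
    have dj: "S1 \<inter> FV' = {}" "S2 \<inter> FV' = {}" using s(3) by auto
    from drop1_unaffected[OF d1 e s(1,2,4) dj] show thesis
    proof (elim disjE conjE)
      assume u: "hpath (E - FE) S1 s a" "S1 \<inter> FV = {}"
      have SF: "S1 \<union> (S2 - FV) = S - FV" using s(3) u(2) sub by blast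
      from drop_hpath[OF d1 hpath_rev[OF s(2)] dj(2) st(2)] show thesis
      proof (elim disjE exE conjE)
        fix c assume c: "hpath (E - FE) (S2 - FV) t c"
        show thesis by (rule two[OF u(1) hpath_rev[OF c] SF]) (use s(4) in auto)
      next
        fix T1 T2 c g assume t: "hpath (E - FE) T1 t c" "hpath (E - FE) T2 g b" "T1 \<union> T2 = S2 - FV" "T1 \<inter> T2 = {}"
        show thesis by (rule three[OF u(1) t(2) hpath_rev[OF t(1)]]) (use t(3,4) SF s(4) in auto)
      qed
    next
      assume u: "hpath (E - FE) S2 b t" "S2 \<inter> FV = {}"
      have SF: "(S1 - FV) \<union> S2 = S - FV" using s(3) u(2) sub by blast
      from drop_hpath[OF d1 s(1) dj(1) st(1)] show thesis
      proof (elim disjE exE conjE)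
        fix c assume c: "hpath (E - FE) (S1 - FV) s c"
        show thesis by (rule two[OF c u(1) SF]) (use s(4) in auto)
      next
        fix T1 T2 c g assume t: "hpath (E - FE) T1 s c" "hpath (E - FE) T2 g a" "T1 \<union> T2 = S1 - FV" "T1 \<inter> T2 = {}"
        show thesis by (rule three[OF t(1,2) u(1)]) (use t(3,4) SF s(4) in auto)
      qed
    qed
  qed
qed

context thsplit begin

abbreviation good_A where "good_A \<equiv> good_nbrs FV FE A EA"

lemma near_pathI:
  assumes "hpath Eg (Q \<union> (B - FV)) s t" "Q \<subseteq> A - FV" "A - FV \<subseteq> insert w Q"
  shows "near_path Eg (V - FV) s t"
  unfolding near_path_def V_faultfree using assms by (intro exI[of _ "Q \<union> (B - FV)"] exI[of _ w]) auto

lemma good_nbrs_V: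
  assumes "z \<in> good_nbrs FV FE V E x" "x \<in> A - FV"
  shows "z \<in> good_A x \<or> (z = \<phi> x \<and> crossable x)"
proof -
  have z: "z \<in> V - FV" "{x, z} \<in> Eg" using assms(1) unfolding good_nbrs_def by auto
  show ?thesis
  proof (cases "z \<in> A")
    case True
    then show ?thesis using edge_A[of x z] z assms(2) unfolding good_nbrs_def by auto
  next
    case False
    then have "z \<in> B" using z V by auto
    then have "z = \<phi> x" using edge_cross[of x z] z assms(2) by auto
    then show ?thesis using z assms(2) \<open>z \<in> B\<close> unfolding crossable_def by auto
  qed
qed

lemma near_card:
  assumes "S \<subseteq> A - FV" "A - FV \<subseteq> insert w S"
  shows "2 ^ m \<le> card S + 1 + fA"
proof -
  have fS: "finite S" using assms(1) finA finite_subset by blast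
  have "card (A - FV) \<le> card (insert w S)" using assms(2) fS by (intro card_mono) auto
  also have "\<dots> \<le> card S + 1" using fS by (simp add: card_insert_if)
  finally show ?thesis using card_A_faultfree by linarith
qed

section \<open>At most \<open>2 * m - 10\<close> faults in the larger half\<close>

context
  assumes m7: "7 \<le> m" and n8: "nfaults FV FE V E + 8 \<le> 2 * m" and le: "fB \<le> fA"
begin

lemma fault_sum: "fA + fB + ncross + 8 \<le> 2 * m"
  using n8 nfaults_split by simp

lemma pow_lower: "16 * m + 16 \<le> 2 ^ m"
  using pow_ge7[OF m7] .

lemma ham_conn_B_half: "ham_conn Eg (B - FV)"
  by (rule ham_conn_B_del') (use fault_sum le in linarith)

lemma not_cr_small: "S \<subseteq> A - FV \<Longrightarrow> card {x \<in> S. \<not> crossable x \<or> \<phi> x \<notin> B - FV} \<le> fB + ncross"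
proof -
  assume S: "S \<subseteq> A - FV"
  have "card {x \<in> S. \<not> crossable x \<or> \<phi> x \<notin> B - FV} \<le> card {x \<in> A - FV. \<not> crossable x}"
    using S crossable_in finA by (intro card_mono) auto
  then show ?thesis using card_not_cr by linarith
qed

lemma near_detour:
  assumes "hpath Eg S s t" "S \<subseteq> A - FV" "A - FV \<subseteq> insert w S"
  shows "near_path Eg (V - FV) s t"
proof -
  have "2 * card {x \<in> S. \<not> crossable x \<or> \<phi> x \<notin> B - FV} + 1 < card S"
    using not_cr_small[OF assms(2)] near_card[OF assms(2,3)] fault_sum pow_lower by linarith
  then have "hpath Eg (S \<union> (B - FV)) s t" using detour_B[OF assms(1,2) _ ham_conn_B_half] by blast
  then show ?thesis using near_pathI assms(2,3) by blast
qed

text \<open>The vertices that could violate the neighbour condition of \<open>near_path_at\<close>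
  for a suitably chosen other end.\<close>

definition Low where "Low = {x \<in> A - FV. card (good_A x) \<le> 1}"

text \<open>Two such vertices would have at most two usable neighbours together, but at least five
  remain.\<close>

lemma Low_eq: "x \<in> Low \<Longrightarrow> y \<in> Low \<Longrightarrow> x = y"
proof (rule ccontr)
  assume a: "x \<in> Low" "y \<in> Low" "x \<noteq> y"
  then have "2 * m \<le> card (good_A x) + card (good_A y) + fA + 3"
    unfolding Low_def by (intro good_nbrs_two[OF tA]) auto
  then show False using a fault_sum unfolding Low_def by auto
qed

lemma card_Low: "card Low \<le> 1" "finite Low"
proof -
  show "finite Low" unfolding Low_def using finA by auto
  then show "card Low \<le> 1" using Low_eq by (metis One_nat_def card_le_Suc0_iff_eq)
qed

lemma not_Low: "x \<in> A - FV \<Longrightarrow> x \<notin> Low \<Longrightarrow> \<exists>z\<in>good_A x. z \<noteq> y"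
  unfolding Low_def by (intro card_ge2_avoid) auto

lemma pick:
  assumes "finite Z" "card Z \<le> 3"
  obtains x where "x \<in> A - FV" "crossable x" "x \<notin> Low" "x \<notin> Z"
proof -
  let ?X = "{x \<in> A - FV. \<not> crossable x} \<union> (Low \<union> Z)"
  have "card ?X \<le> card {x \<in> A - FV. \<not> crossable x} + card (Low \<union> Z)" by (rule card_Un_le)
  also have "card (Low \<union> Z) \<le> 4" using card_Un_le[of Low Z] card_Low assms by linarith
  finally have "card ?X < card (A - FV)" using card_not_cr card_A_faultfree fault_sum pow_lower by linarith
  moreover have "finite ?X" using finA card_Low assms by simp
  ultimately have "\<not> A - FV \<subseteq> ?X" using card_mono[of ?X "A - FV"] by auto
  then show thesis using that by blast
qed

text \<open>An inner vertex of a path in \<open>A\<close> has two usable neighbours in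
  \<open>A\<close>. A vertex with fewer is therefore bypassed, and can be prefixed to the path later
  through its partner.\<close>

lemma off_path:
  assumes "hpath Eg S x y" "S \<subseteq> A - FV" "s \<noteq> x" "s \<noteq> y" "card (good_A s) \<le> 1"
  shows "s \<notin> S"
proof
  assume s: "s \<in> S"
  obtain S1 S2 a b where ab: "hpath Eg S1 x a" "hpath Eg S2 b y" "{a, s} \<in> Eg" "{s, b} \<in> Eg"
    "S1 \<union> S2 = S - {s}" "S1 \<inter> S2 = {}"
    using hpath_drop_vertex[OF assms(1) s] assms(3,4) by metis
  have i: "a \<in> S1" "b \<in> S2" using hpath_last_in[OF ab(1)] hpath_hd_in[OF ab(2)] .
  have "a \<in> good_A s" "b \<in> good_A s"
    using i ab(3-5) assms(2) s edge_A[of s a] edge_A[of s b] unfolding good_nbrs_def by (auto simp: insert_commute)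
  moreover have "a \<noteq> b" using i ab(6) by auto
  moreover have "finite (good_A s)" using good_nbrs_sub[of FV FE A EA s] finA finite_subset by blast
  ultimately show False using assms(5) card_le_Suc0_iff_eq[of "good_A s"] by auto
qed

text \<open>Since \<open>s\<close> has no neighbour in \<open>A\<close> except possibly
  \<open>t\<close>, it must leave for \<open>B\<close> at once. The path of \<open>A\<close> from an
  auxiliary vertex \<open>x\<close> to \<open>t\<close> misses exactly \<open>s\<close>, and
  \<open>B\<close> joins \<open>s\<close> to \<open>x\<close>.\<close>

lemma step_AA_isolated:
  assumes T: "near_path_at TYPE('a) m" and a: "fA + 10 \<le> 2 * m"
    and s: "s \<in> A - FV" and t: "t \<in> A - FV" and ne: "s \<noteq> t" and c: "crossable s" and low: "good_A s \<subseteq> {t}"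
  shows "near_path Eg (V - FV) s t"
proof -
  have cs: "card (good_A s) \<le> 1" using card_mono[OF _ low] by simp
  then have sL: "s \<in> Low" unfolding Low_def using s by simp
  have tL: "t \<notin> Low" using Low_eq[OF sL] ne by auto
  obtain x where x: "x \<in> A - FV" "crossable x" "x \<notin> Low" "x \<notin> {s, t}" by (rule pick[of "{s, t}"]) (auto simp: card_insert_if)
  have "near_path (EA - FE) (A - FV) x t"
    using T[unfolded near_path_at_def, rule_format, OF tA a x(1) t _ not_Low[OF x(1,3)] not_Low[OF t tL]] x(4) by auto
  then obtain S w where S: "S \<subseteq> A - FV" "hpath (EA - FE) S x t" "A - FV \<subseteq> insert w S" unfolding near_path_def by blast
  have h: "hpath Eg S x t" using hpath_mono[OF S(2) EA_sub] .
  have sS: "s \<notin> S" by (rule off_path[OF h S(1) _ ne cs]) (use x in auto)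
  have "hpath Eg ({s} \<union> S \<union> (B - FV)) s t"
    by (rule link_pieces[OF hpath_single h _ _ _ c x(2) _ _ _ ham_conn_B_half]) (use s S sS crossable_in[OF c] crossable_in[OF x(2)] in auto)
  then show ?thesis by (rule near_pathI[where w = w]) (use s S in auto)
qed

lemma step_AA:
  assumes T: "near_path_at TYPE('a) m" and a: "fA + 10 \<le> 2 * m"
    and s: "s \<in> A - FV" and t: "t \<in> A - FV" and ne: "s \<noteq> t"
    and ns: "\<exists>z\<in>good_nbrs FV FE V E s. z \<noteq> t" and nt: "\<exists>z\<in>good_nbrs FV FE V E t. z \<noteq> s"
  shows "near_path Eg (V - FV) s t"
proof -
  consider "\<exists>z\<in>good_A s. z \<noteq> t" "\<exists>z\<in>good_A t. z \<noteq> s" | "good_A s \<subseteq> {t}" | "good_A t \<subseteq> {s}" by blast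
  then show ?thesis
  proof cases
    case 1
    have "near_path (EA - FE) (A - FV) s t"
      using T[unfolded near_path_at_def, rule_format, OF tA a s t ne 1] .
    then obtain S w where S: "S \<subseteq> A - FV" "hpath (EA - FE) S s t" "A - FV \<subseteq> insert w S" unfolding near_path_def by blast
    show ?thesis by (rule near_detour[OF hpath_mono[OF S(2) EA_sub] S(1,3)])
  next
    case 2
    then have "crossable s" using ns good_nbrs_V[OF _ s] by blast
    then show ?thesis using step_AA_isolated[OF T a s t ne _ 2] by blast
  next
    case 3
    then have "crossable t" using nt good_nbrs_V[OF _ t] by blast
    then show ?thesis using near_path_rev[OF step_AA_isolated[OF T a t s _ _ 3]] ne by blast
  qed
qed

text \<open>The mirror image of \<open>detour_B\<close>: an edge of the path in \<open>B\<close> is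
  replaced by an excursion through \<open>A\<close>. Its partners must be fault-free, crossable and
  outside \<open>Low\<close>, so that the induction hypothesis applies to them.\<close>

lemma B_path_detour:
  assumes T: "near_path_at TYPE('a) m" and a: "fA + 10 \<le> 2 * m"
    and h: "hpath Eg (B - FV) s t" and Z: "finite Z" "card Z \<le> 1"
  obtains S w x y where "S \<subseteq> A - FV" "hpath Eg S x y" "A - FV \<subseteq> insert w S" "x \<notin> Z" "y \<notin> Z"
    "hpath Eg (S \<union> (B - FV)) s t"
proof -
  let ?N = "{x \<in> A - FV. \<not> crossable x} \<union> (Low \<union> Z \<union> (FV \<inter> A))"
  have fN: "finite ?N" using finA card_Low Z by simp
  have "card ?N \<le> card {x \<in> A - FV. \<not> crossable x} + card (Low \<union> Z \<union> (FV \<inter> A))" by (rule card_Un_le)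
  also have "card (Low \<union> Z \<union> (FV \<inter> A)) \<le> card (Low \<union> Z) + card (FV \<inter> A)" by (rule card_Un_le)
  also have "card (Low \<union> Z) \<le> 2" using card_Un_le[of Low Z] card_Low Z by linarith
  finally have cN: "card ?N \<le> fB + ncross + 2 + fA" using card_not_cr unfolding nfaults_def by linarith
  have cX: "card (\<phi> ` ?N) \<le> card ?N" by (rule card_image_le[OF fN])
  have "2 ^ m \<le> card (B - FV) + fB" using card_faultfree(1)[OF tB] .
  then have big: "2 * card (\<phi> ` ?N) + 1 < card (B - FV)" using cX cN fault_sum pow_lower by linarith
  have fX: "finite (\<phi> ` ?N)" using fN by simp
  obtain S1 S2 x' y' where s: "hpath Eg S1 s x'" "hpath Eg S2 y' t" "{x', y'} \<in> Eg" "S1 \<union> S2 = B - FV"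
    "S1 \<inter> S2 = {}" "x' \<notin> \<phi> ` ?N" "y' \<notin> \<phi> ` ?N"
    by (rule hpath_generic[OF h fX big])
  have i: "x' \<in> S1" "y' \<in> S2" using hpath_last_in[OF s(1)] hpath_hd_in[OF s(2)] .
  have ex: "\<exists>x. x \<in> A - FV \<and> \<phi> x = z \<and> crossable x \<and> x \<notin> Low \<and> x \<notin> Z" if z: "z \<in> B" "z \<notin> \<phi> ` ?N" for z
  proof -
    obtain x where "x \<in> A" "\<phi> x = z" using phi_ex[OF z(1)] by blast
    then show ?thesis using z(2) by (intro exI[of _ x]) auto
  qed
  obtain x where x: "x \<in> A - FV" "\<phi> x = x'" "crossable x" "x \<notin> Low" "x \<notin> Z" using ex[of x'] s(4,6) i by blast
  obtain y where y: "y \<in> A - FV" "\<phi> y = y'" "crossable y" "y \<notin> Low" "y \<notin> Z" using ex[of y'] s(4,7) i by blast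
  have "x \<noteq> y" using x(2) y(2) i s(5) by auto
  then have "near_path (EA - FE) (A - FV) x y"
    using T[unfolded near_path_at_def, rule_format, OF tA a x(1) y(1) _ not_Low[OF x(1,4)] not_Low[OF y(1,4)]] by blast
  then obtain S w where S: "S \<subseteq> A - FV" "hpath (EA - FE) S x y" "A - FV \<subseteq> insert w S" unfolding near_path_def by blast
  have h': "hpath Eg S x y" using hpath_mono[OF S(2) EA_sub] .
  have 1: "hpath Eg (S1 \<union> S) s y"
    by (rule hpath_join[OF s(1) h']) (use crossable_edge[OF x(3)] x(2) s(4) S(1) disj in \<open>auto simp: insert_commute\<close>)
  have "hpath Eg (S \<union> (B - FV)) s t"
    by (rule hpath_join'[OF 1 s(2)]) (use crossable_edge[OF y(3)] y(2) s(4,5) S(1) disj in auto)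
  then show thesis using that S(1,3) h' x(5) y(5) by blast
qed

lemma step_BB:
  assumes T: "near_path_at TYPE('a) m" and a: "fA + 10 \<le> 2 * m"
    and s: "s \<in> B - FV" and t: "t \<in> B - FV" and ne: "s \<noteq> t"
  shows "near_path Eg (V - FV) s t"
proof -
  obtain S w x y where S: "S \<subseteq> A - FV" "hpath Eg S x y" "A - FV \<subseteq> insert w S" "hpath Eg (S \<union> (B - FV)) s t"
    by (rule B_path_detour[OF T a ham_connD[OF ham_conn_B_half s t ne], of "{}"]) auto
  then show ?thesis using near_pathI by blast
qed

lemma step_AB:
  assumes T: "near_path_at TYPE('a) m" and a: "fA + 10 \<le> 2 * m"
    and s: "s \<in> A - FV" and t: "t \<in> B - FV" and ns: "\<exists>z\<in>good_nbrs FV FE V E s. z \<noteq> t"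
  shows "near_path Eg (V - FV) s t"
proof (cases "good_A s = {}")
  case False
  then obtain z where z: "z \<in> good_A s" by blast
  obtain u where u: "u \<in> A" "\<phi> u = t" using phi_ex t by blast
  \<comment> \<open>Avoiding \<open>z\<close> keeps it as a neighbour of \<open>s\<close> other than
    the end \<open>x\<close>; avoiding \<open>u\<close> makes the partner of \<open>x\<close> differ
    from \<open>t\<close>.\<close>
  obtain x where x: "x \<in> A - FV" "crossable x" "x \<notin> Low" "x \<notin> {s, z, u}"
    by (rule pick[of "{s, z, u}"]) (auto simp: card_insert_if)
  have "\<exists>z\<in>good_A s. z \<noteq> x" using z x(4) by auto
  then have "near_path (EA - FE) (A - FV) s x"
    using T[unfolded near_path_at_def, rule_format, OF tA a s x(1) _ _ not_Low[OF x(1,3)]] x(4) by auto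
  then obtain S w where S: "S \<subseteq> A - FV" "hpath (EA - FE) S s x" "A - FV \<subseteq> insert w S" unfolding near_path_def by blast
  have "\<phi> x \<noteq> t" using u x(1,4) phi_eq by auto
  then have "hpath Eg (B - FV) (\<phi> x) t" using ham_connD[OF ham_conn_B_half _ t] crossable_in[OF x(2)] by auto
  then have "hpath Eg (S \<union> (B - FV)) s t"
    by (intro extend_to_B[OF hpath_mono[OF S(2) EA_sub] _ x(2)]) (use S(1) in auto)
  then show ?thesis using near_pathI S(1,3) by blast
next
  case True
  then have c: "crossable s" "\<phi> s \<noteq> t" using ns good_nbrs_V[OF _ s] by auto
  have "hpath Eg (B - FV) (\<phi> s) t" using ham_connD[OF ham_conn_B_half _ t c(2)] crossable_in[OF c(1)] by auto
  then obtain S w x y where S: "S \<subseteq> A - FV" "hpath Eg S x y" "A - FV \<subseteq> insert w S" "x \<notin> {s}" "y \<notin> {s}"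
    "hpath Eg (S \<union> (B - FV)) (\<phi> s) t"
    by (rule B_path_detour[OF T a, of _ _ "{s}"]) auto
  have sS: "s \<notin> S" by (rule off_path[OF S(2,1)]) (use S True in auto)
  have "hpath Eg ({s} \<union> (S \<union> (B - FV))) s t"
    by (rule hpath_join[OF hpath_single S(6) crossable_edge[OF c(1)]]) (use sS s disj in auto)
  then have "hpath Eg (({s} \<union> S) \<union> (B - FV)) s t" by (simp add: Un_assoc)
  then show ?thesis by (rule near_pathI[where w = w]) (use S s in auto)
qed

end

end

lemma good_nbrs_mono: "drop1 FV FE FV' FE' \<Longrightarrow> good_nbrs FV FE V E x \<subseteq> good_nbrs FV' FE' V E x"
  using drop1_sub unfolding good_nbrs_def by blast

section \<open>More than \<open>2 * m - 10\<close> faults in the larger half: some end point in the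
  other half\<close>

context thsplit begin

context
  assumes m7: "7 \<le> m" and sm: "fA + fB + ncross + 8 \<le> 2 * m" and b1: "fB + ncross \<le> 1"
begin

lemma ham_conn_B_del2: "finite X \<Longrightarrow> card X \<le> 2 \<Longrightarrow> ham_conn Eg (B - FV - X)"
  by (rule ham_conn_B_del) (use thln_ham_conn_hcycle[where 'a='a, OF m3] b1 m7 in auto)

lemma ham_conn_B_few: "ham_conn Eg (B - FV)"
  using ham_conn_B_del2[of "{}"] by simp

lemma two_dpc_B_few: "two_dpc Eg (B - FV)"
  by (rule two_dpc_B) (use b1 m7 in auto)

lemma one_bad:
  assumes "x \<in> A - FV" "y \<in> A - FV" "x \<noteq> y" shows "crossable x \<or> crossable y"
proof (rule ccontr)
  assume "\<not> (crossable x \<or> crossable y)"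
  then have "{x, y} \<subseteq> {x \<in> A - FV. \<not> crossable x}" using assms by auto
  then have "card {x, y} \<le> card {x \<in> A - FV. \<not> crossable x}" using finA by (intro card_mono) auto
  then show False using card_not_cr b1 assms(3) by simp
qed

lemma few_bad: "S \<subseteq> A - FV \<Longrightarrow> card {x \<in> S. \<not> crossable x} \<le> 1"
proof -
  assume S: "S \<subseteq> A - FV"
  have "card {x \<in> S. \<not> crossable x} \<le> card {x \<in> A - FV. \<not> crossable x}"
    using S finA by (intro card_mono) auto
  then show ?thesis using card_not_cr b1 by linarith
qed

lemma near_big:
  assumes "S \<subseteq> A - FV" "A - FV \<subseteq> insert w S" shows "20 \<le> card S"
  using near_card[OF assms] sm pow_ge7[OF m7] m7 by linarith

text \<open>The target \<open>t\<close> is reached over the matching edge from \<open>e\<close>, so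
  it is spared when the two pieces are linked in \<open>B\<close>.\<close>

lemma link_pieces_to:
  assumes "hpath Eg S1 s a" "hpath Eg M b e" "S1 \<subseteq> A - FV" "M \<subseteq> A - FV" "S1 \<inter> M = {}" "crossable a" "crossable b" "crossable e"
    "\<phi> e = t" "\<phi> a \<noteq> t" "\<phi> b \<noteq> t"
  shows "hpath Eg (S1 \<union> M \<union> (B - FV)) s t"
proof -
  have tB: "t \<in> B - FV" using crossable_in[OF assms(8)] assms(9) by auto
  have 1: "hpath Eg (S1 \<union> M \<union> (B - FV - {t})) s e"
    by (rule link_pieces[OF assms(1,2) _ _ assms(5,6,7) _ _ _ ham_conn_B_del2])
      (use assms(3,4,10,11) crossable_in[OF assms(6)] crossable_in[OF assms(7)] in auto)
  show ?thesis
    by (rule hpath_join'[OF 1 hpath_single]) (use crossable_edge[OF assms(8)] assms(3,4,9) tB disj in auto)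
qed

text \<open>If crossing at \<open>e\<close> would hit \<open>t\<close> too early, \<open>B\<close>
  without \<open>t\<close> is visited from the inside of the path, and \<open>e\<close> leads to
  \<open>t\<close> at the end. Only \<open>e\<close> and one uncrossable vertex must be avoided
  there, so six vertices suffice.\<close>

lemma finish_in_B:
  assumes h: "hpath Eg S s e" and S: "S \<subseteq> A - FV" and c: "crossable e" and t: "t \<in> B - FV" and big: "6 \<le> card S"
  shows "hpath Eg (S \<union> (B - FV)) s t"
proof (cases "\<phi> e = t")
  case False
  then have "hpath Eg (B - FV) (\<phi> e) t" using ham_connD[OF ham_conn_B_few _ t] crossable_in[OF c] by auto
  then show ?thesis by (intro extend_to_B[OF h _ c]) (use S in auto)
next
  case True
  let ?X = "{x \<in> S. \<not> crossable x} \<union> {e}"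
  have fS: "finite S" using hpath_finite[OF h] .
  have "card ?X \<le> card {x \<in> S. \<not> crossable x} + card {e}" by (rule card_Un_le)
  then have X: "2 * card ?X + 1 < card S" using few_bad[OF S] big by simp
  have fX: "finite ?X" using fS by simp
  obtain S1 S2 x y where s: "hpath Eg S1 s x" "hpath Eg S2 y e" "{x, y} \<in> Eg" "S1 \<union> S2 = S"
    "S1 \<inter> S2 = {}" "x \<notin> ?X" "y \<notin> ?X" by (rule hpath_generic[OF h fX X])
  have i: "x \<in> S" "y \<in> S" "e \<in> S" using hpath_last_in[OF s(1)] hpath_hd_in[OF s(2)] s(4) hpath_last_in[OF h] by auto
  have "\<phi> x \<noteq> t" "\<phi> y \<noteq> t" using True i S s(6,7) phi_eq[of _ e] by auto
  then have "hpath Eg (S1 \<union> S2 \<union> (B - FV)) s t"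
    by (intro link_pieces_to[OF s(1,2) _ _ s(5) _ _ c True]) (use s(4,6,7) S i in auto)
  then show ?thesis using s(4) by simp
qed

text \<open>If \<open>t\<close> is the partner of an end of \<open>M\<close>, that end comes last;
  otherwise the cover of \<open>B\<close> by two paths threads \<open>M\<close>.\<close>

lemma finish_with_piece:
  assumes h: "hpath Eg S1 s a" "hpath Eg M e b" "e \<noteq> b" and S: "S1 \<subseteq> A - FV" "M \<subseteq> A - FV" "S1 \<inter> M = {}"
    and c: "crossable a" "crossable e" "crossable b" and t: "t \<in> B - FV" "\<phi> a \<noteq> t"
  shows "hpath Eg (S1 \<union> M \<union> (B - FV)) s t"
proof -
  have i: "a \<in> S1" "e \<in> M" "b \<in> M" using hpath_last_in[OF h(1)] hpath_hd_in[OF h(2)] hpath_last_in[OF h(2)] by auto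
  then have iA: "a \<in> A" "e \<in> A" "b \<in> A" using S by auto
  have ne: "\<phi> a \<noteq> \<phi> e" "\<phi> a \<noteq> \<phi> b" "\<phi> e \<noteq> \<phi> b" using i S(3) h(3) by (auto simp: phi_eq iA)
  consider "\<phi> e = t" | "\<phi> b = t" | "\<phi> e \<noteq> t" "\<phi> b \<noteq> t" by blast
  then show ?thesis
  proof cases
    case 1
    show ?thesis by (rule link_pieces_to[OF h(1) hpath_rev[OF h(2)] S c(1,3,2) 1 t(2)]) (use 1 ne in auto)
  next
    case 2
    show ?thesis by (rule link_pieces_to[OF h(1,2) S c(1,2,3) 2 t(2)]) (use 2 ne in auto)
  next
    case 3
    have 1: "hpath Eg (M \<union> (B - FV)) (\<phi> a) t"
      by (rule thread_piece[OF h(2) _ h(3) c(2,3) _ _ _ _ t(1) t(2) _ _ _ _ two_dpc_B_few])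
        (use S crossable_in[OF c(1)] crossable_in[OF c(2)] crossable_in[OF c(3)] ne 3 in auto)
    show ?thesis
      by (rule hpath_join'[OF h(1) 1 crossable_edge[OF c(1)]]) (use S disj in auto)
  qed
qed

text \<open>The start \<open>\<phi> a\<close> steps to \<open>a\<close> immediately. If
  \<open>t\<close> is the partner of \<open>b\<close>, the rest of \<open>B\<close> is visited from
  an inner edge of \<open>Q\<close> that avoids \<open>a\<close>, \<open>b\<close> and one
  uncrossable vertex; hence the bound 8.\<close>

lemma visit_piece_from_end:
  assumes h: "hpath Eg Q a b" and Q: "Q \<subseteq> A - FV" and c: "crossable a" "crossable b" and big: "8 \<le> card Q"
    and t: "t \<in> B - FV" "\<phi> a \<noteq> t"
  shows "hpath Eg (Q \<union> (B - FV)) (\<phi> a) t"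
proof -
  have i: "a \<in> Q" "b \<in> Q" using hpath_hd_in[OF h] hpath_last_in[OF h] by auto
  have ab: "a \<noteq> b" using hpath_card1[OF h] big by auto
  have iA: "a \<in> A" "b \<in> A" using i Q by auto
  have pab: "\<phi> a \<noteq> \<phi> b" using ab iA by (simp add: phi_eq)
  have ea: "{\<phi> a, a} \<in> Eg" using crossable_edge[OF c(1)] by (simp add: insert_commute)
  show ?thesis
  proof (cases "\<phi> b = t")
    case False
    have 1: "hpath Eg (B - FV - {\<phi> a}) (\<phi> b) t"
      by (rule ham_connD[OF ham_conn_B_del2]) (use False t pab crossable_in[OF c(2)] in auto)
    have 2: "hpath Eg (Q \<union> (B - FV - {\<phi> a})) a t" by (rule extend_to_B[OF h _ c(2) 1]) (use Q in auto)
    show ?thesis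
      by (rule hpath_join'[OF hpath_single 2 ea]) (use Q crossable_in[OF c(1)] disj in auto)
  next
    case True
    let ?X = "{x \<in> Q. \<not> crossable x} \<union> {a, b}"
    have fQ: "finite Q" using hpath_finite[OF h] .
    have "card ?X \<le> card {x \<in> Q. \<not> crossable x} + card {a, b}" by (rule card_Un_le)
    then have X: "2 * card ?X + 1 < card Q" using few_bad[OF Q] big ab by simp
    have fX: "finite ?X" using fQ by simp
    obtain S1 S2 x y where s: "hpath Eg S1 a x" "hpath Eg S2 y b" "{x, y} \<in> Eg" "S1 \<union> S2 = Q"
      "S1 \<inter> S2 = {}" "x \<notin> ?X" "y \<notin> ?X" by (rule hpath_generic[OF h fX X])
    have j: "x \<in> Q" "y \<in> Q" using hpath_last_in[OF s(1)] hpath_hd_in[OF s(2)] s(4) by auto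
    have cxy: "crossable x" "crossable y" using j s(6,7) by auto
    have jA: "x \<in> A" "y \<in> A" using j Q by auto
    have "x \<noteq> a" "y \<noteq> a" "x \<noteq> b" "y \<noteq> b" using s(6,7) by auto
    then have ne: "\<phi> x \<noteq> \<phi> a" "\<phi> y \<noteq> \<phi> a" "\<phi> x \<noteq> t" "\<phi> y \<noteq> t"
      unfolding True[symmetric] by (simp_all add: phi_eq iA jA)
    have 1: "hpath Eg (S1 \<union> S2 \<union> (B - FV - {\<phi> a, t})) a b"
      by (rule link_pieces[OF s(1,2) _ _ s(5) cxy _ _ _ ham_conn_B_del2])
        (use s(4) Q ne crossable_in[OF cxy(1)] crossable_in[OF cxy(2)] in \<open>auto simp: card_insert_if\<close>)
    have 2: "hpath Eg ({\<phi> a} \<union> (S1 \<union> S2 \<union> (B - FV - {\<phi> a, t}))) (\<phi> a) b"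
      by (rule hpath_join[OF hpath_single 1 ea]) (use s(4) Q crossable_in[OF c(1)] disj in auto)
    show ?thesis
      by (rule hpath_join'[OF 2 hpath_single]) (use crossable_edge[OF c(2)] True s(4) Q t crossable_in[OF c(1)] disj in auto)
  qed
qed

lemma visit_piece:
  assumes h: "hpath Eg Q a b" and Q: "Q \<subseteq> A - FV" and c: "crossable a" "crossable b" and big: "8 \<le> card Q"
    and s: "s \<in> B - FV" and t: "t \<in> B - FV" and ne: "s \<noteq> t"
  shows "hpath Eg (Q \<union> (B - FV)) s t"
proof -
  have ab: "a \<noteq> b" using hpath_card1[OF h] big by auto
  consider "\<phi> a = s" | "\<phi> b = s" | "\<phi> a = t" | "\<phi> b = t"
    | "\<phi> a \<noteq> s" "\<phi> b \<noteq> s" "\<phi> a \<noteq> t" "\<phi> b \<noteq> t" by blast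
  then show ?thesis
  proof cases
    case 1 then show ?thesis using visit_piece_from_end[OF h Q c big t] ne by auto
  next
    case 2 then show ?thesis using visit_piece_from_end[OF hpath_rev[OF h] Q c(2,1) big t] ne by auto
  next
    case 3 then show ?thesis using hpath_rev[OF visit_piece_from_end[OF h Q c big s]] ne by auto
  next
    case 4 then show ?thesis using hpath_rev[OF visit_piece_from_end[OF hpath_rev[OF h] Q c(2,1) big s]] ne by auto
  next
    case 5
    show ?thesis
      by (rule thread_piece[OF h _ ab c _ _ _ s t ne _ _ _ _ two_dpc_B_few]) (use 5 Q crossable_in[OF c(1)] crossable_in[OF c(2)] in auto)
  qed
qed

lemma near_cycle_A:
  assumes NC: "near_cycle_at TYPE('a) m" and a: "fA + 9 \<le> 2 * m"
  obtains S w where "S \<subseteq> A - FV" "hcycle Eg S" "A - FV \<subseteq> insert w S"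
proof -
  have "near_cycle (EA - FE) (A - FV)" using NC tA a unfolding near_cycle_at_def by blast
  then obtain S w where "S \<subseteq> A - FV" "hcycle (EA - FE) S" "A - FV \<subseteq> insert w S" unfolding near_cycle_def by blast
  then show thesis using that hcycle_mono[OF _ EA_sub] by blast
qed

lemma near_cycle_A_drop:
  assumes NC: "near_cycle_at TYPE('a) m" and a: "fA = Suc (2 * m - 9)"
  obtains Q w a b where "Q \<subseteq> A - FV" "hpath Eg Q a b" "A - FV \<subseteq> insert w Q"
proof -
  obtain FV' FE' where d: "drop1 FV FE FV' FE'" "nfaults FV' FE' A EA = 2 * m - 9"
    by (rule drop1_ex[OF tA a])
  have "near_cycle (EA - FE') (A - FV')" using NC tA d(2) m7 unfolding near_cycle_at_def by simp
  then obtain S w where S: "S \<subseteq> A - FV'" "hcycle (EA - FE') S" "A - FV' \<subseteq> insert w S" unfolding near_cycle_def by blast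
  have "S \<inter> FV' = {}" using S(1) by auto
  then obtain a b where ab: "hpath (EA - FE) (S - FV) a b" "a \<noteq> b"
    by (rule drop_hcycle[OF d(1) S(2)])
  show thesis
    by (rule that[of "S - FV" a b w]) (use S drop1_sub[OF d(1)] hpath_mono[OF ab(1) EA_sub] in auto)
qed

lemma hcycle_big_generic:
  assumes "hcycle Eg S" "S \<subseteq> A - FV" "A - FV \<subseteq> insert w S"
  obtains x y where "hpath Eg S x y" "crossable x" "crossable y"
proof -
  have X: "2 * card {x \<in> S. \<not> crossable x} + 1 < card S" using few_bad[OF assms(2)] near_big[OF assms(2,3)] by linarith
  have fX: "finite {x \<in> S. \<not> crossable x}" using hcycle_finite[OF assms(1)] by simp
  obtain x y where xy: "hpath Eg S x y" "{x, y} \<in> Eg" "x \<notin> {x \<in> S. \<not> crossable x}" "y \<notin> {x \<in> S. \<not> crossable x}" "x \<noteq> y"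
    by (rule hcycle_generic[OF assms(1) fX X])
  then show thesis using that[OF xy(1)] hpath_hd_in[OF xy(1)] hpath_last_in[OF xy(1)] by auto
qed

text \<open>One piece of \<open>A\<close> with crossable ends is enough. It comes from a cycle
  opened at an edge between crossable vertices, or from a cycle opened by an ignored fault, in which
  case every fault lies in \<open>A\<close> and all fault-free vertices cross.\<close>

lemma crowded_BB:
  assumes NC: "near_cycle_at TYPE('a) m" and s: "s \<in> B - FV" and t: "t \<in> B - FV" and ne: "s \<noteq> t"
  shows "near_path Eg (V - FV) s t"
proof -
  have "\<exists>Q w a b. Q \<subseteq> A - FV \<and> hpath Eg Q a b \<and> A - FV \<subseteq> insert w Q \<and> crossable a \<and> crossable b"
  proof (cases "fA + 9 \<le> 2 * m")
    case True
    obtain S w where S: "S \<subseteq> A - FV" "hcycle Eg S" "A - FV \<subseteq> insert w S" by (rule near_cycle_A[OF NC True])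
    obtain x y where "hpath Eg S x y" "crossable x" "crossable y" by (rule hcycle_big_generic[OF S(2,1,3)])
    then show ?thesis using S by blast
  next
    case False
    then have z: "fA = Suc (2 * m - 9)" "fB = 0" "ncross = 0" using sm m7 by linarith+
    obtain Q w a b where Q: "Q \<subseteq> A - FV" "hpath Eg Q a b" "A - FV \<subseteq> insert w Q" by (rule near_cycle_A_drop[OF NC z(1)])
    then show ?thesis using crossable_all[OF z(2,3)] hpath_hd_in[OF Q(2)] hpath_last_in[OF Q(2)] by blast
  qed
  then obtain Q w a b where Q: "Q \<subseteq> A - FV" "hpath Eg Q a b" "A - FV \<subseteq> insert w Q" "crossable a" "crossable b" by blast
  have "8 \<le> card Q" using near_big[OF Q(1,3)] by simp
  then have "hpath Eg (Q \<union> (B - FV)) s t" using visit_piece[OF Q(2,1,4,5) _ s t ne] by blast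
  then show ?thesis using near_pathI Q(1,3) by blast
qed

lemma prefix_isolated:
  assumes s: "s \<in> A - FV" "s \<notin> Q" and h: "hpath Eg Q a b" "Q \<subseteq> A - FV" "crossable a" "crossable b" "8 \<le> card Q"
    and t: "t \<in> B - FV" and c: "crossable s" "\<phi> s \<noteq> t" and w: "A - FV \<subseteq> insert s Q"
  shows "near_path Eg (V - FV) s t"
proof -
  have 1: "hpath Eg (Q \<union> (B - FV)) (\<phi> s) t"
    by (rule visit_piece[OF h(1,2,3,4,5) _ t c(2)]) (use crossable_in[OF c(1)] in auto)
  have "hpath Eg ({s} \<union> (Q \<union> (B - FV))) s t"
    by (rule hpath_join[OF hpath_single 1 crossable_edge[OF c(1)]]) (use s disj in auto)
  then have "hpath Eg (({s} \<union> Q) \<union> (B - FV)) s t" by (simp add: Un_assoc)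
  then show ?thesis by (rule near_pathI[where w = s]) (use s h w in auto)
qed

lemma crowded_AB_cycle:
  assumes S: "S \<subseteq> A - FV" "hcycle Eg S" "A - FV \<subseteq> insert w S" and s: "s \<in> A - FV" and t: "t \<in> B - FV"
    and ns: "\<exists>z\<in>good_nbrs FV FE V E s. z \<noteq> t"
  shows "near_path Eg (V - FV) s t"
proof -
  have big: "20 \<le> card S" using near_big[OF S(1,3)] .
  \<comment> \<open>The cycle opened at \<open>d\<close> can end at either cycle neighbour of
    \<open>d\<close>, and at most one of these is uncrossable.\<close>
  have ends: "\<exists>e. crossable e \<and> hpath Eg S d e" if d: "d \<in> S" for d
  proof -
    obtain p q where pq: "p \<noteq> q" "hpath Eg S d p" "hpath Eg S d q" by (rule hcycle_at[OF S(2) d])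
    have "p \<in> A - FV" "q \<in> A - FV" using hpath_last_in[OF pq(2)] hpath_last_in[OF pq(3)] S(1) by auto
    then show ?thesis using one_bad pq by blast
  qed
  show ?thesis
  proof (cases "s \<in> S")
    case True
    obtain e where e: "crossable e" "hpath Eg S s e" using ends[OF True] by blast
    have "hpath Eg (S \<union> (B - FV)) s t" by (rule finish_in_B[OF e(2) S(1) e(1) t]) (use big in simp)
    then show ?thesis using near_pathI S(1,3) by blast
  next
    case False
    \<comment> \<open>The vertex missed by the cycle can only be \<open>s\<close>.\<close>
    then have w: "A - FV \<subseteq> insert s S" using S(3) s by auto
    show ?thesis
    proof (cases "good_A s = {}")
      case True
      then have c: "crossable s" "\<phi> s \<noteq> t" using ns good_nbrs_V[OF _ s] by auto
      obtain x y where "hpath Eg S x y" "crossable x" "crossable y" by (rule hcycle_big_generic[OF S(2,1,3)])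
      then show ?thesis using prefix_isolated[OF s False _ S(1) _ _ _ t c w] big by auto
    next
      case F2: False
      then obtain d where d: "d \<in> good_A s" by blast
      have dS: "d \<in> S" using good_nbrs_A[OF d] w by auto
      obtain e where e: "crossable e" "hpath Eg S d e" using ends[OF dS] by blast
      have 1: "hpath Eg ({s} \<union> S) s e"
        by (rule hpath_join[OF hpath_single e(2)]) (use good_nbrs_A[OF d] False in auto)
      have "card ({s} \<union> S) \<ge> 6" using big False hcycle_finite[OF S(2)] by simp
      then have "hpath Eg (({s} \<union> S) \<union> (B - FV)) s t"
        by (intro finish_in_B[OF 1 _ e(1) t]) (use S s in auto)
      then show ?thesis by (rule near_pathI[where w = s]) (use S s w in auto)
    qed
  qed
qed

end

context
  assumes m7: "7 \<le> m" and sm: "fA + 8 \<le> 2 * m" and b0: "fB = 0" "ncross = 0"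
begin

lemma sm': "fA + fB + ncross + 8 \<le> 2 * m" and b1': "fB + ncross \<le> 1"
  using sm b0 by simp_all

lemmas finish_in_B' = finish_in_B[OF m7 sm' b1'] and finish_with_piece' = finish_with_piece[OF m7 sm' b1'] and link_pieces_to' = link_pieces_to[OF m7 sm' b1']
  and near_big' = near_big[OF m7 sm' b1']

lemma cr0: "x \<in> A - FV \<Longrightarrow> crossable x"
  using crossable_all[OF b0] .

text \<open>The path starts with \<open>s\<close>, \<open>d\<close> and follows \<open>Q\<close>
  from \<open>d\<close> to \<open>b\<close>. The part of \<open>Q\<close> before \<open>d\<close> is
  threaded through \<open>B\<close>, or, if it is the single vertex \<open>a\<close>, becomes the
  missed part.\<close>

lemma start_outside_piece:
  assumes h: "hpath Eg Q a b" and Q: "Q \<subseteq> A - FV" "A - FV \<subseteq> insert s Q" and s: "s \<in> A - FV" "s \<notin> Q"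
    and d: "d \<in> Q" "{s, d} \<in> Eg" and t: "t \<in> B - FV" and b: "\<phi> b \<noteq> t"
  shows "near_path Eg (V - FV) s t"
proof -
  have big: "20 \<le> card Q" using near_big'[OF Q] .
  have fQ: "finite Q" using hpath_finite[OF h] .
  have i: "a \<in> Q" "b \<in> Q" using hpath_hd_in[OF h] hpath_last_in[OF h] by auto
  have iR: "a \<in> A - FV" "b \<in> A - FV" using i Q by auto
  have ds: "{d, s} \<in> Eg" using d(2) by (simp add: insert_commute)
  have fin1: "near_path Eg (V - FV) s t" if x: "hpath Eg X d e" "X \<subseteq> Q" "Q \<subseteq> insert v X" for X e v
  proof -
    have e: "e \<in> A - FV" using hpath_last_in[OF x(1)] x(2) Q by auto
    have 1: "hpath Eg ({s} \<union> X) s e" by (rule hpath_join[OF hpath_single x(1) d(2)]) (use x s in auto)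
    have fX: "finite X" using x(2) fQ finite_subset by blast
    have "card Q \<le> card (insert v X)" using x(3) fX by (intro card_mono) auto
    then have "6 \<le> card ({s} \<union> X)" using big fX x(2) s(2) by (auto simp: card_insert_if split: if_splits)
    then have "hpath Eg (({s} \<union> X) \<union> (B - FV)) s t"
      by (intro finish_in_B'[OF 1 _ cr0[OF e] t]) (use x Q s in auto)
    then show ?thesis by (rule near_pathI[where w = v]) (use x Q s in auto)
  qed
  have fin2: "near_path Eg (V - FV) s t" if x: "hpath Eg X d e" "hpath Eg M f g" "f \<noteq> g" "X \<union> M = Q" "X \<inter> M = {}" "\<phi> e \<noteq> t" for X M e f g
  proof -
    have e: "e \<in> A - FV" "f \<in> A - FV" "g \<in> A - FV"
      using hpath_last_in[OF x(1)] hpath_hd_in[OF x(2)] hpath_last_in[OF x(2)] x(4) Q by auto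
    have 1: "hpath Eg ({s} \<union> X) s e" by (rule hpath_join[OF hpath_single x(1) d(2)]) (use x s in auto)
    have "hpath Eg (({s} \<union> X) \<union> M \<union> (B - FV)) s t"
      by (rule finish_with_piece'[OF 1 x(2,3) _ _ _ cr0[OF e(1)] cr0[OF e(2)] cr0[OF e(3)] t x(6)]) (use x(4,5) Q s in auto)
    then show ?thesis by (rule near_pathI[where w = s]) (use x(4) Q s in auto)
  qed
  consider "d = a" | "d = b" | "d \<noteq> a" "d \<noteq> b" by blast
  then show ?thesis
  proof cases
    case 1 then show ?thesis using fin1[of Q b s] h by auto
  next
    case 2 then show ?thesis using fin1[of Q a s] hpath_rev[OF h] by auto
  next
    case 3
    obtain S1 S2 e where s1: "hpath Eg S1 a e" "hpath Eg S2 d b" "{e, d} \<in> Eg" "S1 \<union> S2 = Q" "S1 \<inter> S2 = {}"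
      by (rule hpath_pred[OF h d(1) 3(1)])
    show ?thesis
    proof (cases "a = e")
      case True
      then have "S1 = {a}" using hpath_eq_ends s1(1) by metis
      then show ?thesis using fin1[OF s1(2), of a] s1(4) by auto
    next
      case False
      show ?thesis by (rule fin2[OF s1(2,1) False _ _ b]) (use s1(4,5) in auto)
    qed
  qed
qed

text \<open>From \<open>s\<close> one part of \<open>Q\<close> is followed to its end and the other
  is threaded through \<open>B\<close>. This fails only if the part on the side of \<open>a\<close>
  is \<open>a\<close> alone and \<open>a\<close> is the partner of \<open>t\<close>.\<close>

lemma start_inside_piece:
  assumes h: "hpath Eg Q a b" and Q: "Q \<subseteq> A - FV" "A - FV \<subseteq> insert w Q" and s: "s \<in> Q" "s \<noteq> a" "s \<noteq> b"
    and t: "t \<in> B - FV" and b: "\<phi> b \<noteq> t"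
  shows "near_path Eg (V - FV) s t"
proof -
  have big: "20 \<le> card Q" using near_big'[OF Q] .
  have fQ: "finite Q" using hpath_finite[OF h] .
  have i: "a \<in> Q" "b \<in> Q" using hpath_hd_in[OF h] hpath_last_in[OF h] by auto
  have iR: "a \<in> A - FV" "b \<in> A - FV" "s \<in> A - FV" using i s Q by auto
  obtain S1 S2 a' b' where x: "hpath Eg S1 a a'" "hpath Eg S2 b' b" "{a', s} \<in> Eg" "{s, b'} \<in> Eg"
    "S1 \<union> S2 = Q - {s}" "S1 \<inter> S2 = {}"
    using hpath_drop_vertex[OF h s(1)] s(2,3) by metis
  have j: "a' \<in> S1" "b' \<in> S2" "a \<in> S1" "b \<in> S2"
    using hpath_last_in[OF x(1)] hpath_hd_in[OF x(2)] hpath_hd_in[OF x(1)] hpath_last_in[OF x(2)] .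
  have jR: "a' \<in> A - FV" "b' \<in> A - FV" using j x(5) Q by auto
  have sa: "hpath Eg ({s} \<union> S1) s a"
    by (rule hpath_join[OF hpath_single hpath_rev[OF x(1)]]) (use x(3,5) in \<open>auto simp: insert_commute\<close>)
  have sb: "hpath Eg ({s} \<union> S2) s b"
    by (rule hpath_join[OF hpath_single x(2,4)]) (use x(5) in auto)
  have opt2: "near_path Eg (V - FV) s t" if "a \<noteq> a'"
  proof -
    have "hpath Eg (({s} \<union> S2) \<union> S1 \<union> (B - FV)) s t"
      by (rule finish_with_piece'[OF sb x(1) that _ _ _ cr0 cr0 cr0 t b]) (use x(5,6) Q iR jR in auto)
    moreover have "({s} \<union> S2) \<union> S1 = Q" using x(5) s(1) by auto
    ultimately show ?thesis using near_pathI Q by metis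
  qed
  show ?thesis
  proof (cases "a = a'")
    case False then show ?thesis by (rule opt2)
  next
    case True
    then have S1: "S1 = {a}" using hpath_eq_ends x(1) by metis
    define S3 where "S3 = {s} \<union> S2"
    have QS: "Q = insert a S3" "a \<notin> S3" using x(5,6) s S1 i unfolding S3_def by auto
    have h3: "hpath Eg S3 s b" using sb unfolding S3_def .
    have cS3: "6 \<le> card S3" using QS big fQ by (auto simp: card_insert_if)
    have S3R: "S3 \<subseteq> A - FV" using QS Q by auto
    have bb: "b' \<noteq> b"
    proof
      assume "b' = b"
      then have "S2 = {b}" using hpath_eq_ends x(2) by metis
      then have "card S3 \<le> 2" unfolding S3_def by (simp add: card_insert_if)
      then show False using cS3 by simp
    qed
    show ?thesis
    proof (cases "\<phi> a = t")
      case False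
      have "hpath Eg (({s} \<union> S1) \<union> S2 \<union> (B - FV)) s t"
        by (rule finish_with_piece'[OF sa x(2) bb _ _ _ cr0 cr0 cr0 t False]) (use x(5,6) Q iR jR in auto)
      moreover have "({s} \<union> S1) \<union> S2 = Q" using x(5) s(1) by auto
      ultimately show ?thesis using near_pathI Q by metis
    next
      case at: True
      \<comment> \<open>The exceptional position: \<open>a\<close> is either visited last,
        immediately before \<open>t\<close>, or left out and replaced by the vertex \<open>w\<close>
        missed so far.\<close>
      have off: "\<phi> e \<noteq> t" if "e \<in> A" "e \<noteq> a" for e using at that iR phi_eq by auto
      show ?thesis
      proof (cases "A - FV \<subseteq> Q")
        case True
        have "hpath Eg (S3 \<union> (B - FV)) s t" by (rule finish_in_B'[OF h3 S3R cr0[OF iR(2)] t cS3])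
        then show ?thesis by (rule near_pathI[where w = a]) (use S3R True QS in auto)
      next
        case False
        then have w: "w \<in> A - FV" "w \<notin> Q" "w \<noteq> a" using Q i by auto
        consider "w \<in> good_A a" | d where "w \<notin> good_A a" "d \<in> good_A a" "d \<noteq> s" | "w \<notin> good_A a" "good_A a \<subseteq> {s}" by blast
        then show ?thesis
        proof cases
          case 1
          have M: "hpath Eg ({w} \<union> {a}) w a"
            by (rule hpath_join[OF hpath_single hpath_single]) (use good_nbrs_A[OF 1] in \<open>auto simp: insert_commute\<close>)
          have "hpath Eg (S3 \<union> ({w} \<union> {a}) \<union> (B - FV)) s t"
            by (rule link_pieces_to'[OF h3 M S3R _ _ cr0 cr0 cr0 at b off]) (use w iR QS in auto)
          then show ?thesis by (rule near_pathI[where w = a]) (use w S3R iR Q QS in auto)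
        next
          case (2 d)
          have dS: "d \<in> S3" using good_nbrs_A[OF 2(2)] 2(1,2) Q QS by auto
          obtain T1 T2 e where p: "hpath Eg T1 s e" "hpath Eg T2 d b" "{e, d} \<in> Eg" "T1 \<union> T2 = S3" "T1 \<inter> T2 = {}"
            by (rule hpath_pred[OF h3 dS 2(3)])
          have e: "e \<in> A - FV" "e \<noteq> a" using hpath_last_in[OF p(1)] p(4) S3R QS by auto
          have M: "hpath Eg (T2 \<union> {a}) b a"
            by (rule hpath_join[OF hpath_rev[OF p(2)] hpath_single]) (use good_nbrs_A[OF 2(2)] p(4) QS in \<open>auto simp: insert_commute\<close>)
          have "hpath Eg (T1 \<union> (T2 \<union> {a}) \<union> (B - FV)) s t"
            by (rule link_pieces_to'[OF p(1) M _ _ _ cr0 cr0 cr0 at off b]) (use p(4,5) QS S3R iR e in auto)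
          moreover have "T1 \<union> (T2 \<union> {a}) = Q" using p(4) QS by auto
          ultimately show ?thesis using near_pathI Q by metis
        next
          case 3
          \<comment> \<open>Here \<open>a\<close> can be reached neither from \<open>w\<close> nor
            from a vertex of \<open>S3\<close> other than \<open>s\<close>, so it is given up. The
            count for two vertices leaves \<open>w\<close> a neighbour other than \<open>s\<close>
            at which it is inserted.\<close>
          have "card (good_A a) \<le> 1" using card_mono[OF _ 3(2)] by simp
          moreover have "2 * m \<le> card (good_A a) + card (good_A w) + fA + 3"
            by (rule good_nbrs_two[OF tA]) (use w iR in auto)
          ultimately have "2 \<le> card (good_A w)" using sm by linarith
          then obtain d where d: "d \<in> good_A w" "d \<noteq> s" using card_ge2_avoid[of "good_A w" s] by blast
          have "w \<in> good_A d" by (rule good_nbrs_sym[OF d(1) w(1)])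
          then have "d \<noteq> a" using 3(1) by metis
          then have dS: "d \<in> S3" using good_nbrs_A[OF d(1)] Q QS by auto
          obtain T1 T2 e where p: "hpath Eg T1 s e" "hpath Eg T2 d b" "{e, d} \<in> Eg" "T1 \<union> T2 = S3" "T1 \<inter> T2 = {}"
            by (rule hpath_pred[OF h3 dS d(2)])
          have e: "e \<in> A - FV" "e \<noteq> a" using hpath_last_in[OF p(1)] p(4) S3R QS by auto
          have wS: "w \<notin> S3" "w \<noteq> b" using w QS i by auto
          have M: "hpath Eg ({w} \<union> T2) w b"
            by (rule hpath_join[OF hpath_single p(2)]) (use good_nbrs_A[OF d(1)] p(4) wS in auto)
          have "hpath Eg (T1 \<union> ({w} \<union> T2) \<union> (B - FV)) s t"
            by (rule finish_with_piece'[OF p(1) M wS(2) _ _ _ cr0 cr0 cr0 t off]) (use p(4,5) S3R wS w iR e in auto)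
          then show ?thesis by (rule near_pathI[where w = a]) (use p(4) S3R w Q QS in auto)
        qed
      qed
    qed
  qed
qed

lemma crowded_AB_drop:
  assumes NC: "near_cycle_at TYPE('a) m" and a: "fA = Suc (2 * m - 9)"
    and s: "s \<in> A - FV" and t: "t \<in> B - FV" and ns: "\<exists>z\<in>good_nbrs FV FE V E s. z \<noteq> t"
  shows "near_path Eg (V - FV) s t"
proof -
  obtain Q w a b where Q: "Q \<subseteq> A - FV" "hpath Eg Q a b" "A - FV \<subseteq> insert w Q"
    by (rule near_cycle_A_drop[OF m7 sm' b1' NC a])
  have big: "20 \<le> card Q" using near_big'[OF Q(1,3)] .
  have i: "a \<in> A - FV" "b \<in> A - FV" using hpath_hd_in[OF Q(2)] hpath_last_in[OF Q(2)] Q(1) by auto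
  have ab: "a \<noteq> b" using hpath_card1[OF Q(2)] big by auto
  \<comment> \<open>At most one end has partner \<open>t\<close>; the piece is oriented so that this
    is not the end called \<open>b\<close> in the two lemmas applied below.\<close>
  then have or: "\<phi> a \<noteq> t \<or> \<phi> b \<noteq> t" using phi_eq i by auto
  show ?thesis
  proof (cases "s \<in> Q")
    case True
    consider "s = a" | "s = b" | "s \<noteq> a" "s \<noteq> b" by blast
    then show ?thesis
    proof cases
      case 1
      have "hpath Eg (Q \<union> (B - FV)) s t"
        by (rule finish_in_B'[OF _ Q(1) cr0[OF i(2)] t]) (use 1 Q(2) big in auto)
      then show ?thesis using near_pathI Q by blast
    next
      case 2
      have "hpath Eg (Q \<union> (B - FV)) s t"
        by (rule finish_in_B'[OF _ Q(1) cr0[OF i(1)] t]) (use 2 hpath_rev[OF Q(2)] big in auto)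
      then show ?thesis using near_pathI Q by blast
    next
      case 3
      then show ?thesis
        using or start_inside_piece[OF Q(2,1,3) True _ _ t] start_inside_piece[OF hpath_rev[OF Q(2)] Q(1,3) True _ _ t] by blast
    qed
  next
    case False
    then have w: "A - FV \<subseteq> insert s Q" using Q(3) s by auto
    show ?thesis
    proof (cases "good_A s = {}")
      case True
      then have c: "crossable s" "\<phi> s \<noteq> t" using ns good_nbrs_V[OF _ s] by auto
      show ?thesis
        by (rule prefix_isolated[OF m7 sm' b1' s False Q(2,1) cr0[OF i(1)] cr0[OF i(2)] _ t c w]) (use big in simp)
    next
      case F2: False
      then obtain d where d: "d \<in> good_A s" by blast
      have dQ: "d \<in> Q" "{s, d} \<in> Eg" using good_nbrs_A[OF d] w by auto
      show ?thesis
        using or start_outside_piece[OF Q(2,1) w s False dQ t] start_outside_piece[OF hpath_rev[OF Q(2)] Q(1) w s False dQ t] by blast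
    qed
  qed
qed

end

lemma crowded_AB:
  assumes m7: "7 \<le> m" and sm: "fA + fB + ncross + 8 \<le> 2 * m" and b1: "fB + ncross \<le> 1"
    and NC: "near_cycle_at TYPE('a) m" and s: "s \<in> A - FV" and t: "t \<in> B - FV" and ns: "\<exists>z\<in>good_nbrs FV FE V E s. z \<noteq> t"
  shows "near_path Eg (V - FV) s t"
proof (cases "fA + 9 \<le> 2 * m")
  case True
  obtain S w where S: "S \<subseteq> A - FV" "hcycle Eg S" "A - FV \<subseteq> insert w S" by (rule near_cycle_A[OF m7 sm b1 NC True])
  show ?thesis by (rule crowded_AB_cycle[OF m7 sm b1 S s t ns])
next
  case False
  then have z: "fA = Suc (2 * m - 9)" "fB = 0" "ncross = 0" using sm m7 by linarith+
  have "fA + 8 \<le> 2 * m" using sm by simp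
  then show ?thesis by (rule crowded_AB_drop[OF m7 _ z(2,3) NC z(1) s t ns])
qed

end

section \<open>More than \<open>2 * m - 10\<close> faults in the larger half: both end points
  there\<close>

context thsplit begin

text \<open>The ignored fault is chosen to unblock \<open>s\<close>. If each of the at least
  \<open>m - 1\<close> neighbours other than \<open>t\<close> were blocked both by itself and by its
  edge to \<open>s\<close>, there would be at least \<open>2 * m - 2\<close> faults. So some
  neighbour is blocked by one fault only.\<close>

lemma free_one:
  assumes a: "fA = Suc k" "fA + 8 \<le> 2 * m" and s: "s \<in> A - FV" and low: "good_A s \<subseteq> {t}"
  obtains FV' FE' where "drop1 FV FE FV' FE'" "nfaults FV' FE' A EA = k" "\<exists>z\<in>good_nbrs FV' FE' A EA s. z \<noteq> t"
proof -
  let ?N = "nbrs EA s - {t}"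
  have fN: "finite (nbrs EA s)" using nbrs_EA finA finite_subset by blast
  have "card (nbrs EA s) = m" using thln_degree[OF tA] s by auto
  then have cN: "m \<le> card ?N + 1" using fN m3 by (simp add: card_Diff_singleton_if)
  have "\<exists>z\<in>?N. \<not> (z \<in> FV \<and> {s, z} \<in> FE)"
  proof (rule ccontr)
    assume c: "\<not> ?thesis"
    have "card ?N \<le> card (FV \<inter> A)" using c nbrs_EA[of s] finA by (intro card_mono) auto
    moreover have "card ?N \<le> card (FE \<inter> EA)"
      by (rule card_inj_on_le[of "\<lambda>z. {s, z}"]) (use c finEA in \<open>auto simp: inj_on_def doubleton_eq_iff nbrs_def\<close>)
    ultimately show False using cN a(2) unfolding nfaults_def by linarith
  qed
  then obtain z where z: "z \<in> nbrs EA s" "z \<noteq> t" "\<not> (z \<in> FV \<and> {s, z} \<in> FE)" by blast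
  have zA: "z \<in> A" "{s, z} \<in> EA" using z(1) nbrs_EA by (auto simp: nbrs_def)
  have "z \<notin> good_A s" using low z(2) by auto
  then consider "z \<in> FV" "{s, z} \<notin> FE" | "z \<notin> FV" "{s, z} \<in> FE" using z(3) zA unfolding good_nbrs_def by auto
  then show thesis
  proof cases
    case 1
    show thesis
      by (rule that[OF drop1_vertex(2,1)[OF 1(1) zA(1) finA a(1)]])
        (use 1 zA z(2) in \<open>auto simp: good_nbrs_def\<close>)
  next
    case 2
    show thesis
      by (rule that[OF drop1_edge(2,1)[OF 2(2) zA(2) finEA a(1)]])
        (use 2 zA z(2) in \<open>auto simp: good_nbrs_def\<close>)
  qed
qed

text \<open>If one end point is blocked, the other has at least four usable neighbours by
  \<open>good_nbrs_two\<close>, so a single ignored fault serves both.\<close>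

lemma free_both:
  assumes a: "fA = Suc k" "fA + 8 \<le> 2 * m" and s: "s \<in> A - FV" and t: "t \<in> A - FV" and ne: "s \<noteq> t"
  obtains FV' FE' where "drop1 FV FE FV' FE'" "nfaults FV' FE' A EA = k"
    "\<exists>z\<in>good_nbrs FV' FE' A EA s. z \<noteq> t" "\<exists>z\<in>good_nbrs FV' FE' A EA t. z \<noteq> s"
proof -
  have other: "\<exists>z\<in>good_A v. z \<noteq> u" if "u \<in> A - FV" "v \<in> A - FV" "u \<noteq> v" "good_A u \<subseteq> {v}" for u v
  proof -
    have "card (good_A u) \<le> 1" using card_mono[OF _ that(4)] by simp
    moreover have "2 * m \<le> card (good_A u) + card (good_A v) + fA + 3"
      by (rule good_nbrs_two[OF tA]) (use that in auto)
    ultimately have "2 \<le> card (good_A v)" using a(2) by linarith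
    then show ?thesis using card_ge2_avoid[of "good_A v" u] by blast
  qed
  consider "good_A s \<subseteq> {t}" | "good_A t \<subseteq> {s}" | "\<exists>z\<in>good_A s. z \<noteq> t" "\<exists>z\<in>good_A t. z \<noteq> s" by blast
  then show thesis
  proof cases
    case 1
    obtain FV' FE' where d: "drop1 FV FE FV' FE'" "nfaults FV' FE' A EA = k" "\<exists>z\<in>good_nbrs FV' FE' A EA s. z \<noteq> t"
      by (rule free_one[OF a s 1])
    show thesis using that[OF d] other[OF s t ne 1] good_nbrs_mono[OF d(1), of A EA t] by blast
  next
    case 2
    obtain FV' FE' where d: "drop1 FV FE FV' FE'" "nfaults FV' FE' A EA = k" "\<exists>z\<in>good_nbrs FV' FE' A EA t. z \<noteq> s"
      by (rule free_one[OF a t 2])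
    show thesis using that[OF d(1,2) _ d(3)] other[OF t s ne[symmetric] 2] good_nbrs_mono[OF d(1), of A EA s] by blast
  next
    case 3
    obtain FV' FE' where d: "drop1 FV FE FV' FE'" "nfaults FV' FE' A EA = k" by (rule drop1_ex[OF tA a(1)])
    show thesis using that[OF d] 3 good_nbrs_mono[OF d(1), of A EA s] good_nbrs_mono[OF d(1), of A EA t] by blast
  qed
qed

context
  assumes m7: "7 \<le> m" and sm: "fA + fB + ncross + 8 \<le> 2 * m" and b1: "fB + ncross \<le> 1"
begin

lemmas ham_conn_B_few' = ham_conn_B_few[OF m7 sm b1] and two_dpc_B_few' = two_dpc_B_few[OF m7 sm b1] and near_big1 = near_big[OF m7 sm b1]
  and one_bad' = one_bad[OF m7 sm b1]

lemma link_pieces_B: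
  assumes "hpath Eg S1 s a" "hpath Eg S2 b t" "S1 \<subseteq> A" "S2 \<subseteq> A" "S1 \<inter> S2 = {}" "crossable a" "crossable b"
  shows "hpath Eg (S1 \<union> S2 \<union> (B - FV)) s t"
  by (rule link_pieces[OF assms(1,2,3,4,5,6,7) _ _ _ ham_conn_B_few']) (use crossable_in[OF assms(6)] crossable_in[OF assms(7)] in auto)

lemma link_three_pieces_B:
  assumes "hpath Eg S1 s a" "hpath Eg M b x" "hpath Eg S2 y t" "b \<noteq> x"
    "S1 \<subseteq> A" "M \<subseteq> A" "S2 \<subseteq> A" "S1 \<inter> S2 = {}" "S1 \<inter> M = {}" "S2 \<inter> M = {}"
    "crossable a" "crossable b" "crossable x" "crossable y"
  shows "hpath Eg (S1 \<union> M \<union> S2 \<union> (B - FV)) s t"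
  by (rule link_three_pieces[OF assms _ _ _ _ _ two_dpc_B_few'])
    (use crossable_in[OF assms(11)] crossable_in[OF assms(12)] crossable_in[OF assms(13)] crossable_in[OF assms(14)] in auto)

text \<open>The piece containing \<open>d\<close> is cut next to \<open>d\<close>, and
  \<open>x\<close> is attached there. This creates a middle piece containing \<open>x\<close> and
  \<open>d\<close>, hence with two different ends; \<open>d \<noteq> s\<close> and
  \<open>d \<noteq> t\<close> keep the outer pieces nonempty.\<close>

lemma insert_vertex_pieces:
  assumes h: "hpath Eg S1 s a" "hpath Eg S2 b t" and S: "S1 \<subseteq> A - FV" "S2 \<subseteq> A - FV" "S1 \<inter> S2 = {}"
    and x: "x \<in> A - FV" "x \<notin> S1 \<union> S2" and d: "d \<in> good_A x" "d \<in> S1 \<union> S2" "d \<noteq> s" "d \<noteq> t"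
    and c: "\<And>z. z \<in> insert x (S1 \<union> S2) \<Longrightarrow> crossable z"
  shows "hpath Eg (insert x (S1 \<union> S2) \<union> (B - FV)) s t"
proof -
  have i: "a \<in> S1" "b \<in> S2" using hpath_last_in[OF h(1)] hpath_hd_in[OF h(2)] .
  have xd: "{x, d} \<in> Eg" "{d, x} \<in> Eg" using good_nbrs_A[OF d(1)] by (auto simp: insert_commute)
  consider "d \<in> S1" | "d \<in> S2" using d(2) by blast
  then show ?thesis
  proof cases
    case 1
    obtain T1 T2 e where p: "hpath Eg T1 s e" "hpath Eg T2 d a" "{e, d} \<in> Eg" "T1 \<union> T2 = S1" "T1 \<inter> T2 = {}"
      by (rule hpath_pred[OF h(1) 1 d(3)])
    have M: "hpath Eg ({x} \<union> T2) x a" by (rule hpath_join[OF hpath_single p(2) xd(1)]) (use x p(4) in auto)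
    have e: "e \<in> S1" using hpath_last_in[OF p(1)] p(4) by auto
    have "hpath Eg (T1 \<union> ({x} \<union> T2) \<union> S2 \<union> (B - FV)) s t"
      by (rule link_three_pieces_B[OF p(1) M h(2)]) (use p(4,5) x S i e c in auto)
    moreover have "T1 \<union> ({x} \<union> T2) \<union> S2 = insert x (S1 \<union> S2)" using p(4) by auto
    ultimately show ?thesis by metis
  next
    case 2
    obtain T1 T2 e where p: "hpath Eg T1 b d" "hpath Eg T2 e t" "{d, e} \<in> Eg" "T1 \<union> T2 = S2" "T1 \<inter> T2 = {}"
      by (rule hpath_succ[OF h(2) 2 d(4)])
    have M: "hpath Eg (T1 \<union> {x}) b x" by (rule hpath_join[OF p(1) hpath_single xd(2)]) (use x p(4) in auto)
    have e: "e \<in> S2" using hpath_hd_in[OF p(2)] p(4) by auto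
    have "hpath Eg (S1 \<union> (T1 \<union> {x}) \<union> T2 \<union> (B - FV)) s t"
      by (rule link_three_pieces_B[OF h(1) M p(2)]) (use p(4,5) x S i e c in auto)
    moreover have "S1 \<union> (T1 \<union> {x}) \<union> T2 = insert x (S1 \<union> S2)" using p(4) by auto
    ultimately show ?thesis by metis
  qed
qed

text \<open>The only uncrossable vertex \<open>a\<close> is the end of a piece. If no fault-free neighbour of \<open>a\<close> allows to
  rotate it into the interior, then \<open>a\<close> has at most two of them, so the missed vertex \<open>w\<close> has enough
  to be inserted in place of \<open>a\<close>.\<close>

lemma pieces_uncrossable_end:
  assumes h: "hpath Eg S1 s a" "hpath Eg S2 b t" and Q: "S1 \<union> S2 = Q" "S1 \<inter> S2 = {}" "Q \<subseteq> A - FV" "A - FV \<subseteq> insert w Q"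
    and ne: "s \<noteq> t" and nc: "\<not> crossable a" and ns: "\<not> crossable s \<Longrightarrow> \<exists>z\<in>good_A s. z \<noteq> t" and n9: "fA + 9 \<le> 2 * m"
  shows "near_path Eg (V - FV) s t"
proof -
  have i: "a \<in> S1" "s \<in> S1" "b \<in> S2" "t \<in> S2"
    using hpath_last_in[OF h(1)] hpath_hd_in[OF h(1)] hpath_hd_in[OF h(2)] hpath_last_in[OF h(2)] .
  have SR: "S1 \<subseteq> A - FV" "S2 \<subseteq> A - FV" using Q by auto
  have aR: "a \<in> A - FV" using i SR by auto
  have crossable: "crossable z" if "z \<in> A - FV" "z \<noteq> a" for z using one_bad'[OF that(1) aR that(2)] nc by blast
  have b: "b \<in> A - FV" "b \<noteq> a" using i SR Q(2) by auto
  consider (out) d where "d \<in> good_A a" "d \<notin> Q" | (two) d where "d \<in> good_A a" "d \<in> S2" "d \<noteq> t"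
    | (rot) d1 d2 where "d1 \<in> good_A a" "d2 \<in> good_A a" "d1 \<in> S1" "d2 \<in> S1" "d1 \<noteq> d2"
    | (none) "good_A a \<subseteq> insert t S1" "\<And>d1 d2. d1 \<in> good_A a \<Longrightarrow> d2 \<in> good_A a \<Longrightarrow> d1 \<in> S1 \<Longrightarrow> d2 \<in> S1 \<Longrightarrow> d1 = d2"
    using Q(1) by blast
  then show ?thesis
  proof cases
    case (out d)
    have d: "d \<in> A - FV" "{a, d} \<in> Eg" "d \<noteq> a" using good_nbrs_A[OF out(1)] by auto
    have dw: "d = w" using d(1) out(2) Q(4) by auto
    have 1: "hpath Eg (S1 \<union> {d}) s d" by (rule hpath_join[OF h(1) hpath_single d(2)]) (use out(2) Q(1) in auto)
    have "hpath Eg ((S1 \<union> {d}) \<union> S2 \<union> (B - FV)) s t"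
      by (rule link_pieces_B[OF 1 h(2) _ _ _ crossable crossable]) (use d b out(2) SR Q(1,2) in auto)
    then show ?thesis by (rule near_pathI[where w = w]) (use d SR Q dw in auto)
  next
    case (two d)
    \<comment> \<open>\<open>a\<close> is joined to \<open>d\<close> inside the second piece. The
      initial part of that piece moves to the first piece in reverse, whose new end is
      \<open>b\<close>.\<close>
    obtain T1 T2 e where p: "hpath Eg T1 b d" "hpath Eg T2 e t" "{d, e} \<in> Eg" "T1 \<union> T2 = S2" "T1 \<inter> T2 = {}"
      by (rule hpath_succ[OF h(2) two(2,3)])
    have e: "e \<in> A - FV" "e \<noteq> a" using hpath_hd_in[OF p(2)] p(4) SR i Q(2) by auto
    have 1: "hpath Eg (S1 \<union> T1) s b"
      by (rule hpath_join[OF h(1) hpath_rev[OF p(1)]]) (use good_nbrs_A[OF two(1)] p(4) Q(2) in auto)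
    have "hpath Eg ((S1 \<union> T1) \<union> T2 \<union> (B - FV)) s t"
      by (rule link_pieces_B[OF 1 p(2) _ _ _ crossable[OF b] crossable[OF e]]) (use p(4,5) SR Q(2) in auto)
    moreover have "(S1 \<union> T1) \<union> T2 = Q" using p(4) Q(1) by auto
    ultimately show ?thesis using near_pathI Q(3,4) by metis
  next
    case (rot d1 d2)
    obtain y where y: "hpath Eg S1 s y" "y \<noteq> a"
      by (rule hpath_rotate2[OF h(1) rot(3,4,5)]) (use good_nbrs_A[OF rot(1)] good_nbrs_A[OF rot(2)] in auto)
    have yR: "y \<in> A - FV" using hpath_last_in[OF y(1)] SR by auto
    have "hpath Eg (S1 \<union> S2 \<union> (B - FV)) s t"
      by (rule link_pieces_B[OF y(1) h(2) _ _ Q(2) crossable[OF yR y(2)] crossable[OF b]]) (use SR in auto)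
    then show ?thesis using near_pathI Q(1,3,4) by metis
  next
    case none
    have cG: "card (good_A a) \<le> 2"
    proof -
      have fS: "finite S1" using hpath_finite[OF h(1)] .
      have "card (good_A a \<inter> S1) \<le> 1" using none(2) fS card_le_Suc0_iff_eq[of "good_A a \<inter> S1"] by auto
      moreover have "card (good_A a) \<le> card (insert t (good_A a \<inter> S1))" using none(1) fS by (intro card_mono) auto
      ultimately show ?thesis using fS by (simp add: card_insert_if split: if_splits)
    qed
    \<comment> \<open>If the first piece were \<open>s\<close> alone, an uncrossable
      \<open>s\<close> would still have a neighbour in \<open>A\<close> other than \<open>t\<close>,
      against the exhausted cases.\<close>
    have sa: "s \<noteq> a"
    proof
      assume e: "s = a"
      then obtain z where z: "z \<in> good_A a" "z \<noteq> t" using ns nc by blast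
      have "S1 = {a}" using h(1) e hpath_eq_ends by metis
      then show False using z none(1) good_nbrs_A[OF z(1)] by auto
    qed
    obtain T1 T2 a' where p: "hpath Eg T1 s a'" "hpath Eg T2 a a" "{a', a} \<in> Eg" "T1 \<union> T2 = S1" "T1 \<inter> T2 = {}"
      by (rule hpath_pred[OF h(1) i(1) sa[symmetric]])
    have T2: "T2 = {a}" using hpath_eq_ends[OF p(2)] .
    have T1: "T1 = S1 - {a}" using p(4,5) T2 by auto
    have a': "a' \<in> A - FV" "a' \<noteq> a" using hpath_last_in[OF p(1)] T1 SR by auto
    show ?thesis
    proof (cases "A - FV \<subseteq> Q")
      case True
      have "hpath Eg (T1 \<union> S2 \<union> (B - FV)) s t"
        by (rule link_pieces_B[OF p(1) h(2) _ _ _ crossable[OF a'] crossable[OF b]]) (use T1 SR Q(2) in auto)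
      then show ?thesis by (rule near_pathI[where w = a]) (use T1 SR True Q(1) in auto)
    next
      case False
      then have w: "w \<in> A - FV" "w \<notin> Q" "w \<noteq> a" using Q i by auto
      have wG: "w \<notin> good_A a" using none(1) w(2) i Q(1) by auto
      have "2 * m \<le> card (good_A a) + card (good_A w) + fA + 3"
        by (rule good_nbrs_two[OF tA]) (use w aR in auto)
      \<comment> \<open>With \<open>fA \<le> 2 * m - 9\<close> there are six usable neighbours in
        all, at most two of them at \<open>a\<close>. Three at \<open>w\<close> are needed to avoid
        both \<open>s\<close> and \<open>t\<close>.\<close>
      then have "3 \<le> card (good_A w)" using cG n9 by linarith
      then obtain d where d: "d \<in> good_A w" "d \<noteq> s" "d \<noteq> t" using card_ge3_avoid[of "good_A w" s t] by blast
      have "w \<in> good_A d" by (rule good_nbrs_sym[OF d(1) w(1)])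
      then have "d \<noteq> a" using wG by metis
      then have dT: "d \<in> T1 \<union> S2" using good_nbrs_A[OF d(1)] Q(1,4) T1 by auto
      have "hpath Eg (insert w (T1 \<union> S2) \<union> (B - FV)) s t"
        by (rule insert_vertex_pieces[OF p(1) h(2) _ _ _ w(1) _ d(1) dT d(2,3) crossable]) (use T1 SR Q(1,2) w i in auto)
      then show ?thesis by (rule near_pathI[where w = a]) (use T1 SR w Q in auto)
    qed
  qed
qed

lemma crowded_AA_one:
  assumes T: "near_path_at TYPE('a) m" and n9: "fA = Suc (2 * m - 10)"
    and s: "s \<in> A - FV" and t: "t \<in> A - FV" and ne: "s \<noteq> t"
    and ns: "\<exists>z\<in>good_nbrs FV FE V E s. z \<noteq> t" and nt: "\<exists>z\<in>good_nbrs FV FE V E t. z \<noteq> s"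
    and n8: "nfaults FV FE V E + 8 \<le> 2 * m" and le: "fB \<le> fA"
  shows "near_path Eg (V - FV) s t"
proof -
  have a8: "fA + 8 \<le> 2 * m" using sm by simp
  have a9: "fA + 9 \<le> 2 * m" using n9 m7 by simp
  obtain FV' FE' where d: "drop1 FV FE FV' FE'" "nfaults FV' FE' A EA = 2 * m - 10"
    "\<exists>z\<in>good_nbrs FV' FE' A EA s. z \<noteq> t" "\<exists>z\<in>good_nbrs FV' FE' A EA t. z \<noteq> s"
    by (rule free_both[OF n9 a8 s t ne])
  have sub: "FV' \<subseteq> FV" using drop1_sub[OF d(1)] by auto
  have "nfaults FV' FE' A EA + 10 \<le> 2 * m" using d(2) m7 by simp
  moreover have "s \<in> A - FV'" "t \<in> A - FV'" using s t sub by auto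
  ultimately have "near_path (EA - FE') (A - FV') s t"
    using T[unfolded near_path_at_def, rule_format, OF tA _ _ _ ne d(3,4)] by blast
  then obtain S w where S: "S \<subseteq> A - FV'" "hpath (EA - FE') S s t" "A - FV' \<subseteq> insert w S" unfolding near_path_def by blast
  have Q: "S - FV \<subseteq> A - FV" "A - FV \<subseteq> insert w (S - FV)" using S sub by auto
  \<comment> \<open>A usable neighbour of \<open>s\<close> in the whole network is its partner or
    lies in \<open>A\<close>; if \<open>s\<close> cannot cross, it lies in \<open>A\<close>.\<close>
  have gs: "\<not> crossable s \<Longrightarrow> \<exists>z\<in>good_A s. z \<noteq> t" using ns good_nbrs_V[OF _ s] by blast
  have gt: "\<not> crossable t \<Longrightarrow> \<exists>z\<in>good_A t. z \<noteq> s" using nt good_nbrs_V[OF _ t] by blast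
  have dj: "S \<inter> FV' = {}" using S(1) by auto
  have "(\<exists>a. hpath (EA - FE) (S - FV) s a \<and> (t \<notin> FV \<longrightarrow> a = t)) \<or>
    (\<exists>S1 S2 a b. hpath (EA - FE) S1 s a \<and> hpath (EA - FE) S2 b t \<and> S1 \<union> S2 = S - FV \<and> S1 \<inter> S2 = {})"
    by (rule drop_hpath[OF d(1) S(2) dj]) (use s in auto)
  then show ?thesis
  proof (elim disjE exE conjE)
    fix a assume "hpath (EA - FE) (S - FV) s a" "t \<notin> FV \<longrightarrow> a = t"
    then have h: "hpath (EA - FE) (S - FV) s t" using t by auto
    show ?thesis by (rule near_detour[OF m7 n8 le hpath_mono[OF h EA_sub] Q])
  next
    fix S1 S2 a b assume x: "hpath (EA - FE) S1 s a" "hpath (EA - FE) S2 b t" "S1 \<union> S2 = S - FV" "S1 \<inter> S2 = {}"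
    note h = hpath_mono[OF x(1) EA_sub] hpath_mono[OF x(2) EA_sub]
    consider "\<not> crossable a" | "\<not> crossable b" | "crossable a" "crossable b" by blast
    then show ?thesis
    proof cases
      case 1
      show ?thesis by (rule pieces_uncrossable_end[OF h x(3,4) Q ne 1 gs a9])
    next
      case 2
      have "near_path Eg (V - FV) t s"
        by (rule pieces_uncrossable_end[OF hpath_rev[OF h(2)] hpath_rev[OF h(1)] _ _ Q ne[symmetric] 2 gt a9]) (use x(3,4) in auto)
      then show ?thesis by (rule near_path_rev)
    next
      case 3
      have "hpath Eg (S1 \<union> S2 \<union> (B - FV)) s t"
        by (rule link_pieces_B[OF h _ _ x(4) 3]) (use x(3) Q(1) in auto)
      then show ?thesis using near_pathI Q unfolding x(3) by blast
    qed
  qed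
qed

lemma crowded_AA_two:
  assumes T: "near_path_at TYPE('a) m" and n9: "fA = Suc (2 * m - 9)" and b0: "fB = 0" "ncross = 0"
    and s: "s \<in> A - FV" and t: "t \<in> A - FV" and ne: "s \<noteq> t"
    and n8: "nfaults FV FE V E + 8 \<le> 2 * m" and le: "fB \<le> fA"
  shows "near_path Eg (V - FV) s t"
proof -
  have a8: "fA + 8 \<le> 2 * m" using sm by simp
  have crossable: "\<And>x. x \<in> A - FV \<Longrightarrow> crossable x" using crossable_all[OF b0] .
  obtain FV' FE' where d: "drop1 FV FE FV' FE'" "nfaults FV' FE' A EA = 2 * m - 9"
    "\<exists>z\<in>good_nbrs FV' FE' A EA s. z \<noteq> t" "\<exists>z\<in>good_nbrs FV' FE' A EA t. z \<noteq> s"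
    by (rule free_both[OF n9 a8 s t ne])
  have "nfaults FV' FE' A EA = Suc (2 * m - 10)" using d(2) m7 by simp
  \<comment> \<open>The second ignored fault is arbitrary: ignoring faults only enlarges the sets of
    usable neighbours.\<close>
  then obtain FV'' FE'' where d': "drop1 FV' FE' FV'' FE''" "nfaults FV'' FE'' A EA = 2 * m - 10"
    by (rule drop1_ex[OF tA])
  have sub: "FV' \<subseteq> FV" "FV'' \<subseteq> FV'" using drop1_sub[OF d(1)] drop1_sub[OF d'(1)] by auto
  have g: "\<exists>z\<in>good_nbrs FV'' FE'' A EA s. z \<noteq> t" "\<exists>z\<in>good_nbrs FV'' FE'' A EA t. z \<noteq> s"
    using d(3,4) good_nbrs_mono[OF d'(1), of A EA s] good_nbrs_mono[OF d'(1), of A EA t] by blast+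
  have "nfaults FV'' FE'' A EA + 10 \<le> 2 * m" using d'(2) m7 by simp
  moreover have "s \<in> A - FV''" "t \<in> A - FV''" using s t sub by auto
  ultimately have "near_path (EA - FE'') (A - FV'') s t"
    using T[unfolded near_path_at_def, rule_format, OF tA _ _ _ ne g] by blast
  then obtain S w where S: "S \<subseteq> A - FV''" "hpath (EA - FE'') S s t" "A - FV'' \<subseteq> insert w S" unfolding near_path_def by blast
  have Q: "S - FV \<subseteq> A - FV" "A - FV \<subseteq> insert w (S - FV)" using S sub by auto
  have dj: "S \<inter> FV'' = {}" using S(1) by auto
  have e: "{} \<notin> EA" using thln_basic[OF tA] by blast
  have st: "s \<notin> FV" "t \<notin> FV" using s t by auto
  from d(1) d'(1) e S(2) dj st show ?thesis
  proof (cases rule: drop_two)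
    case one
    show ?thesis by (rule near_detour[OF m7 n8 le hpath_mono[OF one EA_sub] Q])
  next
    case (two S1 S2 a b)
    note h = hpath_mono[OF two(1) EA_sub] hpath_mono[OF two(2) EA_sub]
    have i: "a \<in> S - FV" "b \<in> S - FV" using hpath_last_in[OF h(1)] hpath_hd_in[OF h(2)] two(3) by auto
    have "hpath Eg (S1 \<union> S2 \<union> (B - FV)) s t"
      by (rule link_pieces_B[OF h _ _ two(4) crossable crossable]) (use two(3) Q(1) i in auto)
    then show ?thesis using near_pathI Q unfolding two(3) by blast
  next
    case (three S1 M S2 a b x y)
    note h = hpath_mono[OF three(1) EA_sub] hpath_mono[OF three(2) EA_sub] hpath_mono[OF three(3) EA_sub]
    have i: "a \<in> S1" "b \<in> M" "x \<in> M" "y \<in> S2" "s \<in> S1" "t \<in> S2"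
      using hpath_last_in[OF h(1)] hpath_hd_in[OF h(2)] hpath_last_in[OF h(2)] hpath_hd_in[OF h(3)] hpath_hd_in[OF h(1)] hpath_last_in[OF h(3)] .
    have SR: "S1 \<subseteq> A - FV" "M \<subseteq> A - FV" "S2 \<subseteq> A - FV" using three(4) Q(1) by auto
    have iR: "a \<in> A - FV" "b \<in> A - FV" "x \<in> A - FV" "y \<in> A - FV" using i SR by auto
    show ?thesis
    proof (cases "b = x")
      case False
      have "hpath Eg (S1 \<union> M \<union> S2 \<union> (B - FV)) s t"
        by (rule link_three_pieces_B[OF h False _ _ _ three(5,6,7) crossable crossable crossable crossable]) (use SR iR in auto)
      then show ?thesis using near_pathI Q unfolding three(4) by blast
    next
      case True
      \<comment> \<open>A middle piece of one vertex cannot be threaded, so \<open>b\<close> counts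
        as missed. If \<open>w\<close> is missed too, they form a piece when adjacent; otherwise one
        of them is inserted into an outer piece.\<close>
      then have M: "M = {b}" using hpath_eq_ends h(2) by metis
      have QS: "S - FV = insert b (S1 \<union> S2)" "b \<notin> S1 \<union> S2" using three(4,6,7) M by auto
      show ?thesis
      proof (cases "A - FV \<subseteq> S - FV")
        case True
        have "hpath Eg (S1 \<union> S2 \<union> (B - FV)) s t"
          by (rule link_pieces_B[OF h(1,3) _ _ three(5) crossable crossable]) (use SR iR in auto)
        then show ?thesis by (rule near_pathI[where w = b]) (use SR True QS in auto)
      next
        case False
        then have w: "w \<in> A - FV" "w \<notin> S - FV" using Q by auto
        then have wb: "w \<noteq> b" "w \<notin> S1 \<union> S2" using QS by auto
        have R: "A - FV \<subseteq> insert w (insert b (S1 \<union> S2))" using Q(2) QS by auto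
        show ?thesis
        proof (cases "w \<in> good_A b")
          case True
          have bw: "hpath Eg ({b} \<union> {w}) b w"
            by (rule hpath_join[OF hpath_single hpath_single]) (use good_nbrs_A[OF True] in auto)
          have "hpath Eg (S1 \<union> ({b} \<union> {w}) \<union> S2 \<union> (B - FV)) s t"
            by (rule link_three_pieces_B[OF h(1) bw h(3) _ _ _ _ three(5) _ _ crossable crossable crossable crossable]) (use SR iR w wb QS in auto)
          then show ?thesis by (rule near_pathI[where w = w]) (use SR iR w R in auto)
        next
          case False
          have F2: "b \<notin> good_A w" using False good_nbrs_sym[of b w] w by blast
          have main: "near_path Eg (V - FV) s t"
            if v: "v \<in> A - FV" "v \<notin> S1 \<union> S2" "A - FV \<subseteq> insert u (insert v (S1 \<union> S2))" "u \<notin> good_A v"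
              "3 \<le> card (good_A v)" for v u
          proof -
            obtain d where d: "d \<in> good_A v" "d \<noteq> s" "d \<noteq> t" using card_ge3_avoid[OF v(5), of s t] by blast
            have dS: "d \<in> S1 \<union> S2" using good_nbrs_A[OF d(1)] v(3,4) d(1) by auto
            have "hpath Eg (insert v (S1 \<union> S2) \<union> (B - FV)) s t"
              by (rule insert_vertex_pieces[OF h(1,3) SR(1,3) three(5) v(1,2) d(1) dS d(2,3) crossable]) (use SR v in auto)
            then show ?thesis by (rule near_pathI[where w = u]) (use SR v in auto)
          qed
          have "2 * m \<le> card (good_A b) + card (good_A w) + fA + 3"
            by (rule good_nbrs_two[OF tA]) (use w wb iR in auto)
          \<comment> \<open>At least five usable neighbours are shared out between \<open>b\<close>
            and \<open>w\<close>.\<close>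
          then have "3 \<le> card (good_A b) \<or> 3 \<le> card (good_A w)" using a8 by linarith
          then show ?thesis
          proof
            assume "3 \<le> card (good_A b)"
            then show ?thesis by (rule main[OF iR(2) QS(2) R False])
          next
            assume c: "3 \<le> card (good_A w)"
            show ?thesis by (rule main[OF w(1) wb(2) _ F2 c]) (use R in auto)
          qed
        qed
      qed
    qed
  qed
qed

end

section \<open>Assembly of the induction and translation to the given notions\<close>

lemma near_path_step:
  assumes T: "near_path_at TYPE('a) m" and m7: "7 \<le> m" and n8: "nfaults FV FE V E + 8 \<le> 2 * m"
    and le: "fB \<le> fA"
    and s: "s \<in> V - FV" and t: "t \<in> V - FV" and ne: "s \<noteq> t"
    and ns: "\<exists>z\<in>good_nbrs FV FE V E s. z \<noteq> t" and nt: "\<exists>z\<in>good_nbrs FV FE V E t. z \<noteq> s"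
  shows "near_path Eg (V - FV) s t"
proof -
  have sm: "fA + fB + ncross + 8 \<le> 2 * m" using n8 nfaults_split by simp
  have NC: "near_cycle_at TYPE('a) m" by (rule thln_near_cycle[OF m7])
  have pos: "s \<in> A - FV \<or> s \<in> B - FV" "t \<in> A - FV \<or> t \<in> B - FV" using s t V by auto
  show ?thesis
  proof (cases "fA + 10 \<le> 2 * m")
    case True
    note L = m7 n8 le T True
    show ?thesis
      using pos step_AA[OF L _ _ ne ns nt] step_AB[OF L _ _ ns] near_path_rev[OF step_AB[OF L _ _ nt]] step_BB[OF L _ _ ne] by blast
  next
    case False
    have b1: "fB + ncross \<le> 1" using False sm by linarith
    note L = m7 sm b1
    have AA: "near_path Eg (V - FV) s t" if st: "s \<in> A - FV" "t \<in> A - FV"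
    proof -
      \<comment> \<open>The successors display the faults to be ignored: one in the first case and
        two in the second, where no fault is left outside \<open>A\<close>.\<close>
      consider "fA = Suc (2 * m - 10)" | "fA = Suc (2 * m - 9)" "fB = 0" "ncross = 0"
        using False sm m7 by linarith
      then show ?thesis
      proof cases
        case 1 then show ?thesis by (rule crowded_AA_one[OF L T _ st ne ns nt n8 le])
      next
        case 2 then show ?thesis by (rule crowded_AA_two[OF L T _ _ _ st ne n8 le])
      qed
    qed
    show ?thesis
      using pos AA crowded_AB[OF L NC _ _ ns] near_path_rev[OF crowded_AB[OF L NC _ _ nt]] crowded_BB[OF L NC _ _ ne] by blast
  qed
qed

end

theorem thln_near_path:
  assumes "7 \<le> n" shows "near_path_at TYPE('a) n"
  using assms
proof (induction n rule: dec_induct)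
  case base
  show ?case unfolding near_path_at_def
  proof (intro allI impI)
    fix V :: "'a set" and E FV FE s t
    assume a: "thln 7 V E" "nfaults FV FE V E + 10 \<le> 2 * 7" "s \<in> V - FV" "t \<in> V - FV" "s \<noteq> t"
    then have "ham_conn (E - FE) (V - FV)" using thln_ham_conn_hcycle[where 'a='a, of 7] unfolding ham_conn_at_def by simp
    then have "hpath (E - FE) (V - FV) s t" by (rule ham_connD[OF _ a(3-5)])
    then show "near_path (E - FE) (V - FV) s t" unfolding near_path_def by (intro exI[of _ "V - FV"]) auto
  qed
next
  case (step n)
  show ?case unfolding near_path_at_def
  proof (intro allI impI)
    fix V :: "'a set" and E FV FE s t
    assume th: "thln (Suc n) V E" and nn: "nfaults FV FE V E + 10 \<le> 2 * Suc n" and st: "s \<in> V - FV" "t \<in> V - FV" "s \<noteq> t"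
      "\<exists>z\<in>good_nbrs FV FE V E s. z \<noteq> t" "\<exists>z\<in>good_nbrs FV FE V E t. z \<noteq> s"
    have n3: "Suc n \<noteq> 3" using step.hyps by simp
    obtain m A EA B EB \<phi> where sp: "Suc n = Suc m" "thsplit m V E A EA B EB \<phi>" "nfaults FV FE B EB \<le> nfaults FV FE A EA"
      by (rule thln_wlog[OF th n3])
    have m: "m = n" using sp(1) by simp
    show "near_path (E - FE) (V - FV) s t"
      by (rule thsplit.near_path_step[OF sp(2) _ _ _ sp(3) st]) (use m step nn in auto)
  qed
qed

lemma hpath_is_path:
  assumes "hpath (E - FE) S s t" "S \<subseteq> V - FV"
  obtains p where "is_path (del_verts V FV) (del_edges V E FV FE) p" "hd p = s" "last p = t" "set p = S"
proof -
  obtain p where p: "p \<noteq> []" "distinct p" "set p = S" "hd p = s" "last p = t"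
    "successively (\<lambda>x y. {x, y} \<in> E - FE) p" using assms(1) unfolding hpath_def by blast
  have "{p ! i, p ! Suc i} \<in> del_edges V E FV FE" if i: "Suc i < length p" for i
  proof -
    have "{p ! i, p ! Suc i} \<in> E - FE" using p(6) i by (auto simp: successively_conv_nth)
    moreover have "p ! i \<in> set p" "p ! Suc i \<in> set p" using i by simp_all
    ultimately show ?thesis using p(3) assms(2) unfolding del_edges_def by auto
  qed
  then have "is_path (del_verts V FV) (del_edges V E FV FE) p"
    using p(1-3) assms(2) unfolding is_path_def del_verts_def by simp
  then show thesis using p that by blast
qed

theorem theorem1:
  fixes V :: "'a set" and E :: "'a set set" and FV :: "'a set" and FE :: "'a set set"
    and n :: nat and s t :: 'a
  assumes "n \<ge> 7"
    and "thln n V E"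
    and "FV \<subseteq> V" and "FE \<subseteq> E"
    and "card FV + card FE \<le> 2 * n - 10"
    and "s \<in> del_verts V FV" and "t \<in> del_verts V FV" and "s \<noteq> t"
    and "nbrs (del_edges V E FV FE) s - {t} \<noteq> {}"
    and "nbrs (del_edges V E FV FE) t - {s} \<noteq> {}"
  shows "ham_path_between (del_verts V FV) (del_edges V E FV FE) s t \<or>
         near_ham_path_between (del_verts V FV) (del_edges V E FV FE) s t"
proof -
  \<comment> \<open>The subtraction on natural numbers is exact since
    \<open>n \<ge> 7\<close>.\<close>
  have nfaults: "nfaults FV FE V E + 10 \<le> 2 * n"
    using assms(1,3,4,5) unfolding nfaults_def by (simp add: Int_absorb2)
  have st: "s \<in> V - FV" "t \<in> V - FV" using assms(6,7) unfolding del_verts_def .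
  have g: "nbrs (del_edges V E FV FE) u \<subseteq> good_nbrs FV FE V E u" for u
    unfolding nbrs_def del_edges_def good_nbrs_def by auto
  have gs: "\<exists>z\<in>good_nbrs FV FE V E s. z \<noteq> t" using assms(9) g[of s] by blast
  have gt: "\<exists>z\<in>good_nbrs FV FE V E t. z \<noteq> s" using assms(10) g[of t] by blast
  have "near_path (E - FE) (V - FV) s t"
    using thln_near_path[OF assms(1), unfolded near_path_at_def, rule_format, OF assms(2) nfaults st assms(8) gs gt] .
  then obtain S w where S: "S \<subseteq> V - FV" "hpath (E - FE) S s t" "V - FV \<subseteq> insert w S" unfolding near_path_def by blast
  obtain p where p: "is_path (del_verts V FV) (del_edges V E FV FE) p" "hd p = s" "last p = t" "set p = S"
    by (rule hpath_is_path[OF S(2,1)])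
  show ?thesis
  proof (cases "V - FV \<subseteq> S")
    case True
    then have "set p = del_verts V FV" using p(4) S(1) unfolding del_verts_def by auto
    then show ?thesis using p unfolding ham_path_between_def by blast
  next
    case False
    then have "w \<in> V - FV" "w \<notin> S" using S(3) by auto
    then have "w \<in> del_verts V FV" "set p = del_verts V FV - {w}"
      using p(4) S(1,3) unfolding del_verts_def by auto
    then show ?thesis using p unfolding near_ham_path_between_def by blast
  qed
qed

end
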